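(* Suppose $\mathbb{L}$ is irreducible, and assume: (TRI) there are anti-unitary involutions $\theta$ on $\mathcal{H}_{\mathcal S}$ and $\theta_\omega$ on $\mathcal{H}_{\mathcal E_\omega}$ such that $\theta_\omega H_{\mathcal E_\omega}=H_{\mathcal E_\omega}\theta_\omega$ and $(\theta\otimes\theta_\omega)U_\omega=U_\omega^*(\theta\otimes\theta_\omega)$ for all $\omega\in\Omega$; (DB) the Markov chain $(\pi,P)$ satisfies detailed balance: $\pi_\omega P_{\omega\nu}=\pi_\nu P_{\nu\omega}$ for all $\omega,\nu\in\Omega$. Then the rate function $I(\boldsymbol s)=\sup_{\boldsymbol\alpha\in\mathbb{R}^\Omega}(\boldsymbol\alpha\cdot\boldsymbol s-e(-\boldsymbol\alpha))$ of the large deviation principle for $\frac1NS_N\boldsymbol{\mathfrak{J}}$ under $\mathbb{Q}_{R_0}$ satisfies the fluctuation relation $$ I(-\boldsymbol s)-I(\boldsymbol s)=\mathbf 1\cdot\boldsymbol s\qquad\text{for all }\boldsymbol s\in\mathbb{R}^\Omega $$ (i.e. $I(-\boldsymbol s)=I(\boldsymbol s)+\mathbf 1\cdot\boldsymbol s$ in $[0,\infty]$), where $\mathbf 1=(1,\dots,1)$. This relation is associated with the symmetry $$ e(\mathbf 1-\boldsymbol\alpha)=e(\boldsymbol\alpha)\qquad\text{for all }\boldsymbol\alpha\in\mathbb{R}^\Omega . $$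
   Context: Setting. $\Omega$ is a finite nonempty set; $\mathcal{H}_{\mathcal S}$ and $\mathcal{H}_{\mathcal E_\omega}$ ($\omega\in\Omega$) are finite-dimensional nonzero complex Hilbert spaces; $H_{\mathcal S}$, $H_{\mathcal E_\omega}$, $V_\omega$ are self-adjoint operators on $\mathcal{H}_{\mathcal S}$, $\mathcal{H}_{\mathcal E_\omega}$, $\mathcal{H}_{\mathcal S}\otimes\mathcal{H}_{\mathcal E_\omega}$; $\tau_\omega>0$; $U_\omega=e^{-\mathrm i\tau_\omega(H_{\mathcal S}\otimes\mathbf 1+\mathbf 1\otimes H_{\mathcal E_\omega}+V_\omega)}$. The probes are thermal: for some $\beta_\omega>0$, $\rho_{\mathcal E_\omega}=e^{-\beta_\omega(H_{\mathcal E_\omega}-F_\omega)}$ with $F_\omega=-\beta_\omega^{-1}\log\mathrm{tr}\,e^{-\beta_\omega H_{\mathcal E_\omega}}$. $\mathcal{L}_\omega\rho=\mathrm{tr}_{\mathcal{H}_{\mathcal E_\omega}}(U_\omega(\rho\otimes\rho_{\mathcal E_\omega})U_\omega^* )$ on $\mathcal{B}(\mathcal{H}_{\mathcal S})$. $P$ is a right stochastic $\Omega\times\Omega$ matrix, $\pi$ a probability vector on $\Omega$. $\mathfrak{A}_*$: functions $R:\Omega\to\mathcal{B}(\mathcal{H}_{\mathcal S})$; an element is $\ge0$ ($>0$) if all its values are positive semidefinite (definite). Extended states $\mathfrak{A}_{*+1}$: $R\ge0$ with $\sum_\omega\mathrm{tr}R(\omega)=1$. $(\mathbb{L}R)(\omega)=\sum_\nu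 P_{\nu\omega}\mathcal{L}_\nu R(\nu)$. A positive linear map $\Phi$ is irreducible if for some $t>0$, $e^{t\Phi}Y>0$ for all $Y\ge0$, $Y\neq0$. Full statistics. $S_{\mathcal E_\omega}=-\log\rho_{\mathcal E_\omega}$; $\Pi_s(\omega)$ is its spectral projection for the eigenvalue $s$; $\Xi_\omega=\mathrm{sp}(S_{\mathcal E_\omega})\times\mathrm{sp}(S_{\mathcal E_\omega})$. For $\xi=(s,s')\in\Xi_\omega$: $\mathcal{L}_{\omega,\xi}\rho=e^{-s}\mathrm{tr}_{\mathcal{H}_{\mathcal E_\omega}}\big((\mathbf 1\otimes\Pi_{s'}(\omega))U_\omega(\rho\otimes\Pi_s(\omega))U_\omega^*\big)$ and $\delta\xi=s'-s$. $\mathfrak{X}=\bigcup_\omega\{\omega\}\times\Xi_\omega$, $\boldsymbol{\mathfrak{X}}=\mathfrak{X}^{\{1,2,\dots\}}$, $\boldsymbol x=(x_k)_{k\ge1}$, $x_k=(\omega_k,\xi_k)$, $\phi$ the left shift. For $R_0\in\mathfrak{A}_{*+1}$, $\mathbb{Q}_{R_0}$ (expectation $\mathbb{E}_{R_0}$) is the probability measure on $\boldsymbol{\mathfrak{X}}$ with cylinder probabilities $\mathbb{Q}_{R_0}([x_1\cdots x_n])=P_{\omega_1\omega_2}\cdots P_{\omega_{n-1}\omega_n}\mathrm{tr}(\mathcal{L}_{\omega_n,\xi_n}\cdots\mathcal{L}_{\omega_1,\xi_1}R_0(\omega_1))$. $\mathfrak{J}_\omega(\boldsymbol x)=1_{\{\omega_1=\omega\}}\delta\xi_1$,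 $\boldsymbol{\mathfrak{J}}=(\mathfrak{J}_\omega)_{\omega\in\Omega}$, $S_Nf=\sum_{k=0}^{N-1}f\circ\phi^k$. When $\mathbb{L}$ is irreducible, for every $R_0\in\mathfrak{A}_{*+1}$ the limit $e(\boldsymbol\alpha)=\lim_{N\to\infty}\frac1N\log\mathbb{E}_{R_0}[e^{-\boldsymbol\alpha\cdot S_N\boldsymbol{\mathfrak J}}]$ exists, does not depend on $R_0$, and equals $\log\ell(\boldsymbol\alpha)$, where $\ell(\boldsymbol\alpha)$ is the spectral radius of $(\mathbb{L}^{[\boldsymbol\alpha]}R)(\omega)=\sum_\nu P_{\nu\omega}\sum_{\xi\in\Xi_\nu}e^{-\alpha_\nu\delta\xi}\mathcal{L}_{\nu,\xi}R(\nu)$; and $\frac1NS_N\boldsymbol{\mathfrak{J}}$ satisfies under $\mathbb{Q}_{R_0}$ a large deviation principle with good rate function $I$ defined in the statement. *)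

theory Defs
  imports
    "HOL-Probability.Probability"
    "Jordan_Normal_Form.Schur_Decomposition"
    "Jordan_Normal_Form.Spectral_Radius"
begin

unbundle no vec_syntax
unbundle no inner_syntax

section \<open>Linear algebra on finite-dimensional complex Hilbert spaces\<close>

text \<open>
  A Hilbert space of dimension \<open>n\<close> is taken to be \<open>carrier_vec n\<close> over the complex numbers, with the
  inner product \<open>\<bullet>c\<close> (linear in its first argument); operators are matrices.  The space
  \<open>\<complex>\<^sup>m \<otimes> \<complex>\<^sup>n\<close> is \<open>carrier_vec (m * n)\<close>, where the product basis vector \<open>e\<^sub>i \<otimes> f\<^sub>j\<close> has
  index \<open>i * n + j\<close>.
\<close>

definition self_adjoint :: "complex mat \<Rightarrow> bool" where
  "self_adjoint A \<longleftrightarrow> mat_adjoint A = A"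

text \<open>The order on \<^typ>\<open>complex\<close> compares real parts and requires equal imaginary parts.\<close>

definition pos_semidef :: "complex mat \<Rightarrow> bool" where
  "pos_semidef A \<longleftrightarrow> square_mat A \<and>
     (\<forall>v \<in> carrier_vec (dim_row A). 0 \<le> (A *\<^sub>v v) \<bullet>c v)"

definition pos_def :: "complex mat \<Rightarrow> bool" where
  "pos_def A \<longleftrightarrow> square_mat A \<and>
     (\<forall>v \<in> carrier_vec (dim_row A). v \<noteq> 0\<^sub>v (dim_row A) \<longrightarrow> 0 < (A *\<^sub>v v) \<bullet>c v)"

definition mat_tr :: "complex mat \<Rightarrow> complex" where
  "mat_tr A = (\<Sum>i<dim_row A. A $$ (i, i))"

definition mat_sum :: "nat \<Rightarrow> ('i \<Rightarrow> complex mat) \<Rightarrow> 'i set \<Rightarrow> complex mat" where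
  "mat_sum n f I = mat n n (\<lambda>(i, j). \<Sum>k\<in>I. f k $$ (i, j))"

definition mat_exp :: "complex mat \<Rightarrow> complex mat" where
  "mat_exp A = mat (dim_row A) (dim_row A) (\<lambda>(i, j). \<Sum>k. (A ^\<^sub>m k) $$ (i, j) / fact k)"

text \<open>For a self-adjoint matrix this is the whole spectrum.\<close>

definition real_spectrum :: "complex mat \<Rightarrow> real set" where
  "real_spectrum A = {s. complex_of_real s \<in> spectrum A}"

text \<open>The orthogonal projection onto the eigenspace of \<open>A\<close> (self-adjoint) for the eigenvalue \<open>s\<close>.\<close>

definition spectral_projection :: "complex mat \<Rightarrow> real \<Rightarrow> complex mat" where
  "spectral_projection A s =
     (THE E. E \<in> carrier_mat (dim_row A) (dim_row A) \<and> E * E = E \<and> self_adjoint E \<and>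
        (\<forall>v \<in> carrier_vec (dim_row A). E *\<^sub>v v = v \<longleftrightarrow> A *\<^sub>v v = complex_of_real s \<cdot>\<^sub>v v))"

text \<open>Functional calculus for a positive definite matrix.\<close>

definition mat_log :: "complex mat \<Rightarrow> complex mat" where
  "mat_log A = mat_sum (dim_row A)
     (\<lambda>s. complex_of_real (ln s) \<cdot>\<^sub>m spectral_projection A s) (real_spectrum A)"

definition kron :: "complex mat \<Rightarrow> complex mat \<Rightarrow> complex mat" where
  "kron A B = mat (dim_row A * dim_row B) (dim_col A * dim_col B)
     (\<lambda>(i, j). A $$ (i div dim_row B, j div dim_col B) * B $$ (i mod dim_row B, j mod dim_col B))"

text \<open>Partial trace of an operator on \<open>\<complex>\<^sup>m \<otimes> \<complex>\<^sup>n\<close> over the second factor.\<close>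

definition partial_tr :: "nat \<Rightarrow> nat \<Rightarrow> complex mat \<Rightarrow> complex mat" where
  "partial_tr m n A = mat m m (\<lambda>(i, j). \<Sum>k<n. A $$ (i * n + k, j * n + k))"

definition antiunitary_involution :: "nat \<Rightarrow> (complex vec \<Rightarrow> complex vec) \<Rightarrow> bool" where
  "antiunitary_involution n \<theta> \<longleftrightarrow>
     (\<forall>v \<in> carrier_vec n. \<theta> v \<in> carrier_vec n) \<and>
     (\<forall>u \<in> carrier_vec n. \<forall>v \<in> carrier_vec n. \<theta> (u + v) = \<theta> u + \<theta> v) \<and>
     (\<forall>c. \<forall>v \<in> carrier_vec n. \<theta> (c \<cdot>\<^sub>v v) = cnj c \<cdot>\<^sub>v \<theta> v) \<and>
     (\<forall>u \<in> carrier_vec n. \<forall>v \<in> carrier_vec n. \<theta> u \<bullet>c \<theta> v = cnj (u \<bullet>c v)) \<and>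
     (\<forall>v \<in> carrier_vec n. \<theta> (\<theta> v) = v)"

text \<open>
  The antilinear map on \<open>\<complex>\<^sup>m \<otimes> \<complex>\<^sup>n\<close> with \<open>u \<otimes> v \<mapsto> \<theta> u \<otimes> \<eta> v\<close>, for antilinear \<open>\<theta>\<close> and \<open>\<eta>\<close>:
  \<open>\<Sum> \<psi>\<^sub>i\<^sub>j (e\<^sub>i \<otimes> f\<^sub>j)\<close> is sent to \<open>\<Sum> cnj \<psi>\<^sub>i\<^sub>j (\<theta> e\<^sub>i \<otimes> \<eta> f\<^sub>j)\<close>.
\<close>

definition antilinear_tensor ::
    "nat \<Rightarrow> nat \<Rightarrow> (complex vec \<Rightarrow> complex vec) \<Rightarrow> (complex vec \<Rightarrow> complex vec)
      \<Rightarrow> complex vec \<Rightarrow> complex vec" where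
  "antilinear_tensor m n \<theta> \<eta> \<psi> = Matrix.vec (m * n) (\<lambda>k.
     \<Sum>i<m. \<Sum>j<n. cnj (\<psi> $ (i * n + j)) *
       (\<theta> (unit_vec m i) $ (k div n) * \<eta> (unit_vec n j) $ (k mod n)))"

section \<open>Markovian repeated interaction systems with thermal probes\<close>

text \<open>
  The finite nonempty set \<open>\<Omega>\<close> is the type \<^typ>\<open>'w::finite\<close>, and \<open>\<real>\<^sup>\<Omega>\<close> is \<^typ>\<open>'w \<Rightarrow> real\<close>.
\<close>

record 'w ris =
  dim_S :: nat
  dim_E :: "'w \<Rightarrow> nat"
  H_S :: "complex mat"
  H_E :: "'w \<Rightarrow> complex mat"
  V_int :: "'w \<Rightarrow> complex mat"
  tau :: "'w \<Rightarrow> real"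
  inv_temp :: "'w \<Rightarrow> real"
  P_mat :: "'w \<Rightarrow> 'w \<Rightarrow> real"
  pi_vec :: "'w \<Rightarrow> real"

definition is_ris :: "'w::finite ris \<Rightarrow> bool" where
  "is_ris D \<longleftrightarrow>
     0 < dim_S D \<and> (\<forall>\<omega>. 0 < dim_E D \<omega>) \<and>
     H_S D \<in> carrier_mat (dim_S D) (dim_S D) \<and> self_adjoint (H_S D) \<and>
     (\<forall>\<omega>. H_E D \<omega> \<in> carrier_mat (dim_E D \<omega>) (dim_E D \<omega>) \<and> self_adjoint (H_E D \<omega>)) \<and>
     (\<forall>\<omega>. V_int D \<omega> \<in> carrier_mat (dim_S D * dim_E D \<omega>) (dim_S D * dim_E D \<omega>) \<and>
        self_adjoint (V_int D \<omega>)) \<and>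
     (\<forall>\<omega>. 0 < tau D \<omega>) \<and> (\<forall>\<omega>. 0 < inv_temp D \<omega>) \<and>
     (\<forall>\<omega> \<nu>. 0 \<le> P_mat D \<omega> \<nu>) \<and> (\<forall>\<omega>. (\<Sum>\<nu>\<in>UNIV. P_mat D \<omega> \<nu>) = 1) \<and>
     (\<forall>\<omega>. 0 \<le> pi_vec D \<omega>) \<and> (\<Sum>\<omega>\<in>UNIV. pi_vec D \<omega>) = 1"

definition U_op :: "'w ris \<Rightarrow> 'w \<Rightarrow> complex mat" where
  "U_op D \<omega> = mat_exp ((- \<i> * complex_of_real (tau D \<omega>)) \<cdot>\<^sub>m
     (kron (H_S D) (1\<^sub>m (dim_E D \<omega>)) + kron (1\<^sub>m (dim_S D)) (H_E D \<omega>) + V_int D \<omega>))"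

definition free_energy :: "'w ris \<Rightarrow> 'w \<Rightarrow> real" where
  "free_energy D \<omega> =
     - ln (Re (mat_tr (mat_exp (complex_of_real (- inv_temp D \<omega>) \<cdot>\<^sub>m H_E D \<omega>)))) / inv_temp D \<omega>"

definition rho_E :: "'w ris \<Rightarrow> 'w \<Rightarrow> complex mat" where
  "rho_E D \<omega> = mat_exp (complex_of_real (- inv_temp D \<omega>) \<cdot>\<^sub>m
     (H_E D \<omega> - complex_of_real (free_energy D \<omega>) \<cdot>\<^sub>m 1\<^sub>m (dim_E D \<omega>)))"

definition L_map :: "'w ris \<Rightarrow> 'w \<Rightarrow> complex mat \<Rightarrow> complex mat" where
  "L_map D \<omega> \<rho> = partial_tr (dim_S D) (dim_E D \<omega>)
     (U_op D \<omega> * kron \<rho> (rho_E D \<omega>) * mat_adjoint (U_op D \<omega>))"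

definition ext_obs :: "'w ris \<Rightarrow> ('w \<Rightarrow> complex mat) set" where
  "ext_obs D = {R. \<forall>\<omega>. R \<omega> \<in> carrier_mat (dim_S D) (dim_S D)}"

definition ext_states :: "'w::finite ris \<Rightarrow> ('w \<Rightarrow> complex mat) set" where
  "ext_states D =
     {R \<in> ext_obs D. (\<forall>\<omega>. pos_semidef (R \<omega>)) \<and> (\<Sum>\<omega>\<in>UNIV. mat_tr (R \<omega>)) = 1}"

definition ext_L :: "'w::finite ris \<Rightarrow> ('w \<Rightarrow> complex mat) \<Rightarrow> 'w \<Rightarrow> complex mat" where
  "ext_L D R \<omega> =
     mat_sum (dim_S D) (\<lambda>\<nu>. complex_of_real (P_mat D \<nu> \<omega>) \<cdot>\<^sub>m L_map D \<nu> (R \<nu>)) UNIV"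

text \<open>\<open>e\<^sup>t\<^sup>\<Phi> Y\<close> for a linear map \<open>\<Phi>\<close> on \<^const>\<open>ext_obs\<close>, as a power series.\<close>

definition exp_map ::
    "'w ris \<Rightarrow> real \<Rightarrow> (('w \<Rightarrow> complex mat) \<Rightarrow> 'w \<Rightarrow> complex mat)
      \<Rightarrow> ('w \<Rightarrow> complex mat) \<Rightarrow> 'w \<Rightarrow> complex mat" where
  "exp_map D t \<Phi> Y \<omega> = mat (dim_S D) (dim_S D)
     (\<lambda>(i, j). \<Sum>k. complex_of_real (t ^ k / fact k) * (\<Phi> ^^ k) Y \<omega> $$ (i, j))"

definition irreducible_map ::
    "'w ris \<Rightarrow> (('w \<Rightarrow> complex mat) \<Rightarrow> 'w \<Rightarrow> complex mat) \<Rightarrow> bool" where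
  "irreducible_map D \<Phi> \<longleftrightarrow> (\<exists>t>0. \<forall>Y \<in> ext_obs D.
     (\<forall>\<omega>. pos_semidef (Y \<omega>)) \<and> (\<exists>\<omega>. Y \<omega> \<noteq> 0\<^sub>m (dim_S D) (dim_S D)) \<longrightarrow>
     (\<forall>\<omega>. pos_def (exp_map D t \<Phi> Y \<omega>)))"

section \<open>Full statistics of entropy\<close>

definition S_E :: "'w ris \<Rightarrow> 'w \<Rightarrow> complex mat" where
  "S_E D \<omega> = - mat_log (rho_E D \<omega>)"

definition Xi :: "'w ris \<Rightarrow> 'w \<Rightarrow> (real \<times> real) set" where
  "Xi D \<omega> = real_spectrum (S_E D \<omega>) \<times> real_spectrum (S_E D \<omega>)"

definition L_xi :: "'w ris \<Rightarrow> 'w \<Rightarrow> real \<times> real \<Rightarrow> complex mat \<Rightarrow> complex mat" where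
  "L_xi D \<omega> \<xi> \<rho> = (case \<xi> of (s, s') \<Rightarrow>
     complex_of_real (exp (- s)) \<cdot>\<^sub>m partial_tr (dim_S D) (dim_E D \<omega>)
       (kron (1\<^sub>m (dim_S D)) (spectral_projection (S_E D \<omega>) s') *
        (U_op D \<omega> * kron \<rho> (spectral_projection (S_E D \<omega>) s) * mat_adjoint (U_op D \<omega>))))"

type_synonym 'w outcome = "'w \<times> (real \<times> real)"

definition outcomes :: "'w ris \<Rightarrow> 'w outcome set" where
  "outcomes D = (SIGMA \<omega>:UNIV. Xi D \<omega>)"

definition cylinder_prob ::
    "'w ris \<Rightarrow> ('w \<Rightarrow> complex mat) \<Rightarrow> 'w outcome list \<Rightarrow> real" where
  "cylinder_prob D R\<^sub>0 xs =
     (\<Prod>i<length xs - 1. P_mat D (fst (xs ! i)) (fst (xs ! Suc i))) *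
     Re (mat_tr (fold (\<lambda>(\<omega>, \<xi>) \<rho>. L_xi D \<omega> \<xi> \<rho>) xs (R\<^sub>0 (fst (hd xs)))))"

text \<open>
  \<open>Q\<close> is the probability measure associated with the extended state \<open>R\<^sub>0\<close>.  Sequences \<open>(x\<^sub>1, x\<^sub>2, \<dots>)\<close> of outcomes are streams, so
  that \<open>x\<^sub>1\<close> is \<^const>\<open>shd\<close> and the left shift is \<^const>\<open>stl\<close>.  Existence and uniqueness of \<open>Q\<close> for
  each extended state \<open>R\<^sub>0\<close> are the Kolmogorov extension theorem.
\<close>

definition full_statistics ::
    "'w ris \<Rightarrow> ('w \<Rightarrow> complex mat) \<Rightarrow> 'w outcome stream measure \<Rightarrow> bool" where
  "full_statistics D R\<^sub>0 Q \<longleftrightarrow>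
     prob_space Q \<and>
     sets Q = sets (stream_space (count_space (outcomes D))) \<and>
     (\<forall>xs. xs \<noteq> [] \<and> set xs \<subseteq> outcomes D \<longrightarrow>
        measure Q {x \<in> space Q. stake (length xs) x = xs} = cylinder_prob D R\<^sub>0 xs)"

definition entropy_flux :: "'w \<Rightarrow> 'w outcome stream \<Rightarrow> real" where
  "entropy_flux \<omega> x = (case shd x of (\<omega>\<^sub>1, (s, s')) \<Rightarrow> if \<omega>\<^sub>1 = \<omega> then s' - s else 0)"

definition birkhoff_sum :: "nat \<Rightarrow> ('a stream \<Rightarrow> real) \<Rightarrow> 'a stream \<Rightarrow> real" where
  "birkhoff_sum N f x = (\<Sum>k<N. f ((stl ^^ k) x))"

definition scaled_cumulant ::
    "'w::finite outcome stream measure \<Rightarrow> nat \<Rightarrow> ('w \<Rightarrow> real) \<Rightarrow> real" where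
  "scaled_cumulant Q N \<alpha> = (1 / real N) *
     ln (\<integral>x. exp (- (\<Sum>\<omega>\<in>UNIV. \<alpha> \<omega> * birkhoff_sum N (entropy_flux \<omega>) x)) \<partial>Q)"

definition e_fun :: "'w::finite outcome stream measure \<Rightarrow> ('w \<Rightarrow> real) \<Rightarrow> real" where
  "e_fun Q \<alpha> = lim (\<lambda>N. scaled_cumulant Q N \<alpha>)"

definition rate_fun :: "'w::finite outcome stream measure \<Rightarrow> ('w \<Rightarrow> real) \<Rightarrow> ereal" where
  "rate_fun Q s = (SUP \<alpha>. ereal ((\<Sum>\<omega>\<in>UNIV. \<alpha> \<omega> * s \<omega>) - e_fun Q (\<lambda>\<omega>. - \<alpha> \<omega>)))"

section \<open>Time-reversal invariance and detailed balance\<close>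

definition time_reversal_invariant :: "'w ris \<Rightarrow> bool" where
  "time_reversal_invariant D \<longleftrightarrow>
     (\<exists>\<theta> \<theta>\<^sub>E. antiunitary_involution (dim_S D) \<theta> \<and>
        (\<forall>\<omega>. antiunitary_involution (dim_E D \<omega>) (\<theta>\<^sub>E \<omega>) \<and>
          (\<forall>v \<in> carrier_vec (dim_E D \<omega>). \<theta>\<^sub>E \<omega> (H_E D \<omega> *\<^sub>v v) = H_E D \<omega> *\<^sub>v \<theta>\<^sub>E \<omega> v) \<and>
          (\<forall>\<psi> \<in> carrier_vec (dim_S D * dim_E D \<omega>).
             antilinear_tensor (dim_S D) (dim_E D \<omega>) \<theta> (\<theta>\<^sub>E \<omega>) (U_op D \<omega> *\<^sub>v \<psi>) =
             mat_adjoint (U_op D \<omega>) *\<^sub>v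
               antilinear_tensor (dim_S D) (dim_E D \<omega>) \<theta> (\<theta>\<^sub>E \<omega>) \<psi>)))"

definition detailed_balance :: "'w ris \<Rightarrow> bool" where
  "detailed_balance D \<longleftrightarrow>
     (\<forall>\<omega> \<nu>. pi_vec D \<omega> * P_mat D \<omega> \<nu> = pi_vec D \<nu> * P_mat D \<nu> \<omega>)"

end

theory Submission
  imports Defs
begin

text \<open>
  In the Heisenberg picture, the moment generating function at time \<open>N\<close> of the entropy fluxes in the
  state \<open>R\<^sub>0\<close> is the trace pairing of \<open>R\<^sub>0\<close> with the \<open>N\<close>-th iterate \<open>X\<^sub>N\<close> of the dual of the tilted map,
  started from the identity.  Instead of a Perron-Frobenius eigenvalue, the growth rate is obtained from
  Fekete's lemma: as \<open>X\<^sub>N \<le> tr X\<^sub>N \<cdot> 1\<close>, the total trace of \<open>X\<^sub>N\<close> is submultiplicative.  Irreducibility, in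
  the form \<open>e\<^sup>t\<^sup>\<Phi> R\<^sub>0 \<ge> c \<cdot> 1\<close>, shows that pairing \<open>X\<^sub>N\<close> with \<open>R\<^sub>0\<close> or with any other nonzero positive element
  has the same growth rate.  For the element \<open>\<pi>\<^sub>\<omega> \<cdot> 1\<close>, time reversal and detailed balance turn the pairing
  at \<open>\<alpha>\<close> into the one at \<open>1 - \<alpha>\<close> exactly, for every \<open>N\<close>, so the two growth rates agree.
\<close>

section \<open>Unitary diagonalization of self-adjoint matrices\<close>

text \<open>Irreducibility concerns the untilted map L alone, while rates are needed at every tilt,
  and the comparison constant must not depend on N. Both points are settled by estimating tr(X_N
  e^{tL} R) from two sides. It is at least c tr X_N, as e^{tL} R >= c. It is at most a constant
  times tr(X_N R): the finitely many weights are bounded away from 0, so each power of L is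
  dominated by the tilted one at the cost of a factor C per step, and each further Heisenberg step
  enlarges the pairing by at most the total trace of X_1; the exponential series then sums to a
  constant. The symmetry is exact for a local reason. A probe measured first in s and then in s'
  starts with Gibbs weight e^{-s}; reversal exchanges s and s', and -a(s' - s) - s = -(1 - a)(s -
  s') - s'. Reversal also reverses the order of interactions and jumps of the chain. This leaves one
  averaging with P at the wrong end, which stationarity of \<pi> removes. Positivity and order are
  tested by traces against positive semidefinite matrices, the form in which duality transports
  them.\<close>

lemma mat_adjoint_index [simp]:
  fixes A :: "complex mat"
  shows "i < dim_col A \<Longrightarrow> j < dim_row A \<Longrightarrow> mat_adjoint A $$ (i, j) = cnj (A $$ (j, i))"
  by (simp add: mat_adjoint_def mat_of_rows_def)

lemma mat_adjoint_dim [simp]: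
  fixes A :: "complex mat"
  shows "dim_row (mat_adjoint A) = dim_col A" "dim_col (mat_adjoint A) = dim_row A"
  by (simp_all add: mat_adjoint_def)

lemma mat_adjoint_carrier [simp]:
  fixes A :: "complex mat"
  shows "A \<in> carrier_mat m n \<Longrightarrow> mat_adjoint A \<in> carrier_mat n m"
  by (intro carrier_matI) simp_all

lemma mult_mat_index:
  "i < dim_row A \<Longrightarrow> j < dim_col B \<Longrightarrow> dim_col A = dim_row B \<Longrightarrow>
    (A * B) $$ (i, j) = (\<Sum>k<dim_row B. A $$ (i, k) * B $$ (k, j))"
  by (simp add: scalar_prod_def atLeast0LessThan)

lemma mult_mat_vec_index:
  "i < dim_row A \<Longrightarrow> dim_col A = dim_vec v \<Longrightarrow>
    (A *\<^sub>v v) $ i = (\<Sum>k<dim_vec v. A $$ (i, k) * v $ k)"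
  by (simp add: scalar_prod_def atLeast0LessThan)

lemma cscalar_prod_sum:
  fixes u v :: "complex vec"
  shows "dim_vec u = dim_vec v \<Longrightarrow> u \<bullet>c v = (\<Sum>k<dim_vec v. u $ k * cnj (v $ k))"
  by (simp add: scalar_prod_def atLeast0LessThan)

lemma mat_adjoint_adjoint [simp]:
  fixes A :: "complex mat"
  shows "mat_adjoint (mat_adjoint A) = A"
  by (rule eq_matI) auto

lemma mat_adjoint_mult:
  fixes A B :: "complex mat"
  assumes "dim_col A = dim_row B"
  shows "mat_adjoint (A * B) = mat_adjoint B * mat_adjoint A"
  by (rule eq_matI) (use assms in \<open>auto simp: mult_mat_index mult.commute simp del: index_mult_mat(1)\<close>)

lemma mat_adjoint_one [simp]: "mat_adjoint (1\<^sub>m n :: complex mat) = 1\<^sub>m n"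
  by (rule eq_matI) auto

lemma mat_adjoint_cscalar_prod:
  fixes A :: "complex mat"
  assumes "A \<in> carrier_mat n n" "u \<in> carrier_vec n" "v \<in> carrier_vec n"
  shows "(A *\<^sub>v u) \<bullet>c v = u \<bullet>c (mat_adjoint A *\<^sub>v v)"
proof -
  have "(A *\<^sub>v u) \<bullet>c v = (\<Sum>k<n. \<Sum>l<n. A $$ (k, l) * u $ l * cnj (v $ k))"
    using assms by (simp add: cscalar_prod_sum mult_mat_vec_index sum_distrib_right carrier_vecD del: index_mult_mat_vec)
  also have "\<dots> = (\<Sum>l<n. \<Sum>k<n. A $$ (k, l) * u $ l * cnj (v $ k))"
    by (rule sum.swap)
  also have "\<dots> = u \<bullet>c (mat_adjoint A *\<^sub>v v)"
    using assms by (simp add: cscalar_prod_sum mult_mat_vec_index sum_distrib_left carrier_vecD mult_ac del: index_mult_mat_vec)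
  finally show ?thesis .
qed

definition unitary :: "nat \<Rightarrow> complex mat \<Rightarrow> bool" where
  "unitary n W \<longleftrightarrow> W \<in> carrier_mat n n \<and> mat_adjoint W * W = 1\<^sub>m n \<and> W * mat_adjoint W = 1\<^sub>m n"

lemma unitaryI:
  assumes "W \<in> carrier_mat n n" "mat_adjoint W * W = 1\<^sub>m n"
  shows "unitary n W"
  using assms mat_mult_left_right_inverse[of "mat_adjoint W" n W] by (simp add: unitary_def)

lemma cscalar_prod_self:
  fixes u :: "complex vec"
  shows "u \<bullet>c u = complex_of_real (\<Sum>k<dim_vec u. (cmod (u $ k))\<^sup>2)"
  by (simp only: cscalar_prod_sum of_real_sum complex_norm_square)

text \<open>A basis extending \<open>v\<close> is orthogonalised by Gram-Schmidt, which keeps its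
  first vector; dividing the columns by their norms \<open>r\<close> makes the matrix unitary. In
  \<open>spectral_theorem\<close> this is the change of basis that splits off an
  eigenvector.\<close>

lemma unitary_with_first_column:
  fixes v :: "complex vec"
  assumes v: "v \<in> carrier_vec n" and v0: "v \<noteq> 0\<^sub>v n"
  obtains U c where "unitary n U" "col U 0 = c \<cdot>\<^sub>v v"
proof -
  interpret cof_vec_space n "TYPE(complex)" .
  define b where "b = basis_completion v"
  define ws where "ws = gram_schmidt n b"
  from basis_completion[OF v v0, folded b_def]
  have dist_b: "distinct b" and indep: "\<not> lin_dep (set b)" and b: "set b \<subseteq> carrier_vec n"
    and hdb: "hd b = v" and len_b: "length b = n" by auto
  have n: "0 < n" using v v0 by (cases n) auto
  from hdb len_b n obtain vs where bv: "b = v # vs" by (cases b) auto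
  from gram_schmidt_result[OF b dist_b indep refl, folded ws_def]
  have ws: "set ws \<subseteq> carrier_vec n" "corthogonal ws" "length ws = n"
    by (auto simp: len_b)
  from gram_schmidt_hd[OF v, of vs, folded bv] have hdws: "hd ws = v" unfolding ws_def .
  have ws0: "ws ! 0 = v" using hdws ws(3) n by (metis hd_conv_nth length_greater_0_conv)
  have wsc: "ws ! i \<in> carrier_vec n" if "i < n" for i using ws that by auto
  define r where "r i = sqrt (\<Sum>k<n. (cmod (ws ! i $ k))\<^sup>2)" for i
  define U where "U = mat n n (\<lambda>(i, j). ws ! j $ i / complex_of_real (r j))"
  have self: "ws ! i \<bullet>c ws ! i = complex_of_real (r i) * complex_of_real (r i)" if "i < n" for i
    using wsc[OF that] 
    by (simp add: cscalar_prod_self r_def sum_nonneg flip: of_real_mult del: of_real_sum)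
  have r0: "r i \<noteq> 0" if "i < n" for i
    using corthogonalD[OF ws(2), of i i] that ws(3) self[OF that] by auto
  have "mat_adjoint U * U = 1\<^sub>m n"
  proof (rule eq_matI)
    fix i j assume "i < dim_row (1\<^sub>m n :: complex mat)" "j < dim_col (1\<^sub>m n :: complex mat)"
    hence ij: "i < n" "j < n" by auto
    have "(mat_adjoint U * U) $$ (i, j) =
      (\<Sum>k<n. ws ! j $ k * cnj (ws ! i $ k)) / (complex_of_real (r i) * complex_of_real (r j))"
      using ij by (simp add: mult_mat_index U_def sum_divide_distrib mult_ac del: index_mult_mat(1))
    also have "(\<Sum>k<n. ws ! j $ k * cnj (ws ! i $ k)) = ws ! j \<bullet>c ws ! i"
      using ij wsc[of i] wsc[of j] by (simp add: cscalar_prod_sum carrier_vecD)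
    also have "\<dots> / (complex_of_real (r i) * complex_of_real (r j)) = 1\<^sub>m n $$ (i, j)"
    proof (cases "i = j")
      case True
      thus ?thesis using ij self[of i] r0[of i] by simp
    next
      case False
      thus ?thesis using ij corthogonalD[OF ws(2), of j i] ws(3) by simp
    qed
    finally show "(mat_adjoint U * U) $$ (i, j) = 1\<^sub>m n $$ (i, j)" .
  qed (auto simp: U_def)
  hence "unitary n U" by (intro unitaryI) (auto simp: U_def)
  moreover have "col U 0 = (1 / complex_of_real (r 0)) \<cdot>\<^sub>v v"
    by (rule eq_vecI) (use n v in \<open>auto simp: U_def ws0\<close>)
  ultimately show thesis by (rule that)
qed

lemma unitary_conj_eq_iff:
  assumes U: "unitary n U" and A: "A \<in> carrier_mat n n" and B: "B \<in> carrier_mat n n"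
  shows "B = mat_adjoint U * A * U \<longleftrightarrow> A = U * B * mat_adjoint U"
proof -
  have c: "U \<in> carrier_mat n n" "mat_adjoint U \<in> carrier_mat n n"
    and i: "mat_adjoint U * U = 1\<^sub>m n" "U * mat_adjoint U = 1\<^sub>m n"
    using U by (auto simp: unitary_def)
  have "U * (mat_adjoint U * A * U) * mat_adjoint U = (U * mat_adjoint U) * A * (U * mat_adjoint U)"
    using c A by (simp add: assoc_mult_mat[of _ n n _ n _ n] mult_carrier_mat[of _ n n _ n])
  moreover have "mat_adjoint U * (U * B * mat_adjoint U) * U = (mat_adjoint U * U) * B * (mat_adjoint U * U)"
    using c B by (simp add: assoc_mult_mat[of _ n n _ n _ n] mult_carrier_mat[of _ n n _ n])
  ultimately show ?thesis using i A B by auto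
qed

text \<open>The block-diagonal sum of the scalar \<open>c\<close> and the matrix \<open>A\<close>;
  row and column 0 belong to \<open>c\<close>, hence the shift by 1.\<close>

definition bordered :: "nat \<Rightarrow> complex \<Rightarrow> complex mat \<Rightarrow> complex mat" where
  "bordered m c A = mat (Suc m) (Suc m)
     (\<lambda>(i, j). if i = 0 \<and> j = 0 then c else if i = 0 \<or> j = 0 then 0 else A $$ (i - 1, j - 1))"

lemma bordered_mult:
  assumes "A \<in> carrier_mat m m" "B \<in> carrier_mat m m"
  shows "bordered m a A * bordered m b B = bordered m (a * b) (A * B)"
proof (rule eq_matI)
  fix i j assume "i < dim_row (bordered m (a * b) (A * B))" "j < dim_col (bordered m (a * b) (A * B))"
  hence "i < Suc m" "j < Suc m" by (auto simp: bordered_def)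
  thus "(bordered m a A * bordered m b B) $$ (i, j) = bordered m (a * b) (A * B) $$ (i, j)"
    using assms
    by (cases i; cases j)
      (simp_all add: mult_mat_index bordered_def sum.lessThan_Suc_shift del: index_mult_mat(1) sum.lessThan_Suc)
qed (auto simp: bordered_def)

lemma bordered_adjoint:
  assumes "A \<in> carrier_mat m m"
  shows "mat_adjoint (bordered m a A) = bordered m (cnj a) (mat_adjoint A)"
  by (rule eq_matI) (use assms in \<open>auto simp: bordered_def\<close>)

lemma bordered_one: "bordered m 1 (1\<^sub>m m) = 1\<^sub>m (Suc m)"
  by (rule eq_matI) (auto simp: bordered_def)

definition real_diag :: "nat \<Rightarrow> (nat \<Rightarrow> real) \<Rightarrow> complex mat" where
  "real_diag n d = mat n n (\<lambda>(i, j). if i = j then complex_of_real (d i) else 0)"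

lemma real_diag_carrier [simp]: "real_diag n d \<in> carrier_mat n n"
  by (simp add: real_diag_def)

lemma unitary_mult:
  assumes "unitary n U" "unitary n V"
  shows "unitary n (U * V)"
proof (rule unitaryI)
  have c: "U \<in> carrier_mat n n" "mat_adjoint U \<in> carrier_mat n n"
     "V \<in> carrier_mat n n" "mat_adjoint V \<in> carrier_mat n n"
    and i: "mat_adjoint U * U = 1\<^sub>m n" "mat_adjoint V * V = 1\<^sub>m n"
    using assms by (auto simp: unitary_def)
  show "U * V \<in> carrier_mat n n" using c by simp
  have "mat_adjoint (U * V) * (U * V) = mat_adjoint V * (mat_adjoint U * U) * V"
    using c by (subst mat_adjoint_mult) (auto simp: assoc_mult_mat[of _ n n _ n _ n] mult_carrier_mat[of _ n n _ n])
  thus "mat_adjoint (U * V) * (U * V) = 1\<^sub>m n" using c i by simp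
qed

lemma self_adjoint_index:
  "self_adjoint A \<Longrightarrow> A \<in> carrier_mat n n \<Longrightarrow> i < n \<Longrightarrow> j < n \<Longrightarrow> A $$ (i, j) = cnj (A $$ (j, i))"
  by (metis carrier_matD mat_adjoint_index self_adjoint_def)

text \<open>Deflation by induction on the dimension: conjugating by a unitary whose first column is
  an eigenvector clears the first column below the diagonal. Self-adjointness then clears the first
  row and makes the eigenvalue real, and the remaining block is again self-adjoint.\<close>

theorem spectral_theorem:
  assumes "A \<in> carrier_mat n n" "self_adjoint A"
  obtains W d where "unitary n W" "A = W * real_diag n d * mat_adjoint W"
  using assms
proof (induction n arbitrary: A thesis)
  case 0
  show ?case
    by (rule 0(1)[of A "\<lambda>_. 0"]) (use 0 in \<open>auto simp: unitary_def intro!: eq_matI\<close>)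
next
  case (Suc m A)
  let ?n = "Suc m"
  note A = Suc.prems(2)
  from spectrum_non_empty[OF A] obtain e v where ev: "eigenvector A v e"
    by (auto simp: spectrum_def eigenvalue_def)
  hence v: "v \<in> carrier_vec ?n" and v0: "v \<noteq> 0\<^sub>v ?n" and Av: "A *\<^sub>v v = e \<cdot>\<^sub>v v"
    using A by (auto simp: eigenvector_def)
  obtain U c where U: "unitary ?n U" and U0: "col U 0 = c \<cdot>\<^sub>v v"
    using unitary_with_first_column[OF v v0] .
  have cU: "U \<in> carrier_mat ?n ?n" "mat_adjoint U \<in> carrier_mat ?n ?n"
    and iU: "mat_adjoint U * U = 1\<^sub>m ?n"
    using U by (auto simp: unitary_def)
  define B where "B = mat_adjoint U * A * U"
  have B: "B \<in> carrier_mat ?n ?n" using cU A by (auto simp: B_def)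
  have Bsa: "self_adjoint B"
    using Suc.prems(3) cU A
    by (simp add: self_adjoint_def B_def mat_adjoint_mult assoc_mult_mat[of _ ?n ?n _ ?n _ ?n] mult_carrier_mat[of _ ?n ?n _ ?n])
  \<comment> \<open>The first column of \<open>U\<close> is a multiple of the eigenvector, so column
    0 of \<open>B\<close> is \<open>e\<close> times column 0 of the identity.\<close>
  have B0: "B $$ (i, 0) = (if i = 0 then e else 0)" if i: "i < ?n" for i
  proof -
    have "B = mat_adjoint U * (A * U)" using cU A by (simp add: B_def assoc_mult_mat[of _ ?n ?n _ ?n _ ?n])
    hence "B $$ (i, 0) = (\<Sum>k<?n. mat_adjoint U $$ (i, k) * (A * U) $$ (k, 0))"
      using cU A i by (simp add: mult_mat_index del: index_mult_mat(1) sum.lessThan_Suc)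
    also have "\<dots> = (\<Sum>k<?n. mat_adjoint U $$ (i, k) * (e * U $$ (k, 0)))"
    proof (rule sum.cong)
      fix k assume "k \<in> {..<?n}"
      hence k: "k < ?n" by simp
      have "(A * U) $$ (k, 0) = (A *\<^sub>v col U 0) $ k" using k A cU by simp
      also have "A *\<^sub>v col U 0 = e \<cdot>\<^sub>v (c \<cdot>\<^sub>v v)"
        unfolding U0 using A v Av by (simp add: mult_mat_vec smult_smult_assoc mult.commute)
      also have "\<dots> $ k = e * U $$ (k, 0)"
        unfolding U0[symmetric] using k cU by simp
      finally show "mat_adjoint U $$ (i, k) * (A * U) $$ (k, 0) = mat_adjoint U $$ (i, k) * (e * U $$ (k, 0))"
        by simp
    qed simp
    also have "\<dots> = e * (mat_adjoint U * U) $$ (i, 0)"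
      using cU i by (simp add: mult_mat_index sum_distrib_left mult_ac del: index_mult_mat(1) sum.lessThan_Suc)
    finally show ?thesis using i by (simp add: iU)
  qed
  define C where "C = mat m m (\<lambda>(i, j). B $$ (Suc i, Suc j))"
  have C: "C \<in> carrier_mat m m" by (simp add: C_def)
  have Csa: "self_adjoint C"
    unfolding self_adjoint_def
  proof (rule eq_matI)
    fix i j assume "i < dim_row C" "j < dim_col C"
    thus "mat_adjoint C $$ (i, j) = C $$ (i, j)"
      using self_adjoint_index[OF Bsa B, of "Suc i" "Suc j"] by (simp add: C_def)
  qed (simp_all add: C_def)
  have eR: "e = complex_of_real (Re e)"
    using self_adjoint_index[OF Bsa B, of 0 0] B0[of 0] by (simp add: complex_eq_iff)
  have BC: "B = bordered m e C"
  proof (rule eq_matI)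
    fix i j assume "i < dim_row (bordered m e C)" "j < dim_col (bordered m e C)"
    hence ij: "i < ?n" "j < ?n" by (auto simp: bordered_def)
    consider "j = 0" | "i = 0" "j \<noteq> 0" | "i \<noteq> 0" "j \<noteq> 0" by blast
    thus "B $$ (i, j) = bordered m e C $$ (i, j)"
    proof cases
      case 1
      thus ?thesis using B0[OF ij(1)] ij by (simp add: bordered_def)
    next
      case 2
      thus ?thesis using B0[OF ij(2)] self_adjoint_index[OF Bsa B ij] ij by (simp add: bordered_def)
    next
      case 3
      then obtain i' j' where "i = Suc i'" "j = Suc j'" by (meson not0_implies_Suc)
      thus ?thesis using ij by (simp add: bordered_def C_def)
    qed
  qed (use B in \<open>auto simp: bordered_def\<close>)
  obtain V d where V: "unitary m V" and CV: "C = V * real_diag m d * mat_adjoint V"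
    using Suc.IH[OF _ C Csa] by blast
  have cV: "V \<in> carrier_mat m m" "mat_adjoint V \<in> carrier_mat m m"
    and iV: "mat_adjoint V * V = 1\<^sub>m m"
    using V by (auto simp: unitary_def)
  let ?V = "bordered m 1 V"
  let ?d = "\<lambda>i. if i = 0 then Re e else d (i - 1)"
  have uV: "unitary ?n ?V"
    by (rule unitaryI) (use cV iV in \<open>auto simp: bordered_adjoint bordered_mult bordered_one, auto simp: bordered_def\<close>)
  have "real_diag ?n ?d = bordered m e (real_diag m d)"
    by (subst eR, rule eq_matI) (auto simp: real_diag_def bordered_def)
  hence "B = ?V * real_diag ?n ?d * mat_adjoint ?V"
    using cV by (simp add: BC CV bordered_adjoint bordered_mult)
  hence "A = U * (?V * real_diag ?n ?d * mat_adjoint ?V) * mat_adjoint U"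
    using unitary_conj_eq_iff[OF U A B] B_def by simp
  also have "\<dots> = (U * ?V) * real_diag ?n ?d * (mat_adjoint ?V * mat_adjoint U)"
    using cU uV by (simp add: unitary_def assoc_mult_mat[of _ ?n ?n _ ?n _ ?n] mult_carrier_mat[of _ ?n ?n _ ?n])
  also have "mat_adjoint ?V * mat_adjoint U = mat_adjoint (U * ?V)"
    using cU uV by (intro mat_adjoint_mult[symmetric]) (auto simp: unitary_def)
  finally show ?case by (rule Suc.prems(1)[OF unitary_mult[OF U uV]])
qed

section \<open>Functional calculus\<close>

text \<open>For fixed \<open>W\<close> these matrices form a commutative algebra on which products,
  exponentials, logarithms and spectral projections act through the real function \<open>d\<close>
  alone. This is the functional calculus used below.\<close>

definition udiag :: "nat \<Rightarrow> complex mat \<Rightarrow> (nat \<Rightarrow> real) \<Rightarrow> complex mat" where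
  "udiag n W d = W * real_diag n d * mat_adjoint W"

lemma real_diag_dim [simp]: "dim_row (real_diag n d) = n" "dim_col (real_diag n d) = n"
  by (simp_all add: real_diag_def)

lemma unitary_carrier: "unitary n W \<Longrightarrow> W \<in> carrier_mat n n"
  by (simp add: unitary_def)

lemma udiag_carrier [simp]: "unitary n W \<Longrightarrow> udiag n W d \<in> carrier_mat n n"
  by (auto simp: udiag_def unitary_def intro!: mult_carrier_mat[of _ n n])

lemma udiag_index:
  assumes "unitary n W" "i < n" "j < n"
  shows "udiag n W d $$ (i, j) = (\<Sum>l<n. complex_of_real (d l) * W $$ (i, l) * cnj (W $$ (j, l)))"
proof -
  have W: "W \<in> carrier_mat n n" "W * real_diag n d \<in> carrier_mat n n"
    using assms by (auto simp: unitary_def intro!: mult_carrier_mat[of _ n n])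
  have "udiag n W d $$ (i, j) = (\<Sum>l<n. (W * real_diag n d) $$ (i, l) * cnj (W $$ (j, l)))"
    unfolding udiag_def using assms W by (subst mult_mat_index) auto
  also have "\<dots> = (\<Sum>l<n. complex_of_real (d l) * W $$ (i, l) * cnj (W $$ (j, l)))"
  proof (rule sum.cong)
    fix l assume l: "l \<in> {..<n}"
    have "(W * real_diag n d) $$ (i, l) = (\<Sum>k<n. if k = l then W $$ (i, k) * complex_of_real (d k) else 0)"
      using assms W l by (subst mult_mat_index; (simp; fail)?) (intro sum.cong, auto simp: real_diag_def)
    thus "(W * real_diag n d) $$ (i, l) * cnj (W $$ (j, l)) = complex_of_real (d l) * W $$ (i, l) * cnj (W $$ (j, l))"
      using l by simp
  qed simp
  finally show ?thesis .
qed

lemma real_diag_mult: "real_diag n d * real_diag n e = real_diag n (\<lambda>l. d l * e l)"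
proof (rule eq_matI)
  fix i j assume "i < dim_row (real_diag n (\<lambda>l. d l * e l))" "j < dim_col (real_diag n (\<lambda>l. d l * e l))"
  hence ij: "i < n" "j < n" by (auto simp: real_diag_def)
  have "(real_diag n d * real_diag n e) $$ (i, j) =
      (\<Sum>k<n. if k = i then (if i = j then complex_of_real (d i * e i) else 0) else 0)"
    using ij by (subst mult_mat_index; (simp; fail)?) (intro sum.cong, auto simp: real_diag_def)
  thus "(real_diag n d * real_diag n e) $$ (i, j) = real_diag n (\<lambda>l. d l * e l) $$ (i, j)"
    using ij by (simp add: real_diag_def)
qed (auto simp: real_diag_def)

lemma real_diag_adjoint [simp]: "mat_adjoint (real_diag n d) = real_diag n d"
  by (rule eq_matI) (auto simp: real_diag_def)

lemma udiag_mult: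
  assumes "unitary n W"
  shows "udiag n W d * udiag n W e = udiag n W (\<lambda>l. d l * e l)"
proof -
  let ?D = "real_diag n d" and ?E = "real_diag n e" and ?Wa = "mat_adjoint W"
  have c: "W \<in> carrier_mat n n" "?Wa \<in> carrier_mat n n" and i: "?Wa * W = 1\<^sub>m n"
    using assms by (auto simp: unitary_def)
  have "udiag n W d * udiag n W e = W * ?D * ((?Wa * W) * (?E * ?Wa))"
    using c by (simp add: udiag_def assoc_mult_mat[of _ n n _ n _ n] mult_carrier_mat[of _ n n _ n])
  also have "(?Wa * W) * (?E * ?Wa) = ?E * ?Wa"
    unfolding i by (rule left_mult_one_mat[of _ n n]) (use c in \<open>auto intro!: mult_carrier_mat[of _ n n]\<close>)
  also have "W * ?D * (?E * ?Wa) = W * (?D * ?E) * ?Wa"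
    using c by (simp add: assoc_mult_mat[of _ n n _ n _ n] mult_carrier_mat[of _ n n _ n])
  finally show ?thesis by (simp add: udiag_def real_diag_mult)
qed

lemma udiag_one:
  assumes "unitary n W"
  shows "udiag n W (\<lambda>_. 1) = 1\<^sub>m n"
proof -
  have "real_diag n (\<lambda>_. 1) = 1\<^sub>m n" by (rule eq_matI) (auto simp: real_diag_def)
  thus ?thesis using assms by (simp add: udiag_def unitary_def right_mult_one_mat[of _ n n])
qed

lemma udiag_cong: "(\<And>l. l < n \<Longrightarrow> d l = e l) \<Longrightarrow> udiag n W d = udiag n W e"
proof -
  assume "\<And>l. l < n \<Longrightarrow> d l = e l"
  hence "real_diag n d = real_diag n e" by (intro eq_matI) (auto simp: real_diag_def)
  thus ?thesis by (simp add: udiag_def)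
qed

lemma udiag_self_adjoint:
  assumes "unitary n W"
  shows "self_adjoint (udiag n W d)"
  unfolding self_adjoint_def
proof (rule eq_matI)
  fix i j assume "i < dim_row (udiag n W d)" "j < dim_col (udiag n W d)"
  hence ij: "i < n" "j < n" using udiag_carrier[OF assms, of d] by auto
  thus "mat_adjoint (udiag n W d) $$ (i, j) = udiag n W d $$ (i, j)"
    using assms by (simp add: udiag_index mult_ac carrier_matD[OF udiag_carrier[OF assms]])
qed (use udiag_carrier[OF assms, of d] in auto)

lemma udiag_smult:
  assumes "unitary n W"
  shows "complex_of_real c \<cdot>\<^sub>m udiag n W d = udiag n W (\<lambda>l. c * d l)"
  by (rule eq_matI) (use udiag_carrier[OF assms] assms in \<open>auto simp: udiag_index sum_distrib_left mult_ac carrier_matD[OF udiag_carrier[OF assms]]\<close>)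

lemma udiag_diff:
  assumes "unitary n W"
  shows "udiag n W d - udiag n W e = udiag n W (\<lambda>l. d l - e l)"
  by (rule eq_matI) (use assms in \<open>auto simp: udiag_index algebra_simps sum_subtractf carrier_matD[OF udiag_carrier[OF assms]]\<close>)

lemma udiag_mat_sum:
  assumes "unitary n W"
  shows "mat_sum n (\<lambda>k. complex_of_real (c k) \<cdot>\<^sub>m udiag n W (d k)) I = udiag n W (\<lambda>l. \<Sum>k\<in>I. c k * d k l)"
proof (rule eq_matI)
  fix i j assume "i < dim_row (udiag n W (\<lambda>l. \<Sum>k\<in>I. c k * d k l))" "j < dim_col (udiag n W (\<lambda>l. \<Sum>k\<in>I. c k * d k l))"
  hence ij: "i < n" "j < n" by (auto simp: carrier_matD[OF udiag_carrier[OF assms]])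
  have "mat_sum n (\<lambda>k. complex_of_real (c k) \<cdot>\<^sub>m udiag n W (d k)) I $$ (i, j) =
     (\<Sum>k\<in>I. \<Sum>l<n. complex_of_real (c k * d k l) * W $$ (i, l) * cnj (W $$ (j, l)))"
    using ij by (simp add: mat_sum_def udiag_index[OF assms] carrier_matD[OF udiag_carrier[OF assms]] sum_distrib_left mult_ac)
  also have "\<dots> = (\<Sum>l<n. \<Sum>k\<in>I. complex_of_real (c k * d k l) * W $$ (i, l) * cnj (W $$ (j, l)))"
    by (rule sum.swap)
  finally show "mat_sum n (\<lambda>k. complex_of_real (c k) \<cdot>\<^sub>m udiag n W (d k)) I $$ (i, j) =
     udiag n W (\<lambda>l. \<Sum>k\<in>I. c k * d k l) $$ (i, j)"
    using ij by (simp add: udiag_index[OF assms] sum_distrib_right)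
qed (auto simp: mat_sum_def carrier_matD[OF udiag_carrier[OF assms]])

lemma udiag_pow:
  assumes "unitary n W"
  shows "udiag n W d ^\<^sub>m k = udiag n W (\<lambda>l. d l ^ k)"
proof (induction k)
  case 0
  thus ?case by (simp add: udiag_one[OF assms] carrier_matD[OF udiag_carrier[OF assms]])
next
  case (Suc k)
  thus ?case by (simp add: udiag_mult[OF assms] mult.commute)
qed

lemma mat_exp_udiag:
  assumes "unitary n W"
  shows "mat_exp (udiag n W d) = udiag n W (\<lambda>l. exp (d l))"
proof (rule eq_matI)
  fix i j assume "i < dim_row (udiag n W (\<lambda>l. exp (d l)))" "j < dim_col (udiag n W (\<lambda>l. exp (d l)))"
  hence ij: "i < n" "j < n" by (auto simp: carrier_matD[OF udiag_carrier[OF assms]])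
  have s: "(\<lambda>k. complex_of_real (d l ^ k / fact k) * (W $$ (i, l) * cnj (W $$ (j, l))))
      sums (complex_of_real (exp (d l)) * (W $$ (i, l) * cnj (W $$ (j, l))))" for l
    using exp_converges[of "d l"] by (intro sums_mult2 sums_of_real) (simp add: divide_inverse mult.commute)
  have "(\<lambda>k. \<Sum>l<n. complex_of_real (d l ^ k / fact k) * (W $$ (i, l) * cnj (W $$ (j, l))))
      sums (\<Sum>l<n. complex_of_real (exp (d l)) * (W $$ (i, l) * cnj (W $$ (j, l))))"
    by (rule sums_sum) (rule s)
  also have "(\<lambda>k. \<Sum>l<n. complex_of_real (d l ^ k / fact k) * (W $$ (i, l) * cnj (W $$ (j, l)))) =
     (\<lambda>k. (udiag n W d ^\<^sub>m k) $$ (i, j) / fact k)"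
    using ij by (simp add: udiag_pow[OF assms] udiag_index[OF assms] sum_divide_distrib mult_ac)
  finally show "mat_exp (udiag n W d) $$ (i, j) = udiag n W (\<lambda>l. exp (d l)) $$ (i, j)"
    using ij by (simp add: mat_exp_def carrier_matD[OF udiag_carrier[OF assms]] sums_iff
      udiag_index[OF assms] mult_ac)
qed (auto simp: mat_exp_def carrier_matD[OF udiag_carrier[OF assms]])

section \<open>Eigenvectors, spectrum and spectral projections of a diagonalised matrix\<close>

lemma unitary_mult_vec_cancel:
  assumes "unitary n W" "v \<in> carrier_vec n"
  shows "W *\<^sub>v (mat_adjoint W *\<^sub>v v) = v" "mat_adjoint W *\<^sub>v (W *\<^sub>v v) = v"
  using assms by (auto simp: unitary_def assoc_mult_mat_vec[of _ n n _ n, symmetric])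

lemma real_diag_mult_vec:
  assumes "v \<in> carrier_vec n" "l < n"
  shows "(real_diag n d *\<^sub>v v) $ l = complex_of_real (d l) * v $ l"
proof -
  have "(real_diag n d *\<^sub>v v) $ l = (\<Sum>k<n. if k = l then complex_of_real (d l) * v $ l else 0)"
    using assms by (subst mult_mat_vec_index; (simp; fail)?) (intro sum.cong, auto simp: real_diag_def)
  thus ?thesis using assms by simp
qed

text \<open>In the coordinates given by the adjoint of \<open>W\<close> the eigenvalue equation
  decouples into scalar equations. With \<open>d\<close> taking the values 0 and 1 and with s = 1,
  the same criterion describes the fixed vectors of a projection.\<close>

lemma udiag_eigen_iff:
  assumes W: "unitary n W" and v: "v \<in> carrier_vec n"
  shows "udiag n W d *\<^sub>v v = complex_of_real s \<cdot>\<^sub>v v \<longleftrightarrow>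
    (\<forall>l<n. (mat_adjoint W *\<^sub>v v) $ l = 0 \<or> d l = s)"
proof -
  let ?w = "mat_adjoint W *\<^sub>v v"
  have c: "W \<in> carrier_mat n n" "mat_adjoint W \<in> carrier_mat n n" using W by (auto simp: unitary_def)
  have w: "?w \<in> carrier_vec n" by (rule mult_mat_vec_carrier[OF c(2) v])
  have "udiag n W d *\<^sub>v v = W *\<^sub>v (real_diag n d *\<^sub>v ?w)"
    unfolding udiag_def
    using assoc_mult_mat_vec[OF mult_carrier_mat[OF c(1) real_diag_carrier[of n d]] c(2) v]
      assoc_mult_mat_vec[OF c(1) real_diag_carrier w] by simp
  moreover have "complex_of_real s \<cdot>\<^sub>v v = W *\<^sub>v (complex_of_real s \<cdot>\<^sub>v ?w)"
    using c w v unitary_mult_vec_cancel[OF W v] by (simp add: mult_mat_vec)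
  moreover have "W *\<^sub>v x = W *\<^sub>v y \<longleftrightarrow> x = y" if "x \<in> carrier_vec n" "y \<in> carrier_vec n" for x y
    using unitary_mult_vec_cancel(2)[OF W] that by metis
  ultimately have "udiag n W d *\<^sub>v v = complex_of_real s \<cdot>\<^sub>v v \<longleftrightarrow>
     real_diag n d *\<^sub>v ?w = complex_of_real s \<cdot>\<^sub>v ?w"
    using w by (metis mult_mat_vec_carrier real_diag_carrier smult_carrier_vec)
  also have "\<dots> \<longleftrightarrow> (\<forall>l<n. complex_of_real (d l) * ?w $ l = complex_of_real s * ?w $ l)"
  proof
    assume e: "real_diag n d *\<^sub>v ?w = complex_of_real s \<cdot>\<^sub>v ?w"
    show "\<forall>l<n. complex_of_real (d l) * ?w $ l = complex_of_real s * ?w $ l"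
      using arg_cong[OF e, of "\<lambda>u. u $ l" for l] real_diag_mult_vec[OF w] w
      by (metis carrier_vecD index_smult_vec(1))
  next
    assume e: "\<forall>l<n. complex_of_real (d l) * ?w $ l = complex_of_real s * ?w $ l"
    show "real_diag n d *\<^sub>v ?w = complex_of_real s \<cdot>\<^sub>v ?w"
    proof (rule eq_vecI)
      fix l assume "l < dim_vec (complex_of_real s \<cdot>\<^sub>v ?w)"
      hence l: "l < n" "l < dim_vec ?w" using carrier_vecD[OF w] by simp_all
      thus "(real_diag n d *\<^sub>v ?w) $ l = (complex_of_real s \<cdot>\<^sub>v ?w) $ l"
        using e real_diag_mult_vec[OF w l(1), of d] index_smult_vec(1)[OF l(2)] by presburger
    qed (use carrier_vecD[OF w] in \<open>simp del: dim_mult_mat_vec add: dim_mult_mat_vec[of "real_diag n d"]\<close>)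
  qed
  also have "\<dots> \<longleftrightarrow> (\<forall>l<n. ?w $ l = 0 \<or> d l = s)" by auto
  finally show ?thesis .
qed

lemma unitary_col:
  assumes W: "unitary n W" and l: "l < n"
  shows "W *\<^sub>v unit_vec n l \<in> carrier_vec n" "W *\<^sub>v unit_vec n l \<noteq> 0\<^sub>v n"
    "mat_adjoint W *\<^sub>v (W *\<^sub>v unit_vec n l) = unit_vec n l"
proof -
  have c: "W \<in> carrier_mat n n" "mat_adjoint W \<in> carrier_mat n n" using W by (auto simp: unitary_def)
  show 1: "W *\<^sub>v unit_vec n l \<in> carrier_vec n" using c by simp
  show 2: "mat_adjoint W *\<^sub>v (W *\<^sub>v unit_vec n l) = unit_vec n l"
    by (rule unitary_mult_vec_cancel(2)[OF W]) simp
  show "W *\<^sub>v unit_vec n l \<noteq> 0\<^sub>v n"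
  proof
    assume "W *\<^sub>v unit_vec n l = 0\<^sub>v n"
    hence "unit_vec n l = mat_adjoint W *\<^sub>v 0\<^sub>v n" using 2 by simp
    also have "\<dots> = 0\<^sub>v n" by (rule eq_vecI) (use c in \<open>auto simp: scalar_prod_def\<close>)
    finally have "(unit_vec n l :: complex vec) = 0\<^sub>v n" .
    thus False using l by (metis index_unit_vec(2) index_zero_vec(1) zero_neq_one)
  qed
qed

lemma real_spectrum_udiag:
  assumes W: "unitary n W"
  shows "real_spectrum (udiag n W d) = d ` {..<n}"
proof (intro equalityI subsetI)
  fix s assume "s \<in> real_spectrum (udiag n W d)"
  then obtain v where v: "v \<in> carrier_vec n" "v \<noteq> 0\<^sub>v n" "udiag n W d *\<^sub>v v = complex_of_real s \<cdot>\<^sub>v v"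
    by (auto simp: real_spectrum_def spectrum_def eigenvalue_def eigenvector_def carrier_matD[OF udiag_carrier[OF W]])
  have "\<exists>l<n. (mat_adjoint W *\<^sub>v v) $ l \<noteq> 0"
  proof (rule ccontr)
    assume "\<not> ?thesis"
    hence "mat_adjoint W *\<^sub>v v = 0\<^sub>v n" using W by (intro eq_vecI) (auto simp: unitary_def)
    hence "v = W *\<^sub>v 0\<^sub>v n" using unitary_mult_vec_cancel(1)[OF W v(1)] by simp
    also have "\<dots> = 0\<^sub>v n" using W by (auto simp: unitary_def mult_mat_vec_index intro!: eq_vecI simp del: index_mult_mat_vec)
    finally show False using v by simp
  qed
  thus "s \<in> d ` {..<n}" using v udiag_eigen_iff[OF W v(1)] by auto
next
  fix s assume "s \<in> d ` {..<n}"
  then obtain l where l: "l < n" "s = d l" by auto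
  have "udiag n W d *\<^sub>v (W *\<^sub>v unit_vec n l) = complex_of_real s \<cdot>\<^sub>v (W *\<^sub>v unit_vec n l)"
    using l unitary_col[OF W l(1)] by (subst udiag_eigen_iff[OF W]) (auto simp: unit_vec_def)
  hence "eigenvector (udiag n W d) (W *\<^sub>v unit_vec n l) (complex_of_real s)"
    using unitary_col[OF W l(1)] by (auto simp: eigenvector_def carrier_matD[OF udiag_carrier[OF W]])
  thus "s \<in> real_spectrum (udiag n W d)"
    by (auto simp: real_spectrum_def spectrum_def eigenvalue_def)
qed

text \<open>An orthogonal projection is determined by its fixed vectors; this gives the uniqueness
  behind the \<open>THE\<close> in \<open>spectral_projection\<close>.\<close>

lemma spectral_projection_eqI:
  assumes E: "E \<in> carrier_mat (dim_row A) (dim_row A)" "E * E = E" "self_adjoint E"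
    and fixE: "\<And>v. v \<in> carrier_vec (dim_row A) \<Longrightarrow> E *\<^sub>v v = v \<longleftrightarrow> A *\<^sub>v v = complex_of_real s \<cdot>\<^sub>v v"
  shows "spectral_projection A s = E"
  unfolding spectral_projection_def
proof (rule the_equality)
  show "E \<in> carrier_mat (dim_row A) (dim_row A) \<and> E * E = E \<and> self_adjoint E \<and>
        (\<forall>v \<in> carrier_vec (dim_row A). E *\<^sub>v v = v \<longleftrightarrow> A *\<^sub>v v = complex_of_real s \<cdot>\<^sub>v v)"
    using assms by blast
next
  fix F
  let ?n = "dim_row A"
  assume F: "F \<in> carrier_mat ?n ?n \<and> F * F = F \<and> self_adjoint F \<and>
        (\<forall>v \<in> carrier_vec ?n. F *\<^sub>v v = v \<longleftrightarrow> A *\<^sub>v v = complex_of_real s \<cdot>\<^sub>v v)"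
  \<comment> \<open>The columns of the idempotent \<open>G'\<close> are fixed by \<open>G'\<close>,
    hence by \<open>G\<close>.\<close>
  have ran: "G * G' = G'"
    if G: "G \<in> carrier_mat ?n ?n" "G' \<in> carrier_mat ?n ?n" "G' * G' = G'"
      and f: "\<And>v. v \<in> carrier_vec ?n \<Longrightarrow> G *\<^sub>v v = v \<longleftrightarrow> G' *\<^sub>v v = v" for G G' :: "complex mat"
  proof (rule eq_matI)
    fix i j assume "i < dim_row G'" "j < dim_col G'"
    hence ij: "i < ?n" "j < ?n" using G by auto
    have "G' *\<^sub>v col G' j = col (G' * G') j" using G ij by (intro col_mult2[symmetric, of _ ?n ?n _ ?n]) auto
    hence "G' *\<^sub>v col G' j = col G' j" using G by simp
    hence "G *\<^sub>v col G' j = col G' j" using f[of "col G' j"] G ij by auto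
    hence "col (G * G') j = col G' j" using G ij by (subst col_mult2[of _ ?n ?n _ ?n]) auto
    moreover have "(G * G') $$ (i, j) = col (G * G') j $ i" "G' $$ (i, j) = col G' j $ i"
      using G ij by auto
    ultimately show "(G * G') $$ (i, j) = G' $$ (i, j)" by simp
  qed (use G in auto)
  have "E * F = F" "F * E = E"
    using E F fixE by (auto intro!: ran)
  \<comment> \<open>The adjoint of \<open>F * E = E\<close> reads \<open>E * F = E\<close>, while
    \<open>E * F = F\<close>.\<close>
  thus "F = E" using E F by (metis carrier_matD mat_adjoint_mult self_adjoint_def)
qed

lemma spectral_projection_udiag:
  assumes W: "unitary n W"
  shows "spectral_projection (udiag n W d) s = udiag n W (\<lambda>l. if d l = s then 1 else 0)"
proof (rule spectral_projection_eqI)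
  let ?E = "udiag n W (\<lambda>l. if d l = s then 1 else 0)"
  have dim: "dim_row (udiag n W d) = n" using W by (simp add: carrier_matD[OF udiag_carrier])
  show "?E \<in> carrier_mat (dim_row (udiag n W d)) (dim_row (udiag n W d))"
    unfolding dim using W by simp
  show "?E * ?E = ?E" using W by (auto simp: udiag_mult intro!: udiag_cong)
  show "self_adjoint ?E" using W by (rule udiag_self_adjoint)
  fix v :: "complex vec" assume "v \<in> carrier_vec (dim_row (udiag n W d))"
  hence v: "v \<in> carrier_vec n" by (simp add: dim)
  show "?E *\<^sub>v v = v \<longleftrightarrow> udiag n W d *\<^sub>v v = complex_of_real s \<cdot>\<^sub>v v"
    using udiag_eigen_iff[OF W v, of "\<lambda>l. if d l = s then 1 else 0" 1] udiag_eigen_iff[OF W v, of d s]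
    by (auto split: if_splits)
qed

lemma mat_log_udiag:
  assumes W: "unitary n W"
  shows "mat_log (udiag n W d) = udiag n W (\<lambda>l. ln (d l))"
proof -
  have dim: "dim_row (udiag n W d) = n" using W by (simp add: carrier_matD[OF udiag_carrier])
  have "mat_log (udiag n W d) = udiag n W (\<lambda>l. \<Sum>s\<in>d ` {..<n}. ln s * (if d l = s then 1 else 0))"
    unfolding mat_log_def dim real_spectrum_udiag[OF W] spectral_projection_udiag[OF W]
    by (rule udiag_mat_sum[OF W])
  \<comment> \<open>The sum runs over the set of eigenvalues, so \<open>d l\<close> is met exactly
    once, whatever its multiplicity.\<close>
  also have "\<dots> = udiag n W (\<lambda>l. ln (d l))"
    by (rule udiag_cong) (simp add: mult_delta_right)
  finally show ?thesis .
qed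

lemma spectral_theorem_udiag:
  assumes "A \<in> carrier_mat n n" "self_adjoint A"
  obtains W d where "unitary n W" "A = udiag n W d"
  using spectral_theorem[OF assms] by (metis udiag_def)

section \<open>Tensor products and partial traces\<close>

lemma sum_prod_index:
  fixes f :: "nat \<Rightarrow> 'a::comm_monoid_add"
  shows "(\<Sum>p<m * n. f p) = (\<Sum>i<m. \<Sum>k<n. f (i * n + k))"
proof -
  have "(\<Sum>p<m * n. f p) = (\<Sum>i<m. \<Sum>p\<in>{i * n..<i * n + n}. f p)"
    by (rule sum.nat_group[symmetric])
  also have "\<dots> = (\<Sum>i<m. \<Sum>k<n. f (i * n + k))"
  proof (rule sum.cong)
    fix i
    have "(\<Sum>p\<in>{0 + i * n..<n + i * n}. f p) = (\<Sum>k\<in>{0..<n}. f (k + i * n))"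
      by (rule sum.shift_bounds_nat_ivl)
    thus "(\<Sum>p\<in>{i * n..<i * n + n}. f p) = (\<Sum>k<n. f (i * n + k))"
      by (simp add: atLeast0LessThan add.commute)
  qed simp
  finally show ?thesis .
qed

lemma prod_index_less: "i < m \<Longrightarrow> k < n \<Longrightarrow> i * n + k < m * (n::nat)"
  using mult_le_mono1[of "Suc i" m n] by simp

lemma prod_index_div_mod:
  fixes p m n :: nat
  assumes "p < m * n"
  shows "p div n < m" "p mod n < n"
proof -
  have "0 < n" using assms by (cases n) auto
  thus "p mod n < n" by simp
  show "p div n < m" using assms by (rule less_mult_imp_div_less)
qed

lemma kron_carrier [simp]:
  "A \<in> carrier_mat m m \<Longrightarrow> B \<in> carrier_mat n n \<Longrightarrow> kron A B \<in> carrier_mat (m * n) (m * n)"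
  by (auto simp: kron_def)

lemma kron_index:
  assumes "A \<in> carrier_mat m m" "B \<in> carrier_mat n n" "p < m * n" "q < m * n"
  shows "kron A B $$ (p, q) = A $$ (p div n, q div n) * B $$ (p mod n, q mod n)"
  using assms by (auto simp: kron_def)

lemma kron_mult:
  assumes "A \<in> carrier_mat m m" "B \<in> carrier_mat n n" "C \<in> carrier_mat m m" "D \<in> carrier_mat n n"
  shows "kron A B * kron C D = kron (A * C) (B * D)"
proof (rule eq_matI)
  have k: "kron A B \<in> carrier_mat (m * n) (m * n)" "kron C D \<in> carrier_mat (m * n) (m * n)"
      "A * C \<in> carrier_mat m m" "B * D \<in> carrier_mat n n"
      "kron (A * C) (B * D) \<in> carrier_mat (m * n) (m * n)"
    using assms by (auto intro!: kron_carrier mult_carrier_mat)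
  show "dim_row (kron A B * kron C D) = dim_row (kron (A * C) (B * D))"
       "dim_col (kron A B * kron C D) = dim_col (kron (A * C) (B * D))"
    by (simp_all only: index_mult_mat carrier_matD[OF k(1)] carrier_matD[OF k(2)] carrier_matD[OF k(5)])
  fix p q assume "p < dim_row (kron (A * C) (B * D))" "q < dim_col (kron (A * C) (B * D))"
  hence pq: "p < m * n" "q < m * n" by (simp_all only: carrier_matD[OF k(5)])
  note pq' = prod_index_div_mod[OF pq(1)] prod_index_div_mod[OF pq(2)]
  have "(kron A B * kron C D) $$ (p, q) = (\<Sum>r<m * n. kron A B $$ (p, r) * kron C D $$ (r, q))"
    using k pq by (subst mult_mat_index) auto
  also have "\<dots> = (\<Sum>i<m. \<Sum>l<n. kron A B $$ (p, i * n + l) * kron C D $$ (i * n + l, q))"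
    by (rule sum_prod_index)
  also have "\<dots> = (\<Sum>i<m. \<Sum>l<n. (A $$ (p div n, i) * C $$ (i, q div n)) * (B $$ (p mod n, l) * D $$ (l, q mod n)))"
    using assms pq by (intro sum.cong refl) (simp add: kron_index[of _ m _ n] prod_index_less)
  also have "\<dots> = (\<Sum>i<m. A $$ (p div n, i) * C $$ (i, q div n)) * (\<Sum>l<n. B $$ (p mod n, l) * D $$ (l, q mod n))"
    by (rule sum_product[symmetric])
  also have "\<dots> = (A * C) $$ (p div n, q div n) * (B * D) $$ (p mod n, q mod n)"
    using assms pq' by (simp add: mult_mat_index del: index_mult_mat(1))
  also have "\<dots> = kron (A * C) (B * D) $$ (p, q)"
    using k pq by (simp add: kron_index[of _ m _ n] del: index_mult_mat(1))
  finally show "(kron A B * kron C D) $$ (p, q) = kron (A * C) (B * D) $$ (p, q)" .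
qed

lemma kron_adjoint:
  assumes "A \<in> carrier_mat m m" "B \<in> carrier_mat n n"
  shows "mat_adjoint (kron A B) = kron (mat_adjoint A) (mat_adjoint B)"
proof (rule eq_matI)
  have k: "kron A B \<in> carrier_mat (m * n) (m * n)"
      "kron (mat_adjoint A) (mat_adjoint B) \<in> carrier_mat (m * n) (m * n)"
    using assms by auto
  fix p q assume "p < dim_row (kron (mat_adjoint A) (mat_adjoint B))" "q < dim_col (kron (mat_adjoint A) (mat_adjoint B))"
  hence pq: "p < m * n" "q < m * n" using k by auto
  note pq' = prod_index_div_mod[OF pq(1)] prod_index_div_mod[OF pq(2)]
  have "mat_adjoint (kron A B) $$ (p, q) = cnj (A $$ (q div n, p div n) * B $$ (q mod n, p mod n))"
    using pq k kron_index[OF assms pq(2,1)] by auto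
  also have "\<dots> = kron (mat_adjoint A) (mat_adjoint B) $$ (p, q)"
    using assms pq' by (subst kron_index[OF _ _ pq]) auto
  finally show "mat_adjoint (kron A B) $$ (p, q) = kron (mat_adjoint A) (mat_adjoint B) $$ (p, q)" .
qed (use assms in \<open>auto simp: kron_def\<close>)

lemma kron_transpose:
  assumes "A \<in> carrier_mat m m" "B \<in> carrier_mat n n"
  shows "transpose_mat (kron A B) = kron (transpose_mat A) (transpose_mat B)"
proof (rule eq_matI)
  have k: "kron A B \<in> carrier_mat (m * n) (m * n)"
      "kron (transpose_mat A) (transpose_mat B) \<in> carrier_mat (m * n) (m * n)"
    using assms by auto
  fix p q assume "p < dim_row (kron (transpose_mat A) (transpose_mat B))" "q < dim_col (kron (transpose_mat A) (transpose_mat B))"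
  hence pq: "p < m * n" "q < m * n" using k by auto
  note pq' = prod_index_div_mod[OF pq(1)] prod_index_div_mod[OF pq(2)]
  have "transpose_mat (kron A B) $$ (p, q) = A $$ (q div n, p div n) * B $$ (q mod n, p mod n)"
    using pq k kron_index[OF assms pq(2,1)] by auto
  also have "\<dots> = kron (transpose_mat A) (transpose_mat B) $$ (p, q)"
    using assms pq' by (subst kron_index[OF _ _ pq]) auto
  finally show "transpose_mat (kron A B) $$ (p, q) = kron (transpose_mat A) (transpose_mat B) $$ (p, q)" .
qed (use assms in \<open>auto simp: kron_def\<close>)

lemma mat_tr_mult:
  assumes "A \<in> carrier_mat m n" "B \<in> carrier_mat n m"
  shows "mat_tr (A * B) = (\<Sum>i<m. \<Sum>k<n. A $$ (i, k) * B $$ (k, i))"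
  using assms by (simp add: mat_tr_def mult_mat_index del: index_mult_mat(1))

lemma mat_tr_mult_comm:
  assumes "A \<in> carrier_mat m n" "B \<in> carrier_mat n m"
  shows "mat_tr (A * B) = mat_tr (B * A)"
proof -
  have "mat_tr (A * B) = (\<Sum>k<n. \<Sum>i<m. A $$ (i, k) * B $$ (k, i))"
    unfolding mat_tr_mult[OF assms] by (rule sum.swap)
  thus ?thesis using assms by (simp add: mat_tr_mult[of B n m] mult.commute)
qed

lemma mat_tr_transpose [simp]: "A \<in> carrier_mat n n \<Longrightarrow> mat_tr (transpose_mat A) = mat_tr A"
  by (simp add: mat_tr_def)

lemma mat_tr_smult [simp]: "A \<in> carrier_mat n n \<Longrightarrow> mat_tr (c \<cdot>\<^sub>m A) = c * mat_tr A"
  by (simp add: mat_tr_def sum_distrib_left)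

lemma mat_tr_minus [simp]:
  "A \<in> carrier_mat n n \<Longrightarrow> B \<in> carrier_mat n n \<Longrightarrow> mat_tr (A - B) = mat_tr A - mat_tr B"
  by (simp add: mat_tr_def sum_subtractf)

lemma mat_sum_carrier [simp]: "mat_sum n f I \<in> carrier_mat n n"
  by (simp add: mat_sum_def)

lemma mat_tr_mult_mat_sum:
  assumes "X \<in> carrier_mat n n" "\<And>k. k \<in> I \<Longrightarrow> f k \<in> carrier_mat n n"
  shows "mat_tr (X * mat_sum n f I) = (\<Sum>k\<in>I. mat_tr (X * f k))"
proof -
  have "mat_tr (X * mat_sum n f I) = (\<Sum>i<n. \<Sum>j<n. \<Sum>k\<in>I. X $$ (i, j) * f k $$ (j, i))"
    using assms(1) by (simp add: mat_tr_mult[of _ n n] mat_sum_def sum_distrib_left)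
  also have "\<dots> = (\<Sum>k\<in>I. \<Sum>i<n. \<Sum>j<n. X $$ (i, j) * f k $$ (j, i))"
    by (simp only: sum.swap[of _ I "{..<n}"])
  finally show ?thesis using assms by (simp add: mat_tr_mult[of _ n n])
qed

lemma mat_tr_mat_sum_mult:
  assumes "X \<in> carrier_mat n n" "\<And>k. k \<in> I \<Longrightarrow> f k \<in> carrier_mat n n"
  shows "mat_tr (mat_sum n f I * X) = (\<Sum>k\<in>I. mat_tr (f k * X))"
proof -
  have "mat_tr (mat_sum n f I * X) = mat_tr (X * mat_sum n f I)"
    by (rule mat_tr_mult_comm) (use assms in auto)
  also have "\<dots> = (\<Sum>k\<in>I. mat_tr (X * f k))"
    by (rule mat_tr_mult_mat_sum[OF assms])
  also have "\<dots> = (\<Sum>k\<in>I. mat_tr (f k * X))"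
    by (intro sum.cong refl mat_tr_mult_comm) (use assms in auto)
  finally show ?thesis .
qed

lemma kron_mat_sum:
  assumes "A \<in> carrier_mat m m" "\<And>k. k \<in> I \<Longrightarrow> f k \<in> carrier_mat n n"
  shows "kron A (mat_sum n f I) = mat_sum (m * n) (\<lambda>k. kron A (f k)) I"
proof (rule eq_matI)
  fix p q assume "p < dim_row (mat_sum (m * n) (\<lambda>k. kron A (f k)) I)"
    "q < dim_col (mat_sum (m * n) (\<lambda>k. kron A (f k)) I)"
  hence pq: "p < m * n" "q < m * n" by (auto simp: mat_sum_def)
  thus "kron A (mat_sum n f I) $$ (p, q) = mat_sum (m * n) (\<lambda>k. kron A (f k)) I $$ (p, q)"
    using assms prod_index_div_mod[OF pq(1)] prod_index_div_mod[OF pq(2)]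
    by (simp add: kron_index[of _ m _ n]) (simp add: mat_sum_def kron_index[of _ m _ n] sum_distrib_left)
qed (use assms in \<open>auto simp: mat_sum_def kron_def\<close>)

lemma kron_smult_right:
  assumes "A \<in> carrier_mat m m" "B \<in> carrier_mat n n"
  shows "kron A (c \<cdot>\<^sub>m B) = c \<cdot>\<^sub>m kron A B"
proof (rule eq_matI)
  fix p q assume "p < dim_row (c \<cdot>\<^sub>m kron A B)" "q < dim_col (c \<cdot>\<^sub>m kron A B)"
  hence pq: "p < m * n" "q < m * n" using assms by (auto simp: kron_def)
  thus "kron A (c \<cdot>\<^sub>m B) $$ (p, q) = (c \<cdot>\<^sub>m kron A B) $$ (p, q)"
    using assms prod_index_div_mod[OF pq(1)] prod_index_div_mod[OF pq(2)]
    by (simp add: kron_index[of _ m _ n] carrier_matD[OF kron_carrier[OF assms]])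
qed (use assms in \<open>auto simp: kron_def\<close>)

lemma partial_tr_carrier [simp]: "partial_tr m n N \<in> carrier_mat m m"
  by (simp add: partial_tr_def)

text \<open>The partial trace is dual to tensoring with the identity. Through it, statements about
  maps on the system become traces on the tensor product, where cyclicity is available.\<close>

lemma mat_tr_mult_partial_tr:
  assumes "X \<in> carrier_mat m m" "N \<in> carrier_mat (m * n) (m * n)"
  shows "mat_tr (X * partial_tr m n N) = mat_tr (kron X (1\<^sub>m n) * N)"
proof -
  have "mat_tr (kron X (1\<^sub>m n) * N) = (\<Sum>p<m * n. \<Sum>q<m * n. kron X (1\<^sub>m n) $$ (p, q) * N $$ (q, p))"
    using assms by (intro mat_tr_mult) auto
  also have "\<dots> = (\<Sum>i<m. \<Sum>k<n. \<Sum>j<m. \<Sum>l<n.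
      kron X (1\<^sub>m n) $$ (i * n + k, j * n + l) * N $$ (j * n + l, i * n + k))"
    by (simp only: sum_prod_index)
  also have "\<dots> = (\<Sum>i<m. \<Sum>k<n. \<Sum>j<m. \<Sum>l<n. if l = k then X $$ (i, j) * N $$ (j * n + k, i * n + k) else 0)"
    using assms by (intro sum.cong refl) (auto simp: kron_index[of _ m _ n] prod_index_less)
  also have "\<dots> = (\<Sum>i<m. \<Sum>k<n. \<Sum>j<m. X $$ (i, j) * N $$ (j * n + k, i * n + k))"
    by simp
  also have "\<dots> = (\<Sum>i<m. \<Sum>j<m. \<Sum>k<n. X $$ (i, j) * N $$ (j * n + k, i * n + k))"
    by (intro sum.cong[OF refl] sum.swap)
  also have "\<dots> = mat_tr (X * partial_tr m n N)"
    using assms by (simp add: mat_tr_mult[of _ m m] partial_tr_def sum_distrib_left)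
  finally show ?thesis by simp
qed

text \<open>Both the maps \<^const>\<open>L_xi\<close> and their duals for the trace pairing are instances of \<open>probe_map\<close>.\<close>

definition probe_map :: "nat \<Rightarrow> nat \<Rightarrow> complex mat \<Rightarrow> complex mat \<Rightarrow> complex mat \<Rightarrow> complex mat \<Rightarrow> complex mat" where
  "probe_map m n A B M \<rho> =
     partial_tr m n (kron (1\<^sub>m m) B * (M * kron \<rho> A * mat_adjoint M))"

lemma probe_map_carrier [simp]: "probe_map m n A B M \<rho> \<in> carrier_mat m m"
  by (simp add: probe_map_def)

lemma mat_tr_mult_probe_map:
  assumes "A \<in> carrier_mat n n" "B \<in> carrier_mat n n" "M \<in> carrier_mat (m * n) (m * n)"
    and "X \<in> carrier_mat m m" "\<rho> \<in> carrier_mat m m"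
  shows "mat_tr (X * probe_map m n A B M \<rho>) = mat_tr (kron X B * (M * kron \<rho> A * mat_adjoint M))"
proof -
  let ?N = "M * kron \<rho> A * mat_adjoint M"
  have N: "?N \<in> carrier_mat (m * n) (m * n)"
    using assms by (intro mult_carrier_mat[of _ _ "m * n"]) auto
  have "mat_tr (X * probe_map m n A B M \<rho>) = mat_tr (kron X (1\<^sub>m n) * (kron (1\<^sub>m m) B * ?N))"
    unfolding probe_map_def using assms N
    by (intro mat_tr_mult_partial_tr mult_carrier_mat[of _ _ "m * n"]) auto
  also have "kron X (1\<^sub>m n) * (kron (1\<^sub>m m) B * ?N) = kron X (1\<^sub>m n) * kron (1\<^sub>m m) B * ?N"
    using assms N by (intro assoc_mult_mat[symmetric, of _ "m * n" "m * n" _ "m * n" _ "m * n"]) auto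
  also have "kron X (1\<^sub>m n) * kron (1\<^sub>m m) B = kron X B"
    using assms by (subst kron_mult[of _ m _ n]) auto
  finally show ?thesis .
qed

text \<open>Cyclicity of the trace moves both copies of \<open>M\<close> onto the other factor, so
  the dual is of the same kind, with preparation \<open>A\<close> and readout \<open>B\<close>
  exchanged.\<close>

lemma probe_map_dual:
  assumes "A \<in> carrier_mat n n" "B \<in> carrier_mat n n" "M \<in> carrier_mat (m * n) (m * n)"
    and "X \<in> carrier_mat m m" "\<rho> \<in> carrier_mat m m"
  shows "mat_tr (X * probe_map m n A B M \<rho>) = mat_tr (\<rho> * probe_map m n B A (mat_adjoint M) X)"
proof -
  let ?m = "m * n"
  have c: "kron X B \<in> carrier_mat ?m ?m" "kron \<rho> A \<in> carrier_mat ?m ?m" "mat_adjoint M \<in> carrier_mat ?m ?m"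
    using assms by auto
  note M = assms(3)
  note s = assoc_mult_mat[of _ ?m ?m _ ?m _ ?m] mult_carrier_mat[of _ ?m ?m _ ?m]
  have "mat_tr (X * probe_map m n A B M \<rho>) = mat_tr (kron X B * (M * kron \<rho> A * mat_adjoint M))"
    by (rule mat_tr_mult_probe_map[OF assms])
  also have "\<dots> = mat_tr ((kron X B * M) * (kron \<rho> A * mat_adjoint M))"
    using c M by (simp add: s)
  also have "\<dots> = mat_tr (kron \<rho> A * mat_adjoint M * (kron X B * M))"
    using c M by (intro mat_tr_mult_comm[of _ ?m ?m]) (auto simp: s)
  also have "\<dots> = mat_tr (kron \<rho> A * (mat_adjoint M * kron X B * mat_adjoint (mat_adjoint M)))"
    using c M by (simp add: s)
  also have "\<dots> = mat_tr (\<rho> * probe_map m n B A (mat_adjoint M) X)"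
    using assms by (intro mat_tr_mult_probe_map[symmetric]) auto
  finally show ?thesis .
qed

section \<open>Positive semidefinite matrices\<close>

lemma pos_semidef_carrier:
  "A \<in> carrier_mat n n \<Longrightarrow> pos_semidef A \<longleftrightarrow> (\<forall>v \<in> carrier_vec n. 0 \<le> (A *\<^sub>v v) \<bullet>c v)"
  by (simp add: pos_semidef_def)

lemma quadratic_form_sum:
  fixes A :: "complex mat"
  assumes "A \<in> carrier_mat n n" "v \<in> carrier_vec n"
  shows "(A *\<^sub>v v) \<bullet>c v = (\<Sum>k<n. (\<Sum>l<n. A $$ (k, l) * v $ l) * cnj (v $ k))"
  using assms by (simp add: cscalar_prod_sum mult_mat_vec_index carrier_vecD del: index_mult_mat_vec)

lemma sum_two_points:
  fixes f :: "nat \<Rightarrow> complex"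
  assumes "i < n" "j < n" "i \<noteq> j"
  shows "(\<Sum>k<n. f k * (if k = i then a else if k = j then b else 0)) = f i * a + f j * b"
proof -
  have "(\<Sum>k<n. f k * (if k = i then a else if k = j then b else 0)) =
     (\<Sum>k\<in>{i, j}. f k * (if k = i then a else if k = j then b else 0))"
    using assms by (intro sum.mono_neutral_right) auto
  thus ?thesis using assms by simp
qed

lemma quadratic_form_two_points:
  fixes A :: "complex mat"
  assumes A: "A \<in> carrier_mat n n" and ij: "i < n" "j < n" "i \<noteq> j"
    and v: "v = Matrix.vec n (\<lambda>k. if k = i then 1 else if k = j then u else 0)"
  shows "(A *\<^sub>v v) \<bullet>c v = A $$ (i, i) + A $$ (i, j) * u + (A $$ (j, i) + A $$ (j, j) * u) * cnj u"
proof -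
  have "(A *\<^sub>v v) \<bullet>c v = (\<Sum>k<n. (\<Sum>l<n. A $$ (k, l) * (if l = i then 1 else if l = j then u else 0)) *
      (if k = i then 1 else if k = j then cnj u else 0))"
    using A by (subst quadratic_form_sum[of _ n]) (auto simp: v intro!: sum.cong)
  thus ?thesis by (simp add: sum_two_points[OF ij])
qed

text \<open>The order on complex numbers forces a nonnegative number to be real, so the quadratic
  form is real; evaluating it on vectors supported at two indices recovers the relation between
  off-diagonal entries.\<close>

lemma pos_semidef_self_adjoint:
  assumes A: "A \<in> carrier_mat n n" and psd: "pos_semidef A"
  shows "self_adjoint A"
proof -
  have q: "Im ((A *\<^sub>v v) \<bullet>c v) = 0" if "v \<in> carrier_vec n" for v
    using psd that unfolding pos_semidef_carrier[OF A] by (auto simp: less_eq_complex_def)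
  have diag: "Im (A $$ (i, i)) = 0" if i: "i < n" for i
  proof -
    have "(A *\<^sub>v unit_vec n i) \<bullet>c unit_vec n i = A $$ (i, i)"
      using A i by (simp add: quadratic_form_sum[of _ n] unit_vec_def if_distrib[of cnj] mult_delta_right cong: if_cong)
    thus ?thesis using q[of "unit_vec n i"] by simp
  qed
  have off: "A $$ (i, j) = cnj (A $$ (j, i))" if ij: "i < n" "j < n" "i \<noteq> j" for i j
  proof -
    have "Im (A $$ (i, i) + A $$ (i, j) * u + (A $$ (j, i) + A $$ (j, j) * u) * cnj u) = 0" for u
      using q[of "Matrix.vec n (\<lambda>k. if k = i then 1 else if k = j then u else 0)"]
        quadratic_form_two_points[OF A ij refl, of u] by simp
    \<comment> \<open>As the diagonal is real, \<open>u = 1\<close> makes the imaginary parts of the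
      two entries opposite, and \<open>u = \<i>\<close> makes their real parts equal.\<close>
    from this[of 1] this[of \<i>] show ?thesis
      using diag ij by (simp add: complex_eq_iff)
  qed
  show ?thesis unfolding self_adjoint_def
  proof (rule eq_matI)
    fix i j assume "i < dim_row A" "j < dim_col A"
    hence ij: "i < n" "j < n" using A by auto
    show "mat_adjoint A $$ (i, j) = A $$ (i, j)"
      using off[of i j] diag[of i] ij A by (cases "i = j") (auto simp: complex_eq_iff)
  qed (use A in auto)
qed

lemma pos_semidef_adjoint_mult:
  assumes B: "B \<in> carrier_mat n n"
  shows "pos_semidef (mat_adjoint B * B)"
proof -
  have Ba: "mat_adjoint B \<in> carrier_mat n n" using B by simp
  have "0 \<le> ((mat_adjoint B * B) *\<^sub>v v) \<bullet>c v" if v: "v \<in> carrier_vec n" for v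
  proof -
    have Bv: "B *\<^sub>v v \<in> carrier_vec n" by (rule mult_mat_vec_carrier[OF B v])
    have "((mat_adjoint B * B) *\<^sub>v v) \<bullet>c v = (B *\<^sub>v v) \<bullet>c (B *\<^sub>v v)"
      using mat_adjoint_cscalar_prod[OF Ba Bv v] assoc_mult_mat_vec[OF Ba B v] by simp
    thus ?thesis by (simp add: cscalar_prod_self less_eq_complex_def sum_nonneg del: of_real_sum)
  qed
  thus ?thesis using mult_carrier_mat[OF Ba B] by (simp add: pos_semidef_carrier[of _ n])
qed

lemma unitary_col_eigen:
  assumes W: "unitary n W" and l: "l < n"
  shows "(udiag n W d *\<^sub>v (W *\<^sub>v unit_vec n l)) \<bullet>c (W *\<^sub>v unit_vec n l) = complex_of_real (d l)"
proof -
  let ?v = "W *\<^sub>v unit_vec n l"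
  note v = unitary_col[OF W l]
  have "udiag n W d *\<^sub>v ?v = complex_of_real (d l) \<cdot>\<^sub>v ?v"
    using v(3) l by (subst udiag_eigen_iff[OF W v(1)]) (auto simp: unit_vec_def)
  moreover have "?v \<bullet>c ?v = unit_vec n l \<bullet>c unit_vec n l"
    using mat_adjoint_cscalar_prod[OF unitary_carrier[OF W] _ v(1), of "unit_vec n l"] v(3) by simp
  moreover have "(unit_vec n l :: complex vec) \<bullet>c unit_vec n l = 1"
    using l by (simp add: cscalar_prod_sum unit_vec_def if_distrib[of cnj] mult_delta_right cong: if_cong)
  ultimately show ?thesis using v(1) by simp
qed

lemma udiag_eq_adjoint_mult:
  assumes W: "unitary n W" and d: "\<And>l. l < n \<Longrightarrow> 0 \<le> d l"
  shows "\<exists>B \<in> carrier_mat n n. udiag n W d = mat_adjoint B * B"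
proof (intro bexI)
  let ?B = "udiag n W (\<lambda>l. sqrt (d l))"
  have "mat_adjoint ?B * ?B = ?B * ?B"
    using udiag_self_adjoint[OF W] by (simp add: self_adjoint_def)
  also have "\<dots> = udiag n W d"
    unfolding udiag_mult[OF W] by (rule udiag_cong) (simp add: d)
  finally show "udiag n W d = mat_adjoint ?B * ?B" ..
qed (use W in simp)

lemma pos_semidef_udiag_iff:
  assumes W: "unitary n W"
  shows "pos_semidef (udiag n W d) \<longleftrightarrow> (\<forall>l<n. 0 \<le> d l)"
proof
  assume p: "pos_semidef (udiag n W d)"
  show "\<forall>l<n. 0 \<le> d l"
  proof (intro allI impI)
    fix l assume l: "l < n"
    have "0 \<le> complex_of_real (d l)"
      using p unitary_col_eigen[OF W l, of d] unitary_col(1)[OF W l] pos_semidef_carrier[OF udiag_carrier[OF W]]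
      by metis
    thus "0 \<le> d l" by (simp add: less_eq_complex_def)
  qed
next
  assume "\<forall>l<n. 0 \<le> d l"
  then obtain B where "B \<in> carrier_mat n n" "udiag n W d = mat_adjoint B * B"
    using udiag_eq_adjoint_mult[OF W] by metis
  thus "pos_semidef (udiag n W d)" by (simp add: pos_semidef_adjoint_mult)
qed

lemma pos_semidef_diagonalize:
  assumes "A \<in> carrier_mat n n" "pos_semidef A"
  obtains W d where "unitary n W" "A = udiag n W d" "\<And>l. l < n \<Longrightarrow> 0 \<le> d l"
  using spectral_theorem_udiag[OF assms(1) pos_semidef_self_adjoint[OF assms]] assms(2)
    pos_semidef_udiag_iff by metis

lemma pos_semidef_factor:
  assumes "A \<in> carrier_mat n n" "pos_semidef A"
  obtains B where "B \<in> carrier_mat n n" "A = mat_adjoint B * B"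
  using pos_semidef_diagonalize[OF assms] udiag_eq_adjoint_mult by metis

lemma mat_tr_adjoint_mult_nonneg:
  assumes "M \<in> carrier_mat n n"
  shows "0 \<le> mat_tr (mat_adjoint M * M)"
proof -
  have "mat_tr (mat_adjoint M * M) = (\<Sum>i<n. \<Sum>k<n. cnj (M $$ (k, i)) * M $$ (k, i))"
    using assms by (subst mat_tr_mult[of _ n n]) auto
  also have "\<dots> = complex_of_real (\<Sum>i<n. \<Sum>k<n. (cmod (M $$ (k, i)))\<^sup>2)"
    by (simp only: of_real_sum complex_norm_square mult.commute[of "cnj _"])
  also have "0 \<le> \<dots>" by (simp add: less_eq_complex_def sum_nonneg del: of_real_sum)
  finally show ?thesis .
qed

text \<open>With \<open>A\<close> and \<open>B\<close> factored as adjoint times matrix, by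
  \<open>F\<close> and \<open>G\<close>, cyclicity turns the trace into that of adj M M for M = G
  adj F.\<close>

lemma mat_tr_mult_nonneg:
  assumes "A \<in> carrier_mat n n" "pos_semidef A" "B \<in> carrier_mat n n" "pos_semidef B"
  shows "0 \<le> mat_tr (A * B)"
proof -
  obtain F where F: "F \<in> carrier_mat n n" "A = mat_adjoint F * F" using pos_semidef_factor[OF assms(1,2)] .
  obtain G where G: "G \<in> carrier_mat n n" "B = mat_adjoint G * G" using pos_semidef_factor[OF assms(3,4)] .
  note s = assoc_mult_mat[of _ n n _ n _ n] mult_carrier_mat[of _ n n _ n]
  have "mat_tr (A * B) = mat_tr (mat_adjoint F * (F * mat_adjoint G * G))"
    using F G by (simp add: s)
  also have "\<dots> = mat_tr ((F * mat_adjoint G * G) * mat_adjoint F)"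
    using F G by (intro mat_tr_mult_comm[of _ n n]) (auto simp: s)
  also have "\<dots> = mat_tr ((F * mat_adjoint G) * (G * mat_adjoint F))"
    using F G by (simp add: s)
  also have "F * mat_adjoint G = mat_adjoint (G * mat_adjoint F)"
    using F G by (subst mat_adjoint_mult) auto
  also have "0 \<le> mat_tr (mat_adjoint (G * mat_adjoint F) * (G * mat_adjoint F))"
    using F G by (intro mat_tr_adjoint_mult_nonneg[of _ n] mult_carrier_mat[of _ n n]) auto
  finally show ?thesis .
qed

text \<open>Self-duality of the cone of positive semidefinite matrices. It serves to prove
  positivity of partial traces, sums and dual maps, which are accessible through trace
  pairings.\<close>

lemma pos_semidef_trace_iff:
  assumes A: "A \<in> carrier_mat n n"
  shows "pos_semidef A \<longleftrightarrow> (\<forall>B \<in> carrier_mat n n. pos_semidef B \<longrightarrow> 0 \<le> mat_tr (A * B))"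
proof
  assume "pos_semidef A"
  thus "\<forall>B \<in> carrier_mat n n. pos_semidef B \<longrightarrow> 0 \<le> mat_tr (A * B)"
    using mat_tr_mult_nonneg[OF A] by blast
next
  assume tr: "\<forall>B \<in> carrier_mat n n. pos_semidef B \<longrightarrow> 0 \<le> mat_tr (A * B)"
  have "0 \<le> (A *\<^sub>v v) \<bullet>c v" if v: "v \<in> carrier_vec n" for v
  proof -
    \<comment> \<open>The rank-one matrix of \<open>v\<close>: its trace against \<open>A\<close> is
      the quadratic form of \<open>A\<close> at \<open>v\<close>.\<close>
    define B where "B = mat n n (\<lambda>(i, j). v $ i * cnj (v $ j))"
    have B: "B \<in> carrier_mat n n" by (simp add: B_def)
    have "0 \<le> (B *\<^sub>v w) \<bullet>c w" if w: "w \<in> carrier_vec n" for w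
    proof -
      have "(B *\<^sub>v w) \<bullet>c w = (\<Sum>k<n. (\<Sum>l<n. v $ k * cnj (v $ l) * w $ l) * cnj (w $ k))"
        using B w by (subst quadratic_form_sum[of _ n]) (auto simp: B_def)
      also have "\<dots> = (\<Sum>k<n. v $ k * cnj (w $ k)) * (\<Sum>l<n. cnj (v $ l) * w $ l)"
        unfolding sum_product by (intro sum.cong refl) (simp add: sum_distrib_left mult_ac)
      also have "\<dots> = (\<Sum>k<n. v $ k * cnj (w $ k)) * cnj (\<Sum>k<n. v $ k * cnj (w $ k))"
        by simp
      also have "\<dots> = complex_of_real ((cmod (\<Sum>k<n. v $ k * cnj (w $ k)))\<^sup>2)"
        by (rule complex_norm_square[symmetric])
      also have "\<dots> \<ge> 0" by (simp add: less_eq_complex_def)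
      finally show ?thesis .
    qed
    hence "0 \<le> mat_tr (A * B)" using tr B pos_semidef_carrier[OF B] by blast
    also have "mat_tr (A * B) = (A *\<^sub>v v) \<bullet>c v"
      using A B v by (simp add: mat_tr_mult[of _ n n] quadratic_form_sum[of _ n] B_def sum_distrib_left mult_ac)
    finally show ?thesis .
  qed
  thus "pos_semidef A" using pos_semidef_carrier[OF A] by blast
qed

lemma pos_semidef_kron:
  assumes "A \<in> carrier_mat m m" "pos_semidef A" "B \<in> carrier_mat n n" "pos_semidef B"
  shows "pos_semidef (kron A B)"
proof -
  obtain F where F: "F \<in> carrier_mat m m" "A = mat_adjoint F * F" using pos_semidef_factor[OF assms(1,2)] .
  obtain G where G: "G \<in> carrier_mat n n" "B = mat_adjoint G * G" using pos_semidef_factor[OF assms(3,4)] .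
  have "kron A B = mat_adjoint (kron F G) * kron F G"
    using F G by (simp add: kron_adjoint[of _ m _ n] kron_mult[of _ m _ n])
  thus ?thesis using F G by (simp add: pos_semidef_adjoint_mult[of _ "m * n"])
qed

lemma pos_semidef_conj:
  assumes "A \<in> carrier_mat n n" "pos_semidef A" "M \<in> carrier_mat n n"
  shows "pos_semidef (M * A * mat_adjoint M)"
proof -
  obtain F where F: "F \<in> carrier_mat n n" "A = mat_adjoint F * F" using pos_semidef_factor[OF assms(1,2)] .
  have "M * A * mat_adjoint M = mat_adjoint (F * mat_adjoint M) * (F * mat_adjoint M)"
    using F assms by (simp add: mat_adjoint_mult assoc_mult_mat[of _ n n _ n _ n] mult_carrier_mat[of _ n n _ n])
  thus ?thesis using F assms by (simp add: pos_semidef_adjoint_mult[of _ n] mult_carrier_mat[of _ n n _ n])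
qed

text \<open>Paired with a positive \<open>X\<close>, the map gives the trace of a product of two
  positive semidefinite matrices on the tensor product, so self-duality applies.\<close>

lemma pos_semidef_probe_map:
  assumes "A \<in> carrier_mat n n" "pos_semidef A" "B \<in> carrier_mat n n" "pos_semidef B"
    and M: "M \<in> carrier_mat (m * n) (m * n)" and \<rho>: "\<rho> \<in> carrier_mat m m" "pos_semidef \<rho>"
  shows "pos_semidef (probe_map m n A B M \<rho>)"
proof -
  have "0 \<le> mat_tr (probe_map m n A B M \<rho> * X)" if X: "X \<in> carrier_mat m m" "pos_semidef X" for X
  proof -
    have "mat_tr (probe_map m n A B M \<rho> * X) = mat_tr (X * probe_map m n A B M \<rho>)"
      using X by (intro mat_tr_mult_comm) auto
    also have "\<dots> = mat_tr (kron X B * (M * kron \<rho> A * mat_adjoint M))"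
      using assms X by (intro mat_tr_mult_probe_map) auto
    also have "\<dots> \<ge> 0"
      using assms X by (intro mat_tr_mult_nonneg[of _ "m * n"] pos_semidef_kron[of _ m _ n]
        pos_semidef_conj[of _ "m * n"] mult_carrier_mat[of _ "m * n" "m * n"]) auto
    finally show ?thesis .
  qed
  thus ?thesis by (subst pos_semidef_trace_iff[of _ m]) auto
qed

lemma pos_semidef_mat_sum:
  assumes "\<And>k. k \<in> I \<Longrightarrow> f k \<in> carrier_mat n n" "\<And>k. k \<in> I \<Longrightarrow> pos_semidef (f k)"
  shows "pos_semidef (mat_sum n f I)"
proof (subst pos_semidef_trace_iff[of _ n], goal_cases)
  case 2
  show ?case using assms
    by (auto simp: mat_tr_mat_sum_mult intro!: sum_nonneg mat_tr_mult_nonneg[of _ n])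
qed simp

lemma pos_semidef_smult:
  assumes "A \<in> carrier_mat n n" "pos_semidef A" "0 \<le> c"
  shows "pos_semidef (complex_of_real c \<cdot>\<^sub>m A)"
  using pos_semidef_diagonalize[OF assms(1,2)] assms(3)
  by (metis pos_semidef_udiag_iff udiag_smult zero_le_mult_iff)

lemma pos_semidef_one: "pos_semidef (1\<^sub>m n)"
  using pos_semidef_adjoint_mult[of "1\<^sub>m n" n] by simp

lemma mat_tr_udiag:
  assumes W: "unitary n W"
  shows "mat_tr (udiag n W d) = complex_of_real (\<Sum>l<n. d l)"
proof -
  have c: "W \<in> carrier_mat n n" "mat_adjoint W \<in> carrier_mat n n" and i: "mat_adjoint W * W = 1\<^sub>m n"
    using W by (auto simp: unitary_def)
  have "mat_tr (udiag n W d) = mat_tr (W * (real_diag n d * mat_adjoint W))"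
    using c by (simp add: udiag_def assoc_mult_mat[of _ n n _ n _ n])
  also have "\<dots> = mat_tr (real_diag n d * mat_adjoint W * W)"
    using c by (intro mat_tr_mult_comm[of _ n n]) (auto intro!: mult_carrier_mat[of _ n n])
  also have "\<dots> = mat_tr (real_diag n d)"
    using c by (simp add: assoc_mult_mat[of _ n n _ n _ n] i right_mult_one_mat[of _ n n])
  finally show ?thesis by (simp add: mat_tr_def real_diag_def)
qed

lemma mat_tr_nonneg: "A \<in> carrier_mat n n \<Longrightarrow> pos_semidef A \<Longrightarrow> 0 \<le> mat_tr A"
  using mat_tr_mult_nonneg[of A n "1\<^sub>m n"] by (simp add: pos_semidef_one)

text \<open>The eigenvalues are nonnegative, so each is at most their sum.\<close>

lemma pos_semidef_le_trace:
  assumes "A \<in> carrier_mat n n" "pos_semidef A"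
  shows "pos_semidef (complex_of_real (Re (mat_tr A)) \<cdot>\<^sub>m 1\<^sub>m n - A)"
proof -
  obtain W d where W: "unitary n W" "A = udiag n W d" and d: "\<And>l. l < n \<Longrightarrow> 0 \<le> d l"
    using pos_semidef_diagonalize[OF assms] by blast
  have "complex_of_real (Re (mat_tr A)) \<cdot>\<^sub>m 1\<^sub>m n - A = udiag n W (\<lambda>l. (\<Sum>k<n. d k) - d l)"
    unfolding W(2) mat_tr_udiag[OF W(1)] udiag_one[OF W(1), symmetric]
    by (simp only: udiag_smult[OF W(1)] udiag_diff[OF W(1)] Re_complex_of_real mult_1_right)
  thus ?thesis
    using d by (auto simp: pos_semidef_udiag_iff[OF W(1)] intro!: member_le_sum)
qed

lemma unitary_entry_le_1:
  assumes W: "unitary n W" and ij: "i < n" "j < n"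
  shows "cmod (W $$ (i, j)) \<le> 1"
proof -
  have c: "W \<in> carrier_mat n n" and i: "W * mat_adjoint W = 1\<^sub>m n"
    using W by (auto simp: unitary_def)
  have "complex_of_real (\<Sum>k<n. (cmod (W $$ (i, k)))\<^sup>2) = (W * mat_adjoint W) $$ (i, i)"
    using c ij by (subst mult_mat_index) (auto simp only: of_real_sum complex_norm_square intro!: sum.cong, auto)
  hence "(\<Sum>k<n. (cmod (W $$ (i, k)))\<^sup>2) = 1" using ij by (simp add: i del: of_real_sum)
  hence "(cmod (W $$ (i, j)))\<^sup>2 \<le> 1"
    using ij member_le_sum[of j "{..<n}" "\<lambda>k. (cmod (W $$ (i, k)))\<^sup>2"] by simp
  thus ?thesis by (simp add: abs_square_le_1)
qed

text \<open>Follows from the eigenvector expansion, since entries of a unitary matrix have modulus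
  at most 1. It bounds the terms of the entrywise series in \<open>exp_map\<close>.\<close>

lemma pos_semidef_entry_le_trace:
  assumes "A \<in> carrier_mat n n" "pos_semidef A" "i < n" "j < n"
  shows "cmod (A $$ (i, j)) \<le> Re (mat_tr A)"
proof -
  obtain W d where W: "unitary n W" "A = udiag n W d" and d: "\<And>l. l < n \<Longrightarrow> 0 \<le> d l"
    using pos_semidef_diagonalize[OF assms(1,2)] by blast
  have "cmod (A $$ (i, j)) \<le> (\<Sum>l<n. cmod (complex_of_real (d l) * W $$ (i, l) * cnj (W $$ (j, l))))"
    unfolding W(2) udiag_index[OF W(1) assms(3,4)] by (rule norm_sum)
  also have "\<dots> \<le> (\<Sum>l<n. d l)"
  proof (rule sum_mono)
    fix l assume "l \<in> {..<n}"
    hence l: "l < n" by simp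
    have "cmod (W $$ (i, l)) * cmod (W $$ (j, l)) \<le> 1 * 1"
      using unitary_entry_le_1[OF W(1)] assms l by (intro mult_mono) auto
    thus "cmod (complex_of_real (d l) * W $$ (i, l) * cnj (W $$ (j, l))) \<le> d l"
      using d[OF l] mult_left_mono[of "cmod (W $$ (i, l)) * cmod (W $$ (j, l))" 1 "d l"]
      by (simp add: norm_mult mult.assoc)
  qed
  also have "\<dots> = Re (mat_tr A)" by (simp add: W(2) mat_tr_udiag[OF W(1)])
  finally show ?thesis .
qed

lemma pos_def_bounded_below:
  assumes A: "A \<in> carrier_mat n n" and pd: "pos_def A"
  obtains c where "0 < c" "pos_semidef (A - complex_of_real c \<cdot>\<^sub>m 1\<^sub>m n)"
proof -
  have pos: "0 < (A *\<^sub>v v) \<bullet>c v" if "v \<in> carrier_vec n" "v \<noteq> 0\<^sub>v n" for v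
    using pd A that by (simp add: pos_def_def)
  have "0 \<le> (A *\<^sub>v v) \<bullet>c v" if v: "v \<in> carrier_vec n" for v
  proof (cases "v = 0\<^sub>v n")
    case True
    have "(A *\<^sub>v v) \<bullet>c v = 0" using A v by (subst quadratic_form_sum[of _ n]) (auto simp: True)
    thus ?thesis by simp
  next
    case False
    thus ?thesis using pos[OF v] by (simp add: less_imp_le)
  qed
  hence "pos_semidef A" using pos_semidef_carrier[OF A] by blast
  then obtain W d where W: "unitary n W" "A = udiag n W d"
    using pos_semidef_diagonalize[OF A] by metis
  have d: "0 < d l" if l: "l < n" for l
    using pos[OF unitary_col(1,2)[OF W(1) l]] unitary_col_eigen[OF W(1) l, of d] by (simp add: W(2) less_complex_def)
  \<comment> \<open>The least eigenvalue, capped at 1 so that the minimum is over a nonempty set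
    also for \<open>n = 0\<close>.\<close>
  define c where "c = Min (insert 1 (d ` {..<n}))"
  have "0 < c" using d by (simp add: c_def)
  moreover have "A - complex_of_real c \<cdot>\<^sub>m 1\<^sub>m n = udiag n W (\<lambda>l. d l - c)"
    unfolding W(2) udiag_one[OF W(1), symmetric] udiag_smult[OF W(1)] udiag_diff[OF W(1)] by simp
  moreover have "pos_semidef (udiag n W (\<lambda>l. d l - c))"
    by (simp add: pos_semidef_udiag_iff[OF W(1)] c_def)
  ultimately show thesis by (metis that)
qed

section \<open>Tilted maps and their duals\<close>

lemma mat_exp_carrier: "A \<in> carrier_mat n n \<Longrightarrow> mat_exp A \<in> carrier_mat n n"
  by (simp add: mat_exp_def)

lemma mat_sum_index: "i < n \<Longrightarrow> j < n \<Longrightarrow> mat_sum n f I $$ (i, j) = (\<Sum>k\<in>I. f k $$ (i, j))"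
  by (simp add: mat_sum_def)

locale thermal_ris =
  fixes D :: "'w::finite ris"
  assumes is_ris: "is_ris D"
begin

abbreviation "m \<equiv> dim_S D"
abbreviation "n \<equiv> dim_E D"
abbreviation "U \<equiv> U_op D"
abbreviation "Pr \<omega> s \<equiv> spectral_projection (S_E D \<omega>) s"
abbreviation "spec \<omega> \<equiv> real_spectrum (S_E D \<omega>)"

lemma H_E_carrier: "H_E D \<omega> \<in> carrier_mat (n \<omega>) (n \<omega>)"
  and H_E_self_adjoint: "self_adjoint (H_E D \<omega>)"
  and P_nonneg: "0 \<le> P_mat D \<omega> \<nu>"
  and P_stochastic: "(\<Sum>\<nu>\<in>UNIV. P_mat D \<omega> \<nu>) = 1"
  and pi_nonneg: "0 \<le> pi_vec D \<omega>"
  and pi_sum: "(\<Sum>\<omega>\<in>UNIV. pi_vec D \<omega>) = 1"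
  and dim_S_pos: "0 < m"
  using is_ris by (auto simp: is_ris_def)

lemma U_carrier: "U \<omega> \<in> carrier_mat (m * n \<omega>) (m * n \<omega>)"
  using is_ris unfolding U_op_def is_ris_def
  by (intro mat_exp_carrier smult_carrier_mat add_carrier_mat) auto

text \<open>One \<open>W\<close> diagonalises the probe Hamiltonian, its thermal state and the
  entropy operator, because the logarithm undoes the exponential on the diagonal. The last form,
  affine in \<open>H_E\<close>, carries time reversal invariance over to \<open>S_E\<close>.\<close>

lemma S_E_diagonalize:
  obtains W d where "unitary (n \<omega>) W" "S_E D \<omega> = udiag (n \<omega>) W d"
    "rho_E D \<omega> = udiag (n \<omega>) W (\<lambda>l. exp (- d l))"
    "S_E D \<omega> = complex_of_real (inv_temp D \<omega>) \<cdot>\<^sub>m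
      (H_E D \<omega> - complex_of_real (free_energy D \<omega>) \<cdot>\<^sub>m 1\<^sub>m (n \<omega>))"
proof -
  obtain W h where W: "unitary (n \<omega>) W" and h: "H_E D \<omega> = udiag (n \<omega>) W h"
    using spectral_theorem_udiag[OF H_E_carrier H_E_self_adjoint] .
  define d where "d l = inv_temp D \<omega> * (h l - free_energy D \<omega>)" for l
  have H: "H_E D \<omega> - complex_of_real (free_energy D \<omega>) \<cdot>\<^sub>m 1\<^sub>m (n \<omega>) = udiag (n \<omega>) W (\<lambda>l. h l - free_energy D \<omega>)"
    unfolding h udiag_one[OF W, symmetric] udiag_smult[OF W] udiag_diff[OF W] by simp
  have rho: "rho_E D \<omega> = udiag (n \<omega>) W (\<lambda>l. exp (- d l))"
    unfolding rho_E_def H udiag_smult[OF W] mat_exp_udiag[OF W] by (simp add: d_def)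
  have "S_E D \<omega> = - udiag (n \<omega>) W (\<lambda>l. - d l)"
    unfolding S_E_def rho mat_log_udiag[OF W] by simp
  also have "\<dots> = complex_of_real (- 1) \<cdot>\<^sub>m udiag (n \<omega>) W (\<lambda>l. - d l)"
    by (rule eq_matI) auto
  finally have S: "S_E D \<omega> = udiag (n \<omega>) W d"
    unfolding udiag_smult[OF W] by simp
  show thesis
    by (rule that[OF W S rho]) (simp add: S H udiag_smult[OF W] d_def[abs_def])
qed

lemma finite_spec [simp]: "finite (spec \<omega>)"
proof -
  obtain W d where W: "unitary (n \<omega>) W" "S_E D \<omega> = udiag (n \<omega>) W d" using S_E_diagonalize by metis
  show ?thesis unfolding W(2) real_spectrum_udiag[OF W(1)] by simp
qed

lemma finite_Xi [simp]: "finite (Xi D \<omega>)"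
  by (simp add: Xi_def)

lemma Pr_carrier [simp]: "Pr \<omega> s \<in> carrier_mat (n \<omega>) (n \<omega>)"
  and Pr_pos_semidef: "pos_semidef (Pr \<omega> s)"
proof -
  obtain W d where W: "unitary (n \<omega>) W" "S_E D \<omega> = udiag (n \<omega>) W d" using S_E_diagonalize by metis
  show "Pr \<omega> s \<in> carrier_mat (n \<omega>) (n \<omega>)" "pos_semidef (Pr \<omega> s)"
    unfolding W(2) spectral_projection_udiag[OF W(1)] using W(1) by (auto simp: pos_semidef_udiag_iff)
qed

lemma rho_E_spectral: "rho_E D \<omega> = mat_sum (n \<omega>) (\<lambda>s. complex_of_real (exp (- s)) \<cdot>\<^sub>m Pr \<omega> s) (spec \<omega>)"
  and Pr_complete: "mat_sum (n \<omega>) (Pr \<omega>) (spec \<omega>) = 1\<^sub>m (n \<omega>)"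
proof -
  obtain W d where W: "unitary (n \<omega>) W" and S: "S_E D \<omega> = udiag (n \<omega>) W d"
    and rho: "rho_E D \<omega> = udiag (n \<omega>) W (\<lambda>l. exp (- d l))"
    using S_E_diagonalize by metis
  \<comment> \<open>The spectral sum of \<open>f\<close> is the function \<open>f\<close> of
    \<open>S_E\<close>; the two claims are the cases f(s) = e^{-s} and f = 1.\<close>
  have ms: "mat_sum (n \<omega>) (\<lambda>s. complex_of_real (f s) \<cdot>\<^sub>m Pr \<omega> s) (spec \<omega>) = udiag (n \<omega>) W (\<lambda>l. f (d l))" for f
  proof -
    have "mat_sum (n \<omega>) (\<lambda>s. complex_of_real (f s) \<cdot>\<^sub>m Pr \<omega> s) (spec \<omega>) =
       udiag (n \<omega>) W (\<lambda>l. \<Sum>s\<in>d ` {..<n \<omega>}. f s * (if d l = s then 1 else 0))"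
      unfolding S real_spectrum_udiag[OF W] spectral_projection_udiag[OF W] by (rule udiag_mat_sum[OF W])
    also have "\<dots> = udiag (n \<omega>) W (\<lambda>l. f (d l))"
      by (rule udiag_cong) (simp add: mult_delta_right)
    finally show ?thesis .
  qed
  show "rho_E D \<omega> = mat_sum (n \<omega>) (\<lambda>s. complex_of_real (exp (- s)) \<cdot>\<^sub>m Pr \<omega> s) (spec \<omega>)"
    unfolding ms rho ..
  have "complex_of_real 1 \<cdot>\<^sub>m Pr \<omega> s = Pr \<omega> s" for s by (rule eq_matI) auto
  thus "mat_sum (n \<omega>) (Pr \<omega>) (spec \<omega>) = 1\<^sub>m (n \<omega>)"
    using ms[of "\<lambda>_. 1"] udiag_one[OF W] by simp
qed

lemma L_xi_probe_map:
  "L_xi D \<omega> (s, s') \<rho> = complex_of_real (exp (- s)) \<cdot>\<^sub>m probe_map m (n \<omega>) (Pr \<omega> s) (Pr \<omega> s') (U \<omega>) \<rho>"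
  by (simp add: L_xi_def probe_map_def)

lemma L_xi_carrier [simp]: "L_xi D \<omega> \<xi> \<rho> \<in> carrier_mat m m"
  by (cases \<xi>) (simp add: L_xi_probe_map)

lemma L_xi_pos_semidef:
  assumes "\<rho> \<in> carrier_mat m m" "pos_semidef \<rho>"
  shows "pos_semidef (L_xi D \<omega> \<xi> \<rho>)"
  using assms U_carrier[of \<omega>]
  by (cases \<xi>) (auto simp: L_xi_probe_map Pr_pos_semidef
      intro!: pos_semidef_smult[of _ m] pos_semidef_probe_map)

lemma mat_tr_mult_L_xi:
  assumes "X \<in> carrier_mat m m" "\<rho> \<in> carrier_mat m m"
  shows "mat_tr (X * L_xi D \<omega> (s, s') \<rho>) =
    complex_of_real (exp (- s)) * mat_tr (X * probe_map m (n \<omega>) (Pr \<omega> s) (Pr \<omega> s') (U \<omega>) \<rho>)"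
  using assms by (simp add: L_xi_probe_map mult_smult_distrib[of _ m m _ m] mat_tr_smult[OF mult_carrier_mat[of _ m m _ m]])

lemma L_map_carrier [simp]: "L_map D \<omega> \<rho> \<in> carrier_mat m m"
  by (simp add: L_map_def)

text \<open>Summing over the readout s' resolves the identity on the probe; summing over the
  preparation s resolves its thermal state.\<close>

lemma mat_tr_mult_L_map:
  assumes X: "X \<in> carrier_mat m m" and \<rho>: "\<rho> \<in> carrier_mat m m"
  shows "mat_tr (X * L_map D \<omega> \<rho>) = (\<Sum>\<xi>\<in>Xi D \<omega>. mat_tr (X * L_xi D \<omega> \<xi> \<rho>))"
proof -
  let ?N = "m * n \<omega>" and ?U = "U \<omega>" and ?M = "U \<omega> * kron \<rho> (rho_E D \<omega>) * mat_adjoint (U \<omega>)"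
  have rho: "rho_E D \<omega> \<in> carrier_mat (n \<omega>) (n \<omega>)" by (simp add: rho_E_spectral)
  have M: "?M \<in> carrier_mat ?N ?N"
    using U_carrier[of \<omega>] \<rho> rho by (auto intro!: mult_carrier_mat[of _ ?N ?N])
  have Ua: "mat_adjoint ?U \<in> carrier_mat ?N ?N" using U_carrier[of \<omega>] by simp
  have kron_rho: "kron \<rho> (rho_E D \<omega>) = mat_sum ?N (\<lambda>s. kron \<rho> (complex_of_real (exp (- s)) \<cdot>\<^sub>m Pr \<omega> s)) (spec \<omega>)"
    unfolding rho_E_spectral using \<rho> by (intro kron_mat_sum) auto
  have inner: "mat_tr (kron X (Pr \<omega> s') * ?M) = (\<Sum>s\<in>spec \<omega>. mat_tr (X * L_xi D \<omega> (s, s') \<rho>))" for s'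
  proof -
    let ?V = "mat_adjoint ?U * kron X (Pr \<omega> s') * mat_adjoint (mat_adjoint ?U)"
    have V: "?V \<in> carrier_mat ?N ?N"
      using U_carrier[of \<omega>] X by (auto intro!: mult_carrier_mat[of _ ?N ?N])
    have "mat_tr (kron X (Pr \<omega> s') * ?M) = mat_tr (X * probe_map m (n \<omega>) (rho_E D \<omega>) (Pr \<omega> s') ?U \<rho>)"
      using X \<rho> rho U_carrier by (intro mat_tr_mult_probe_map[symmetric]) auto
    \<comment> \<open>\<open>rho_E\<close> sits inside the conjugation by \<open>U\<close>. Passing
      to the dual brings it into the outer factor, where its spectral sum can be pulled out of the
      trace.\<close>
    also have "\<dots> = mat_tr (\<rho> * probe_map m (n \<omega>) (Pr \<omega> s') (rho_E D \<omega>) (mat_adjoint ?U) X)"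
      using X \<rho> rho U_carrier by (intro probe_map_dual) auto
    also have "\<dots> = mat_tr (kron \<rho> (rho_E D \<omega>) * ?V)"
      using X \<rho> rho Ua by (intro mat_tr_mult_probe_map) auto
    also have "\<dots> = (\<Sum>s\<in>spec \<omega>. mat_tr (kron \<rho> (complex_of_real (exp (- s)) \<cdot>\<^sub>m Pr \<omega> s) * ?V))"
      unfolding kron_rho using V \<rho> by (intro mat_tr_mat_sum_mult) auto
    also have "\<dots> = (\<Sum>s\<in>spec \<omega>. mat_tr (X * L_xi D \<omega> (s, s') \<rho>))"
    proof (rule sum.cong)
      fix s
      have k: "kron \<rho> (Pr \<omega> s) \<in> carrier_mat ?N ?N" using \<rho> by simp
      have "mat_tr (kron \<rho> (complex_of_real (exp (- s)) \<cdot>\<^sub>m Pr \<omega> s) * ?V) =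
          complex_of_real (exp (- s)) * mat_tr (kron \<rho> (Pr \<omega> s) * ?V)"
        using k V \<rho> by (simp add: kron_smult_right[of _ m _ "n \<omega>"] mult_smult_assoc_mat[of _ ?N ?N _ ?N]
          mat_tr_smult[OF mult_carrier_mat[of _ ?N ?N _ ?N]])
      also have "mat_tr (kron \<rho> (Pr \<omega> s) * ?V) = mat_tr (\<rho> * probe_map m (n \<omega>) (Pr \<omega> s') (Pr \<omega> s) (mat_adjoint ?U) X)"
        using X \<rho> Ua by (intro mat_tr_mult_probe_map[symmetric]) auto
      also have "\<dots> = mat_tr (X * probe_map m (n \<omega>) (Pr \<omega> s) (Pr \<omega> s') ?U \<rho>)"
        using X \<rho> U_carrier by (intro probe_map_dual[symmetric]) auto
      finally show "mat_tr (kron \<rho> (complex_of_real (exp (- s)) \<cdot>\<^sub>m Pr \<omega> s) * ?V) = mat_tr (X * L_xi D \<omega> (s, s') \<rho>)"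
        by (simp add: mat_tr_mult_L_xi[OF X \<rho>])
    qed simp
    finally show ?thesis .
  qed
  have "mat_tr (X * L_map D \<omega> \<rho>) = mat_tr (kron X (1\<^sub>m (n \<omega>)) * ?M)"
    unfolding L_map_def by (rule mat_tr_mult_partial_tr[OF X M])
  also have "kron X (1\<^sub>m (n \<omega>)) = mat_sum ?N (\<lambda>s. kron X (Pr \<omega> s)) (spec \<omega>)"
    unfolding Pr_complete[symmetric] using X by (intro kron_mat_sum) auto
  also have "mat_tr (\<dots> * ?M) = (\<Sum>s'\<in>spec \<omega>. mat_tr (kron X (Pr \<omega> s') * ?M))"
    using X M by (intro mat_tr_mat_sum_mult) auto
  also have "\<dots> = (\<Sum>s'\<in>spec \<omega>. \<Sum>s\<in>spec \<omega>. mat_tr (X * L_xi D \<omega> (s, s') \<rho>))"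
    by (simp only: inner)
  also have "\<dots> = (\<Sum>s\<in>spec \<omega>. \<Sum>s'\<in>spec \<omega>. mat_tr (X * L_xi D \<omega> (s, s') \<rho>))"
    by (rule sum.swap)
  also have "\<dots> = (\<Sum>\<xi>\<in>Xi D \<omega>. mat_tr (X * L_xi D \<omega> \<xi> \<rho>))"
    by (simp add: Xi_def sum.cartesian_product)
  finally show ?thesis .
qed

definition weight :: "real \<Rightarrow> real \<times> real \<Rightarrow> real" where
  "weight a \<xi> = exp (- a * (snd \<xi> - fst \<xi>))"

definition tilted_L :: "real \<Rightarrow> 'w \<Rightarrow> complex mat \<Rightarrow> complex mat" where
  "tilted_L a \<omega> \<rho> = mat_sum m (\<lambda>\<xi>. complex_of_real (weight a \<xi>) \<cdot>\<^sub>m L_xi D \<omega> \<xi> \<rho>) (Xi D \<omega>)"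

text \<open>The dual of \<open>tilted_L\<close> for the trace pairing, in the form given by
  \<open>probe_map_dual\<close>; the factor \<open>exp (- fst \<xi>)\<close> is the Gibbs weight
  contained in \<open>L_xi\<close>.\<close>

definition tilted_L_dual :: "real \<Rightarrow> 'w \<Rightarrow> complex mat \<Rightarrow> complex mat" where
  "tilted_L_dual a \<omega> X = mat_sum m (\<lambda>\<xi>. complex_of_real (weight a \<xi> * exp (- fst \<xi>)) \<cdot>\<^sub>m
     probe_map m (n \<omega>) (Pr \<omega> (snd \<xi>)) (Pr \<omega> (fst \<xi>)) (mat_adjoint (U \<omega>)) X) (Xi D \<omega>)"

lemma weight_pos: "0 < weight a \<xi>"
  by (simp add: weight_def)

lemma tilted_L_carrier [simp]: "tilted_L a \<omega> \<rho> \<in> carrier_mat m m"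
  and tilted_L_dual_carrier [simp]: "tilted_L_dual a \<omega> X \<in> carrier_mat m m"
  by (simp_all add: tilted_L_def tilted_L_dual_def)

lemma tilted_L_pos_semidef:
  "\<rho> \<in> carrier_mat m m \<Longrightarrow> pos_semidef \<rho> \<Longrightarrow> pos_semidef (tilted_L a \<omega> \<rho>)"
  unfolding tilted_L_def
  by (intro pos_semidef_mat_sum pos_semidef_smult[of _ m] L_xi_pos_semidef)
    (auto simp: less_imp_le[OF weight_pos])

lemma mat_tr_mult_tilted_L:
  assumes X: "X \<in> carrier_mat m m"
  shows "mat_tr (X * tilted_L a \<omega> \<rho>) = (\<Sum>\<xi>\<in>Xi D \<omega>. complex_of_real (weight a \<xi>) * mat_tr (X * L_xi D \<omega> \<xi> \<rho>))"
  unfolding tilted_L_def using X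
  by (subst mat_tr_mult_mat_sum)
    (auto simp: mult_smult_distrib[of _ m m _ m] mat_tr_smult[OF mult_carrier_mat[of _ m m _ m]])

lemma tilted_L_duality:
  assumes X: "X \<in> carrier_mat m m" and \<rho>: "\<rho> \<in> carrier_mat m m"
  shows "mat_tr (tilted_L_dual a \<omega> X * \<rho>) = mat_tr (X * tilted_L a \<omega> \<rho>)"
proof -
  have Ua: "mat_adjoint (U \<omega>) \<in> carrier_mat (m * n \<omega>) (m * n \<omega>)" using U_carrier[of \<omega>] by simp
  have "mat_tr (tilted_L_dual a \<omega> X * \<rho>) = mat_tr (\<rho> * tilted_L_dual a \<omega> X)"
    using \<rho> by (intro mat_tr_mult_comm) auto
  also have "\<dots> = (\<Sum>\<xi>\<in>Xi D \<omega>. complex_of_real (weight a \<xi> * exp (- fst \<xi>)) *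
     mat_tr (\<rho> * probe_map m (n \<omega>) (Pr \<omega> (snd \<xi>)) (Pr \<omega> (fst \<xi>)) (mat_adjoint (U \<omega>)) X))"
    unfolding tilted_L_dual_def using \<rho>
    by (subst mat_tr_mult_mat_sum)
      (auto simp: mult_smult_distrib[of _ m m _ m] mat_tr_smult[OF mult_carrier_mat[of _ m m _ m]])
  also have "\<dots> = (\<Sum>\<xi>\<in>Xi D \<omega>. complex_of_real (weight a \<xi>) * mat_tr (X * L_xi D \<omega> \<xi> \<rho>))"
    using probe_map_dual[OF Pr_carrier Pr_carrier U_carrier X \<rho>]
    by (intro sum.cong refl) (auto simp: mat_tr_mult_L_xi[OF X \<rho>])
  finally show ?thesis by (simp add: mat_tr_mult_tilted_L[OF X])
qed

lemma mat_tr_mult_tilted_L_0: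
  assumes "X \<in> carrier_mat m m" "\<rho> \<in> carrier_mat m m"
  shows "mat_tr (X * tilted_L 0 \<omega> \<rho>) = mat_tr (X * L_map D \<omega> \<rho>)"
  using assms by (simp add: mat_tr_mult_tilted_L mat_tr_mult_L_map weight_def)

section \<open>The Heisenberg dual of the tilted extended map\<close>

definition mean_P :: "('w \<Rightarrow> complex mat) \<Rightarrow> 'w \<Rightarrow> complex mat" where
  "mean_P X \<omega> = mat_sum m (\<lambda>\<nu>. complex_of_real (P_mat D \<omega> \<nu>) \<cdot>\<^sub>m X \<nu>) UNIV"

text \<open>In the tilted extended map the probe acts before the chain jumps, so in the dual the
  average over the next probe is taken first.\<close>

definition heis :: "('w \<Rightarrow> real) \<Rightarrow> ('w \<Rightarrow> complex mat) \<Rightarrow> 'w \<Rightarrow> complex mat" where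
  "heis \<alpha> X \<omega> = tilted_L_dual (\<alpha> \<omega>) \<omega> (mean_P X \<omega>)"

lemma mean_P_carrier [simp]: "mean_P X \<omega> \<in> carrier_mat m m"
  and heis_carrier [simp]: "heis \<alpha> X \<omega> \<in> carrier_mat m m"
  by (simp_all add: mean_P_def heis_def)

lemma mat_tr_mean_P_mult:
  assumes "\<And>\<nu>. X \<nu> \<in> carrier_mat m m" "B \<in> carrier_mat m m"
  shows "mat_tr (mean_P X \<omega> * B) = (\<Sum>\<nu>\<in>UNIV. complex_of_real (P_mat D \<omega> \<nu>) * mat_tr (X \<nu> * B))"
  unfolding mean_P_def using assms
  by (subst mat_tr_mat_sum_mult)
    (auto simp: mult_smult_assoc_mat[of _ m m _ m] mat_tr_smult[OF mult_carrier_mat[of _ m m _ m]])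

lemma mat_tr_heis_mult:
  assumes "\<And>\<nu>. X \<nu> \<in> carrier_mat m m" "B \<in> carrier_mat m m"
  shows "mat_tr (heis \<alpha> X \<omega> * B) =
    (\<Sum>\<nu>\<in>UNIV. complex_of_real (P_mat D \<omega> \<nu>) * mat_tr (X \<nu> * tilted_L (\<alpha> \<omega>) \<omega> B))"
  using assms by (simp add: heis_def tilted_L_duality mat_tr_mean_P_mult)

end

section \<open>Time reversal of operators\<close>

definition trev :: "complex mat \<Rightarrow> complex mat \<Rightarrow> complex mat" where
  "trev K Y = K * transpose_mat Y * mat_adjoint K"

text \<open>
  An antiunitary involution \<open>\<theta>\<close> is entrywise conjugation followed by a matrix \<open>K\<close>, which is unitary and
  symmetric.  In terms of \<open>K\<close>, the map \<open>trev K\<close> is the linear anti-automorphism \<open>Y \<mapsto> \<theta> Y\<^sup>* \<theta>\<close>.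
\<close>

definition antilinear_mat :: "nat \<Rightarrow> (complex vec \<Rightarrow> complex vec) \<Rightarrow> complex mat" where
  "antilinear_mat n \<theta> = mat n n (\<lambda>(i, j). \<theta> (unit_vec n j) $ i)"

definition sym_unitary :: "nat \<Rightarrow> complex mat \<Rightarrow> bool" where
  "sym_unitary n K \<longleftrightarrow> unitary n K \<and> transpose_mat K = K"

lemma cscalar_prod_unit_vec:
  fixes u :: "complex vec"
  assumes "u \<in> carrier_vec n" "i < n"
  shows "u \<bullet>c unit_vec n i = u $ i"
proof -
  have "u \<bullet>c unit_vec n i = (\<Sum>k<n. if k = i then u $ k else 0)"
    using assms by (subst cscalar_prod_sum)
      (simp_all add: unit_vec_def if_distrib[of cnj] mult_delta_right cong: if_cong)
  thus ?thesis using assms by simp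
qed

context
  fixes n :: nat and \<theta> :: "complex vec \<Rightarrow> complex vec"
  assumes \<theta>: "antiunitary_involution n \<theta>"
begin

lemma antiunitary_carrier: "v \<in> carrier_vec n \<Longrightarrow> \<theta> v \<in> carrier_vec n"
  and antiunitary_cscalar_prod: "u \<in> carrier_vec n \<Longrightarrow> v \<in> carrier_vec n \<Longrightarrow> \<theta> u \<bullet>c \<theta> v = cnj (u \<bullet>c v)"
  and antiunitary_involutive: "v \<in> carrier_vec n \<Longrightarrow> \<theta> (\<theta> v) = v"
  using \<theta> by (auto simp: antiunitary_involution_def)

text \<open>An entry of \<theta> e_i is its inner product with e_j = \<theta> (\<theta> e_j), and
  antiunitarity removes one \<theta> from both sides. The symmetry of the matrix thus expresses that
  \<theta> is an involution.\<close>

lemma antilinear_mat_sym: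
  assumes "i < n" "j < n"
  shows "\<theta> (unit_vec n i) $ j = \<theta> (unit_vec n j) $ i"
proof -
  have "\<theta> (unit_vec n i) $ j = \<theta> (unit_vec n i) \<bullet>c \<theta> (\<theta> (unit_vec n j))"
    using assms by (simp add: antiunitary_involutive antiunitary_carrier cscalar_prod_unit_vec)
  also have "\<dots> = cnj (unit_vec n i \<bullet>c \<theta> (unit_vec n j))"
    using assms by (intro antiunitary_cscalar_prod) (auto simp: antiunitary_carrier)
  also have "unit_vec n i \<bullet>c \<theta> (unit_vec n j) = cnj (\<theta> (unit_vec n j) \<bullet>c unit_vec n i)"
    using assms by (simp add: cscalar_prod_sum carrier_vecD[OF antiunitary_carrier] mult.commute)
  finally show ?thesis using assms by (simp add: cscalar_prod_unit_vec antiunitary_carrier)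
qed

text \<open>The coordinate is again an inner product with \<theta> (\<theta> e_k), so the matrix
  form follows from the inner product rule together with the symmetry of the matrix.\<close>

lemma antiunitary_index:
  assumes v: "v \<in> carrier_vec n" and k: "k < n"
  shows "\<theta> v $ k = (\<Sum>i<n. antilinear_mat n \<theta> $$ (k, i) * cnj (v $ i))"
proof -
  have "\<theta> v $ k = \<theta> v \<bullet>c \<theta> (\<theta> (unit_vec n k))"
    using v k by (simp add: antiunitary_involutive antiunitary_carrier cscalar_prod_unit_vec)
  also have "\<dots> = cnj (v \<bullet>c \<theta> (unit_vec n k))"
    using v k by (intro antiunitary_cscalar_prod) (auto simp: antiunitary_carrier)
  also have "\<dots> = (\<Sum>i<n. \<theta> (unit_vec n k) $ i * cnj (v $ i))"
    using v k by (simp add: cscalar_prod_sum carrier_vecD[OF antiunitary_carrier] mult.commute)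
  also have "\<dots> = (\<Sum>i<n. antilinear_mat n \<theta> $$ (k, i) * cnj (v $ i))"
    using k antilinear_mat_sym[of k] by (intro sum.cong) (auto simp: antilinear_mat_def)
  finally show ?thesis .
qed

lemma sym_unitary_antilinear_mat: "sym_unitary n (antilinear_mat n \<theta>)"
proof -
  let ?K = "antilinear_mat n \<theta>"
  have K: "?K \<in> carrier_mat n n" by (simp add: antilinear_mat_def)
  have sym: "transpose_mat ?K = ?K"
    by (rule eq_matI) (use antilinear_mat_sym in \<open>auto simp: antilinear_mat_def\<close>)
  have "mat_adjoint ?K * ?K = 1\<^sub>m n"
  proof (rule eq_matI)
    fix i j assume "i < dim_row (1\<^sub>m n :: complex mat)" "j < dim_col (1\<^sub>m n :: complex mat)"
    hence ij: "i < n" "j < n" by auto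
    have "(mat_adjoint ?K * ?K) $$ (i, j) = (\<Sum>k<n. cnj (?K $$ (k, i)) * ?K $$ (k, j))"
      using K ij by (subst mult_mat_index) auto
    also have "\<dots> = \<theta> (unit_vec n j) \<bullet>c \<theta> (unit_vec n i)"
      using ij by (subst cscalar_prod_sum)
        (auto simp: carrier_vecD[OF antiunitary_carrier] antilinear_mat_def mult.commute)
    also have "\<dots> = cnj (unit_vec n j \<bullet>c unit_vec n i)"
      by (intro antiunitary_cscalar_prod) auto
    also have "\<dots> = 1\<^sub>m n $$ (i, j)"
      using ij by (subst cscalar_prod_unit_vec) auto
    finally show "(mat_adjoint ?K * ?K) $$ (i, j) = 1\<^sub>m n $$ (i, j)" .
  qed (use K in auto)
  thus ?thesis using sym K by (simp add: sym_unitary_def unitaryI)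
qed

end

text \<open>Makes \<open>antilinear_commute_mat\<close> applicable on the tensor product, where the
  matrix of the antilinear map is the Kronecker product of the two matrices; the condition on
  \<open>U\<close> then becomes a matrix identity.\<close>

lemma antilinear_tensor_index:
  assumes "antiunitary_involution m \<theta>" "antiunitary_involution n \<eta>" "\<psi> \<in> carrier_vec (m * n)" "p < m * n"
  shows "antilinear_tensor m n \<theta> \<eta> \<psi> $ p =
    (\<Sum>q<m * n. kron (antilinear_mat m \<theta>) (antilinear_mat n \<eta>) $$ (p, q) * cnj (\<psi> $ q))"
proof -
  have "antilinear_tensor m n \<theta> \<eta> \<psi> $ p = (\<Sum>i<m. \<Sum>j<n.
      kron (antilinear_mat m \<theta>) (antilinear_mat n \<eta>) $$ (p, i * n + j) * cnj (\<psi> $ (i * n + j)))"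
    using assms prod_index_div_mod[OF assms(4)]
    by (simp add: antilinear_tensor_def, intro sum.cong refl)
      (simp add: kron_index[of _ m _ n] antilinear_mat_def prod_index_less)
  thus ?thesis by (simp only: sum_prod_index)
qed

text \<open>The entrywise conjugate of \<open>A\<close> is written as the transpose of its adjoint.\<close>

lemma antilinear_commute_mat:
  assumes A: "A \<in> carrier_mat n n" and B: "B \<in> carrier_mat n n" and K: "K \<in> carrier_mat n n"
    and T: "\<And>v. v \<in> carrier_vec n \<Longrightarrow> T v \<in> carrier_vec n"
       "\<And>v k. v \<in> carrier_vec n \<Longrightarrow> k < n \<Longrightarrow> T v $ k = (\<Sum>i<n. K $$ (k, i) * cnj (v $ i))"
    and com: "\<And>v. v \<in> carrier_vec n \<Longrightarrow> T (A *\<^sub>v v) = B *\<^sub>v T v"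
  shows "K * transpose_mat (mat_adjoint A) = B * K"
proof (rule eq_matI)
  fix k j assume "k < dim_row (B * K)" "j < dim_col (B * K)"
  hence kj: "k < n" "j < n" using B K by auto
  have Av: "A *\<^sub>v unit_vec n j \<in> carrier_vec n" by (rule mult_mat_vec_carrier[OF A]) simp
  have "T (unit_vec n j) $ i = K $$ (i, j)" if i: "i < n" for i
  proof -
    have "T (unit_vec n j) $ i = (\<Sum>l<n. if l = j then K $$ (i, l) else 0)"
      using i by (subst T(2))
        (simp_all add: unit_vec_def if_distrib[of cnj] mult_delta_right cong: if_cong)
    thus ?thesis using kj by simp
  qed
  hence "(B * K) $$ (k, j) = (B *\<^sub>v T (unit_vec n j)) $ k"
    using B K kj carrier_vecD[OF T(1)[of "unit_vec n j"]]
    by (subst mult_mat_index; (simp; fail)?) (subst mult_mat_vec_index; simp)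
  also have "\<dots> = T (A *\<^sub>v unit_vec n j) $ k" by (simp add: com)
  also have "\<dots> = (\<Sum>i<n. K $$ (k, i) * cnj (A $$ (i, j)))"
    using kj A by (subst T(2)[OF Av]) (auto intro!: sum.cong)
  also have "\<dots> = (K * transpose_mat (mat_adjoint A)) $$ (k, j)"
    using A K kj by (subst mult_mat_index) auto
  finally show "(K * transpose_mat (mat_adjoint A)) $$ (k, j) = (B * K) $$ (k, j)" by simp
qed (use A B K in auto)

lemma transpose_adjoint: "transpose_mat (mat_adjoint A) = mat_adjoint (transpose_mat (A :: complex mat))"
  by (rule eq_matI) auto

context
  fixes n :: nat and K :: "complex mat"
  assumes K: "sym_unitary n K"
begin

lemma sym_unitary_carrier: "K \<in> carrier_mat n n" "mat_adjoint K \<in> carrier_mat n n"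
  and sym_unitary_inverse: "mat_adjoint K * K = 1\<^sub>m n" "K * mat_adjoint K = 1\<^sub>m n"
  and sym_unitary_sym: "transpose_mat K = K"
  using K by (auto simp: sym_unitary_def unitary_def)

lemma trev_carrier [simp]: "Y \<in> carrier_mat n n \<Longrightarrow> trev K Y \<in> carrier_mat n n"
  using sym_unitary_carrier by (auto simp: trev_def intro!: mult_carrier_mat[of _ n n])

lemma trev_one: "trev K (1\<^sub>m n) = 1\<^sub>m n"
  using sym_unitary_carrier by (simp add: trev_def sym_unitary_inverse right_mult_one_mat[of _ n n])

text \<open>Cyclicity and the invariance of the trace under transposition give this once
  \<open>K\<close> equals its transpose, that is, once the antiunitary map squares to the
  identity.\<close>

lemma mat_tr_trev_swap:
  assumes X: "X \<in> carrier_mat n n" and Y: "Y \<in> carrier_mat n n"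
  shows "mat_tr (X * trev K Y) = mat_tr (Y * trev K X)"
proof -
  note c = sym_unitary_carrier X Y and s = assoc_mult_mat[of _ n n _ n _ n] mult_carrier_mat[of _ n n _ n]
  have "mat_tr (X * trev K Y) = mat_tr ((X * K * transpose_mat Y) * mat_adjoint K)"
    using c by (simp add: trev_def s)
  also have "\<dots> = mat_tr (mat_adjoint K * (X * K * transpose_mat Y))"
    using c by (intro mat_tr_mult_comm[of _ n n]) (auto simp: s)
  also have "\<dots> = mat_tr (mat_adjoint K * X * K * transpose_mat Y)"
    using c by (simp add: s)
  also have "\<dots> = mat_tr (transpose_mat (mat_adjoint K * X * K * transpose_mat Y))"
    using c by (intro mat_tr_transpose[symmetric, of _ n]) (auto simp: s)
  also have "transpose_mat (mat_adjoint K * X * K * transpose_mat Y) =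
     Y * (transpose_mat K * (transpose_mat X * transpose_mat (mat_adjoint K)))"
    using c by (simp add: s transpose_mult[of _ n n _ n])
  also have "\<dots> = Y * trev K X"
    using c by (simp add: trev_def s transpose_adjoint sym_unitary_sym)
  finally show ?thesis .
qed

text \<open>The hypothesis \<open>com\<close> is time reversal invariance in matrix form, with the
  entrywise conjugate of \<open>M\<close> on its left side. As \<open>trev K\<close> reverses
  products, it exchanges conjugation by \<open>M\<close> with conjugation by the adjoint.\<close>

lemma trev_conj:
  assumes M: "M \<in> carrier_mat n n" and com: "K * transpose_mat (mat_adjoint M) = mat_adjoint M * K"
    and Y: "Y \<in> carrier_mat n n"
  shows "M * trev K Y * mat_adjoint M = trev K (mat_adjoint M * Y * M)"
proof -
  have c: "M \<in> carrier_mat n n" "mat_adjoint M \<in> carrier_mat n n" "transpose_mat M \<in> carrier_mat n n"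
    "transpose_mat (mat_adjoint M) \<in> carrier_mat n n" "transpose_mat Y \<in> carrier_mat n n"
    using M Y by auto
  note k = sym_unitary_carrier and s = assoc_mult_mat[of _ n n _ n _ n] mult_carrier_mat[of _ n n _ n]
  have "mat_adjoint (K * transpose_mat (mat_adjoint M)) = transpose_mat M * mat_adjoint K"
    using c k by (simp add: mat_adjoint_mult transpose_adjoint)
  moreover have "mat_adjoint (mat_adjoint M * K) = mat_adjoint K * M"
    using c k by (simp add: mat_adjoint_mult)
  ultimately have 1: "transpose_mat M * mat_adjoint K = mat_adjoint K * M" using com by metis
  \<comment> \<open>Multiplying 1 by \<open>K\<close> on both sides and cancelling \<open>K\<close>
    against its adjoint yields 2.\<close>
  have "K * (transpose_mat M * mat_adjoint K) * K = K * (mat_adjoint K * M) * K" by (simp only: 1)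
  moreover have "K * (transpose_mat M * mat_adjoint K) * K = K * transpose_mat M * (mat_adjoint K * K)"
    using c k by (simp add: s)
  moreover have "K * (mat_adjoint K * M) * K = (K * mat_adjoint K) * (M * K)"
    using c k by (simp add: s)
  ultimately have 2: "K * transpose_mat M = M * K"
    using c k by (simp add: sym_unitary_inverse right_mult_one_mat[of _ n n] left_mult_one_mat[of _ n n]
      mult_carrier_mat[of _ n n _ n])
  have "mat_adjoint (K * transpose_mat M) = transpose_mat (mat_adjoint M) * mat_adjoint K"
    using c k by (simp add: mat_adjoint_mult transpose_adjoint)
  moreover have "mat_adjoint (M * K) = mat_adjoint K * mat_adjoint M"
    using c k by (simp add: mat_adjoint_mult)
  ultimately have 3: "mat_adjoint K * mat_adjoint M = transpose_mat (mat_adjoint M) * mat_adjoint K"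
    using 2 by metis
  have "M * trev K Y * mat_adjoint M = (M * K) * transpose_mat Y * (mat_adjoint K * mat_adjoint M)"
    using c k by (simp add: trev_def s)
  also have "\<dots> = K * (transpose_mat M * (transpose_mat Y * transpose_mat (mat_adjoint M))) * mat_adjoint K"
    unfolding 3 2[symmetric] using c k by (simp add: s)
  also have "transpose_mat M * (transpose_mat Y * transpose_mat (mat_adjoint M)) = transpose_mat (mat_adjoint M * Y * M)"
    using c M Y by (simp add: transpose_mult[of _ n n _ n] s)
  finally show ?thesis by (simp add: trev_def)
qed

text \<open>\<open>trev K\<close> sends a matrix diagonalised by \<open>W\<close> to one
  diagonalised by \<open>?V\<close> with the same eigenvalues. Spectral projections do not depend on
  the diagonalisation, so they are fixed when the matrix is.\<close>

lemma trev_spectral_projection: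
  assumes W: "unitary n W" and com: "trev K (udiag n W d) = udiag n W d"
  shows "trev K (spectral_projection (udiag n W d) s) = spectral_projection (udiag n W d) s"
proof -
  let ?V = "K * transpose_mat (mat_adjoint W)"
  have W': "W \<in> carrier_mat n n" "mat_adjoint W \<in> carrier_mat n n" "transpose_mat W \<in> carrier_mat n n"
     "transpose_mat (mat_adjoint W) \<in> carrier_mat n n" and iW: "W * mat_adjoint W = 1\<^sub>m n" "mat_adjoint W * W = 1\<^sub>m n"
    using W by (auto simp: unitary_def)
  note k = sym_unitary_carrier and s = assoc_mult_mat[of _ n n _ n _ n] mult_carrier_mat[of _ n n _ n]
  have "transpose_mat W * transpose_mat (mat_adjoint W) = transpose_mat (mat_adjoint W * W)"
    using W' by (simp add: transpose_mult[of _ n n _ n])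
  hence uT: "unitary n (transpose_mat (mat_adjoint W))"
    using W' iW by (intro unitaryI) (auto simp: transpose_adjoint)
  have V: "unitary n ?V"
    using K uT by (intro unitary_mult) (simp add: sym_unitary_def)
  have adj: "mat_adjoint ?V = transpose_mat W * mat_adjoint K"
    using W' k by (simp add: mat_adjoint_mult transpose_adjoint)
  have dT: "transpose_mat (real_diag n e) = real_diag n e" for e
    by (rule eq_matI) (auto simp: real_diag_def)
  have tr: "trev K (udiag n W e) = udiag n ?V e" for e
  proof -
    have "transpose_mat (udiag n W e) = transpose_mat (mat_adjoint W) * (real_diag n e * transpose_mat W)"
      using W' by (simp add: udiag_def transpose_mult[of _ n n _ n] s dT)
    thus ?thesis using W' k by (simp add: trev_def udiag_def[of n ?V] adj s)
  qed
  have "trev K (spectral_projection (udiag n W d) s) = spectral_projection (udiag n ?V d) s"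
    unfolding spectral_projection_udiag[OF W] spectral_projection_udiag[OF V] tr ..
  also have "udiag n ?V d = udiag n W d" using com tr by simp
  finally show ?thesis .
qed

end

lemma sym_unitary_kron:
  assumes "sym_unitary m K" "sym_unitary n L"
  shows "sym_unitary (m * n) (kron K L)"
proof -
  have c: "K \<in> carrier_mat m m" "L \<in> carrier_mat n n" using assms sym_unitary_carrier by auto
  have "kron (1\<^sub>m m) (1\<^sub>m n) = (1\<^sub>m (m * n) :: complex mat)"
  proof (rule eq_matI)
    fix p q assume "p < dim_row (1\<^sub>m (m * n) :: complex mat)" "q < dim_col (1\<^sub>m (m * n) :: complex mat)"
    hence pq: "p < m * n" "q < m * n" by auto
    have "p = q \<longleftrightarrow> p div n = q div n \<and> p mod n = q mod n" by (metis div_mult_mod_eq)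
    thus "kron (1\<^sub>m m) (1\<^sub>m n) $$ (p, q) = (1\<^sub>m (m * n) :: complex mat) $$ (p, q)"
      using pq prod_index_div_mod[OF pq(1)] prod_index_div_mod[OF pq(2)]
      by (subst kron_index[of _ m _ n]) auto
  qed (auto simp: kron_def)
  hence "mat_adjoint (kron K L) * kron K L = 1\<^sub>m (m * n)"
    using c assms by (simp add: kron_adjoint[of _ m _ n] kron_mult[of _ m _ n] sym_unitary_inverse)
  thus ?thesis
    using c assms by (simp add: sym_unitary_def unitaryI kron_transpose[of _ m _ n] sym_unitary_sym)
qed

lemma trev_kron:
  assumes "K \<in> carrier_mat m m" "L \<in> carrier_mat n n" "X \<in> carrier_mat m m" "Y \<in> carrier_mat n n"
  shows "trev (kron K L) (kron X Y) = kron (trev K X) (trev L Y)"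
  using assms unfolding trev_def
  by (simp add: kron_transpose[of _ m _ n] kron_adjoint[of _ m _ n] kron_mult[of _ m _ n] mult_carrier_mat[of _ m m _ m]
     mult_carrier_mat[of _ n n _ n])

text \<open>Microscopic reversibility. Duality alone exchanges \<open>A\<close> and \<open>B\<close>
  at the price of replacing \<open>M\<close> by its adjoint; time reversal undoes that replacement,
  so the same interaction stands on both sides.\<close>

lemma probe_map_reversal:
  assumes K: "sym_unitary m K" and L: "sym_unitary n L"
    and A: "A \<in> carrier_mat n n" "trev L A = A" and B: "B \<in> carrier_mat n n" "trev L B = B"
    and M: "M \<in> carrier_mat (m * n) (m * n)"
    and com: "kron K L * transpose_mat (mat_adjoint M) = mat_adjoint M * kron K L"
    and X: "X \<in> carrier_mat m m" and Z: "Z \<in> carrier_mat m m"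
  shows "mat_tr (X * probe_map m n A B M (trev K Z)) = mat_tr (Z * probe_map m n B A M (trev K X))"
proof -
  let ?N = "m * n"
  note KL = sym_unitary_kron[OF K L] and s = assoc_mult_mat[of _ ?N ?N _ ?N _ ?N] mult_carrier_mat[of _ ?N ?N _ ?N]
  have cK: "K \<in> carrier_mat m m" "L \<in> carrier_mat n n" using K L sym_unitary_carrier by auto
  have k: "kron Z A \<in> carrier_mat ?N ?N" "kron X B \<in> carrier_mat ?N ?N"
     "kron (trev K X) B \<in> carrier_mat ?N ?N" "mat_adjoint M \<in> carrier_mat ?N ?N"
    using A B X Z M trev_carrier[OF K X] by auto
  have t: "trev (kron K L) (kron Z A) = kron (trev K Z) A" "trev (kron K L) (kron X B) = kron (trev K X) B"
    using trev_kron[OF cK Z A(1)] trev_kron[OF cK X B(1)] A B by auto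
  have "mat_tr (X * probe_map m n A B M (trev K Z)) = mat_tr (kron X B * (M * trev (kron K L) (kron Z A) * mat_adjoint M))"
    unfolding t using A B X Z M trev_carrier[OF K Z] by (intro mat_tr_mult_probe_map) auto
  also have "\<dots> = mat_tr (kron X B * trev (kron K L) (mat_adjoint M * kron Z A * M))"
    by (simp only: trev_conj[OF KL M com k(1)])
  also have "\<dots> = mat_tr ((mat_adjoint M * kron Z A * M) * kron (trev K X) B)"
    unfolding t(2)[symmetric] using k M by (intro mat_tr_trev_swap[OF KL]) (auto simp: s)
  also have "\<dots> = mat_tr (mat_adjoint M * (kron Z A * (M * kron (trev K X) B)))"
    using k M by (simp add: s)
  also have "\<dots> = mat_tr (kron Z A * (M * kron (trev K X) B) * mat_adjoint M)"
    using k M by (intro mat_tr_mult_comm[of _ ?N ?N]) (auto simp: s)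
  also have "\<dots> = mat_tr (kron Z A * (M * kron (trev K X) B * mat_adjoint M))"
    using k M by (simp add: s)
  also have "\<dots> = mat_tr (Z * probe_map m n B A M (trev K X))"
    using A B X Z M trev_carrier[OF K X] by (intro mat_tr_mult_probe_map[symmetric]) auto
  finally show ?thesis .
qed

section \<open>Reversal symmetry of the tilted dynamics\<close>

context thermal_ris
begin

lemma time_reversal_matrices:
  assumes "time_reversal_invariant D"
  obtains K L where "sym_unitary m K" "\<And>\<omega>. sym_unitary (n \<omega>) (L \<omega>)"
    "\<And>\<omega> s. trev (L \<omega>) (Pr \<omega> s) = Pr \<omega> s"
    "\<And>\<omega>. kron K (L \<omega>) * transpose_mat (mat_adjoint (U \<omega>)) = mat_adjoint (U \<omega>) * kron K (L \<omega>)"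
proof -
  obtain \<theta> \<eta> where \<theta>: "antiunitary_involution m \<theta>" and \<eta>: "\<And>\<omega>. antiunitary_involution (n \<omega>) (\<eta> \<omega>)"
    and H: "\<And>\<omega> v. v \<in> carrier_vec (n \<omega>) \<Longrightarrow> \<eta> \<omega> (H_E D \<omega> *\<^sub>v v) = H_E D \<omega> *\<^sub>v \<eta> \<omega> v"
    and U: "\<And>\<omega> \<psi>. \<psi> \<in> carrier_vec (m * n \<omega>) \<Longrightarrow>
       antilinear_tensor m (n \<omega>) \<theta> (\<eta> \<omega>) (U \<omega> *\<^sub>v \<psi>) = mat_adjoint (U \<omega>) *\<^sub>v antilinear_tensor m (n \<omega>) \<theta> (\<eta> \<omega>) \<psi>"
    using assms unfolding time_reversal_invariant_def by metis
  define K where "K = antilinear_mat m \<theta>"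
  define L where "L \<omega> = antilinear_mat (n \<omega>) (\<eta> \<omega>)" for \<omega>
  have K: "sym_unitary m K" using sym_unitary_antilinear_mat[OF \<theta>] by (simp add: K_def)
  have L: "sym_unitary (n \<omega>) (L \<omega>)" for \<omega> using sym_unitary_antilinear_mat[OF \<eta>] by (simp add: L_def)
  note cL = sym_unitary_carrier[OF L] and cK = sym_unitary_carrier[OF K]
  have comU: "kron K (L \<omega>) * transpose_mat (mat_adjoint (U \<omega>)) = mat_adjoint (U \<omega>) * kron K (L \<omega>)" for \<omega>
    by (rule antilinear_commute_mat[where n = "m * n \<omega>" and T = "antilinear_tensor m (n \<omega>) \<theta> (\<eta> \<omega>)"])
      (use U_carrier cK cL U antilinear_tensor_index[OF \<theta> \<eta>] in
        \<open>auto simp: K_def L_def, auto simp: antilinear_tensor_def\<close>)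
  have comH: "L \<omega> * transpose_mat (H_E D \<omega>) = H_E D \<omega> * L \<omega>" for \<omega>
  proof -
    have "L \<omega> * transpose_mat (mat_adjoint (H_E D \<omega>)) = H_E D \<omega> * L \<omega>"
      by (rule antilinear_commute_mat[where n = "n \<omega>" and T = "\<eta> \<omega>"])
        (use H_E_carrier cL antiunitary_carrier[OF \<eta>] antiunitary_index[OF \<eta>] H in \<open>auto simp: L_def\<close>)
    thus ?thesis using H_E_self_adjoint[of \<omega>] by (simp add: self_adjoint_def)
  qed
  have "trev (L \<omega>) (Pr \<omega> s) = Pr \<omega> s" for \<omega> s
  proof -
    obtain W d where W: "unitary (n \<omega>) W" and S: "S_E D \<omega> = udiag (n \<omega>) W d"
      and SH: "S_E D \<omega> = complex_of_real (inv_temp D \<omega>) \<cdot>\<^sub>m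
        (H_E D \<omega> - complex_of_real (free_energy D \<omega>) \<cdot>\<^sub>m 1\<^sub>m (n \<omega>))"
      using S_E_diagonalize by metis
    let ?b = "complex_of_real (inv_temp D \<omega>)" and ?c = "- complex_of_real (inv_temp D \<omega> * free_energy D \<omega>)"
    let ?H = "H_E D \<omega>" and ?I = "1\<^sub>m (n \<omega>) :: complex mat"
    note Hc = H_E_carrier[of \<omega>]
    \<comment> \<open>\<open>S_E\<close> is affine in \<open>H_E\<close> with scalar coefficients,
      so the relation \<open>comH\<close> passes to it, and from it to the spectral
      projections.\<close>
    have S1: "S_E D \<omega> = ?b \<cdot>\<^sub>m ?H + ?c \<cdot>\<^sub>m ?I"
      unfolding SH by (rule eq_matI) (use Hc in \<open>auto simp: algebra_simps\<close>)
    have S2: "transpose_mat (S_E D \<omega>) = ?b \<cdot>\<^sub>m transpose_mat ?H + ?c \<cdot>\<^sub>m ?I"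
      unfolding S1 by (rule eq_matI) (use Hc in auto)
    have "L \<omega> * transpose_mat (S_E D \<omega>) = ?b \<cdot>\<^sub>m (L \<omega> * transpose_mat ?H) + ?c \<cdot>\<^sub>m L \<omega>"
      unfolding S2 using Hc cL[of \<omega>]
      by (subst mult_add_distrib_mat[of _ "n \<omega>" "n \<omega>"])
        (auto simp: mult_smult_distrib[of _ "n \<omega>" "n \<omega>" _ "n \<omega>"] right_mult_one_mat[of _ "n \<omega>" "n \<omega>"])
    also have "\<dots> = S_E D \<omega> * L \<omega>"
      unfolding S1 comH using Hc cL[of \<omega>]
      by (subst add_mult_distrib_mat[of _ "n \<omega>" "n \<omega>"])
        (auto simp: mult_smult_assoc_mat[of _ "n \<omega>" "n \<omega>" _ "n \<omega>"] left_mult_one_mat[of _ "n \<omega>" "n \<omega>"])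
    finally have "trev (L \<omega>) (S_E D \<omega>) = S_E D \<omega> * L \<omega> * mat_adjoint (L \<omega>)"
      by (simp add: trev_def)
    also have "\<dots> = S_E D \<omega>"
      using cL[of \<omega>] sym_unitary_inverse[OF L, of \<omega>] W
      by (simp add: S assoc_mult_mat[of _ "n \<omega>" "n \<omega>" _ "n \<omega>" _ "n \<omega>"] right_mult_one_mat[of _ "n \<omega>" "n \<omega>"])
    finally show ?thesis
      unfolding S by (rule trev_spectral_projection[OF L W])
  qed
  from that[OF K L this comU] show thesis .
qed

lemma mean_P_one: "mean_P (\<lambda>_. 1\<^sub>m m) = (\<lambda>_. 1\<^sub>m m)"
proof (rule ext, rule eq_matI)
  fix \<omega> i j assume "i < dim_row (1\<^sub>m m :: complex mat)" "j < dim_col (1\<^sub>m m :: complex mat)"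
  thus "mean_P (\<lambda>_. 1\<^sub>m m) \<omega> $$ (i, j) = 1\<^sub>m m $$ (i, j)"
    using P_stochastic[of \<omega>] by (simp add: mean_P_def mat_sum_index flip: of_real_sum)
qed (simp_all add: mean_P_def mat_sum_def)

definition heis_iter :: "('w \<Rightarrow> real) \<Rightarrow> nat \<Rightarrow> 'w \<Rightarrow> complex mat" where
  "heis_iter \<alpha> N = (heis \<alpha> ^^ N) (\<lambda>_. 1\<^sub>m m)"

lemma heis_iter_0 [simp]: "heis_iter \<alpha> 0 = (\<lambda>_. 1\<^sub>m m)"
  and heis_iter_Suc [simp]: "heis_iter \<alpha> (Suc N) = heis \<alpha> (heis_iter \<alpha> N)"
  by (simp_all add: heis_iter_def)

lemma heis_iter_carrier [simp]: "heis_iter \<alpha> N \<omega> \<in> carrier_mat m m"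
  by (cases N) simp_all

text \<open>\<open>probe_map_reversal\<close> exchanges the two measured values, so the Gibbs factor
  of s has to be rewritten as that of s'. The quotient of the two factors is exactly one unit of
  tilt, which turns a into 1 - a.\<close>

lemma tilted_L_reversal:
  assumes K: "sym_unitary m K" and L: "\<And>\<omega>. sym_unitary (n \<omega>) (L \<omega>)"
    and PrL: "\<And>\<omega> s. trev (L \<omega>) (Pr \<omega> s) = Pr \<omega> s"
    and com: "\<And>\<omega>. kron K (L \<omega>) * transpose_mat (mat_adjoint (U \<omega>)) = mat_adjoint (U \<omega>) * kron K (L \<omega>)"
    and X: "X \<in> carrier_mat m m" and Z: "Z \<in> carrier_mat m m"
  shows "mat_tr (tilted_L_dual a \<omega> X * trev K Z) = mat_tr (X * trev K (tilted_L_dual (1 - a) \<omega> Z))"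
proof -
  let ?T = "\<lambda>X s s' Z. mat_tr (X * probe_map m (n \<omega>) (Pr \<omega> s) (Pr \<omega> s') (U \<omega>) (trev K Z))"
  have expand: "mat_tr (tilted_L_dual b \<omega> X * trev K Z) =
      (\<Sum>s\<in>spec \<omega>. \<Sum>s'\<in>spec \<omega>. complex_of_real (exp (- b * (s' - s) - s)) * ?T X s s' Z)"
    if "X \<in> carrier_mat m m" "Z \<in> carrier_mat m m" for b X Z
    using that trev_carrier[OF K]
    by (simp add: tilted_L_duality mat_tr_mult_tilted_L mat_tr_mult_L_xi weight_def Xi_def
        sum.cartesian_product' exp_diff exp_minus divide_inverse mult_ac
        flip: sum.cartesian_product)
  have "mat_tr (tilted_L_dual a \<omega> X * trev K Z) =
      (\<Sum>s\<in>spec \<omega>. \<Sum>s'\<in>spec \<omega>. complex_of_real (exp (- (1 - a) * (s - s') - s')) * ?T Z s' s X)"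
    unfolding expand[OF X Z]
  proof (intro sum.cong refl)
    fix s s'
    have "- a * (s' - s) - s = - (1 - a) * (s - s') - s'" by (simp add: algebra_simps)
    thus "complex_of_real (exp (- a * (s' - s) - s)) * ?T X s s' Z =
       complex_of_real (exp (- (1 - a) * (s - s') - s')) * ?T Z s' s X"
      using probe_map_reversal[OF K L Pr_carrier PrL Pr_carrier PrL U_carrier com X Z, of \<omega> s s'] by simp
  qed
  also have "\<dots> = mat_tr (tilted_L_dual (1 - a) \<omega> Z * trev K X)"
    unfolding expand[OF Z X] by (rule sum.swap)
  also have "\<dots> = mat_tr (X * trev K (tilted_L_dual (1 - a) \<omega> Z))"
    using X by (intro mat_tr_trev_swap[OF K]) auto
  finally show ?thesis .
qed

text \<open>The pairing \<open>pp\<close> is weighted by \<pi> and twisted by time reversal. With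
  respect to it detailed balance makes \<open>mean_P\<close> symmetric, and the probe maps at tilts
  a and 1 - a are adjoint to each other.\<close>

lemma heis_iter_reversal:
  assumes TRI: "time_reversal_invariant D" and DB: "detailed_balance D"
  shows "(\<Sum>\<omega>\<in>UNIV. complex_of_real (pi_vec D \<omega>) * mat_tr (heis_iter \<alpha> N \<omega>)) =
     (\<Sum>\<omega>\<in>UNIV. complex_of_real (pi_vec D \<omega>) * mat_tr (heis_iter (\<lambda>\<omega>. 1 - \<alpha> \<omega>) N \<omega>))"
proof -
  obtain K L where K: "sym_unitary m K" and L: "\<And>\<omega>. sym_unitary (n \<omega>) (L \<omega>)"
    and PrL: "\<And>\<omega> s. trev (L \<omega>) (Pr \<omega> s) = Pr \<omega> s"
    and com: "\<And>\<omega>. kron K (L \<omega>) * transpose_mat (mat_adjoint (U \<omega>)) = mat_adjoint (U \<omega>) * kron K (L \<omega>)"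
    using time_reversal_matrices[OF TRI] by blast
  note rev = tilted_L_reversal[OF K L PrL com]
  have db: "pi_vec D \<omega> * P_mat D \<omega> \<nu> = pi_vec D \<nu> * P_mat D \<nu> \<omega>" for \<omega> \<nu>
    using DB by (simp add: detailed_balance_def)
  define pp where "pp X Z = (\<Sum>\<omega>\<in>UNIV. complex_of_real (pi_vec D \<omega>) * mat_tr (X \<omega> * trev K (Z \<omega>)))"
    for X Z :: "'w \<Rightarrow> complex mat"
  \<comment> \<open>The adjoint of \<open>heis \<alpha>\<close> under \<open>pp\<close>: the same
    two factors at the reflected tilt, in the opposite order.\<close>
  define B where "B Z = mean_P (\<lambda>\<omega>. tilted_L_dual (1 - \<alpha> \<omega>) \<omega> (Z \<omega>))" for Z
  have step: "pp (heis \<alpha> X) Z = pp X (B Z)"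
    if X: "\<And>\<omega>. X \<omega> \<in> carrier_mat m m" and Z: "\<And>\<omega>. Z \<omega> \<in> carrier_mat m m" for X Z
  proof -
    let ?Y = "\<lambda>\<omega>. tilted_L_dual (1 - \<alpha> \<omega>) \<omega> (Z \<omega>)"
    have "pp (heis \<alpha> X) Z = (\<Sum>\<omega>\<in>UNIV. complex_of_real (pi_vec D \<omega>) * mat_tr (mean_P X \<omega> * trev K (?Y \<omega>)))"
      unfolding pp_def heis_def using rev Z by simp
    also have "\<dots> = (\<Sum>\<omega>\<in>UNIV. \<Sum>\<nu>\<in>UNIV. complex_of_real (pi_vec D \<omega> * P_mat D \<omega> \<nu>) * mat_tr (X \<nu> * trev K (?Y \<omega>)))"
      using X trev_carrier[OF K] by (simp add: mat_tr_mean_P_mult sum_distrib_left mult_ac)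
    also have "\<dots> = (\<Sum>\<nu>\<in>UNIV. \<Sum>\<omega>\<in>UNIV. complex_of_real (pi_vec D \<omega> * P_mat D \<omega> \<nu>) * mat_tr (X \<nu> * trev K (?Y \<omega>)))"
      by (rule sum.swap)
    also have "\<dots> = (\<Sum>\<nu>\<in>UNIV. \<Sum>\<omega>\<in>UNIV. complex_of_real (pi_vec D \<nu> * P_mat D \<nu> \<omega>) * mat_tr (?Y \<omega> * trev K (X \<nu>)))"
      using X db mat_tr_trev_swap[OF K] by (intro sum.cong refl) simp
    also have "\<dots> = (\<Sum>\<nu>\<in>UNIV. complex_of_real (pi_vec D \<nu>) * mat_tr (B Z \<nu> * trev K (X \<nu>)))"
      unfolding B_def using X trev_carrier[OF K] by (simp add: mat_tr_mean_P_mult sum_distrib_left mult_ac)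
    also have "\<dots> = pp X (B Z)"
      unfolding pp_def B_def using X mat_tr_trev_swap[OF K] by (intro sum.cong refl) simp
    finally show ?thesis .
  qed
  have it: "pp (heis_iter \<alpha> N) Z = pp (\<lambda>_. 1\<^sub>m m) ((B ^^ N) Z)"
    if "\<And>\<omega>. Z \<omega> \<in> carrier_mat m m" for Z
    using that
  proof (induction N arbitrary: Z)
    case (Suc N)
    have "pp (heis_iter \<alpha> (Suc N)) Z = pp (heis_iter \<alpha> N) (B Z)" using step Suc.prems by simp
    also have "\<dots> = pp (\<lambda>_. 1\<^sub>m m) ((B ^^ N) (B Z))" by (rule Suc.IH) (simp add: B_def)
    finally show ?case by (simp add: funpow_swap1)
  qed simp
  \<comment> \<open>The factors alternate, so the opposite order only moves one
    \<open>mean_P\<close> from the inner end, where it fixes the identity, to the outer end.\<close>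
  have BN: "(B ^^ N) (\<lambda>_. 1\<^sub>m m) = mean_P (heis_iter (\<lambda>\<omega>. 1 - \<alpha> \<omega>) N)"
    by (induction N) (simp_all add: mean_P_one B_def heis_def[abs_def])
  have one: "mat_tr (1\<^sub>m m * trev K Y) = mat_tr Y" if "Y \<in> carrier_mat m m" for Y
    using mat_tr_trev_swap[OF K, of "1\<^sub>m m" Y] that by (simp add: trev_one[OF K] right_mult_one_mat[of _ m m])
  have "(\<Sum>\<omega>\<in>UNIV. complex_of_real (pi_vec D \<omega>) * mat_tr (heis_iter \<alpha> N \<omega>)) = pp (heis_iter \<alpha> N) (\<lambda>_. 1\<^sub>m m)"
    by (simp add: pp_def trev_one[OF K] right_mult_one_mat[of _ m m])
  also have "\<dots> = (\<Sum>\<omega>\<in>UNIV. complex_of_real (pi_vec D \<omega>) * mat_tr (mean_P (heis_iter (\<lambda>\<omega>. 1 - \<alpha> \<omega>) N) \<omega>))"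
    unfolding it[OF one_carrier_mat] BN by (simp add: pp_def one)
  also have "\<dots> = (\<Sum>\<omega>\<in>UNIV. \<Sum>\<nu>\<in>UNIV. complex_of_real (pi_vec D \<omega> * P_mat D \<omega> \<nu>) * mat_tr (heis_iter (\<lambda>\<omega>. 1 - \<alpha> \<omega>) N \<nu>))"
    using mat_tr_mean_P_mult[of "heis_iter (\<lambda>\<omega>. 1 - \<alpha> \<omega>) N" "1\<^sub>m m"]
    by (simp add: right_mult_one_mat[of _ m m] sum_distrib_left mult_ac)
  \<comment> \<open>The outer \<open>mean_P\<close> disappears because detailed balance makes \<pi>
    stationary.\<close>
  also have "\<dots> = (\<Sum>\<nu>\<in>UNIV. \<Sum>\<omega>\<in>UNIV. complex_of_real (pi_vec D \<nu> * P_mat D \<nu> \<omega>) * mat_tr (heis_iter (\<lambda>\<omega>. 1 - \<alpha> \<omega>) N \<nu>))"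
    by (subst sum.swap) (simp only: db)
  also have "\<dots> = (\<Sum>\<nu>\<in>UNIV. complex_of_real (pi_vec D \<nu>) * mat_tr (heis_iter (\<lambda>\<omega>. 1 - \<alpha> \<omega>) N \<nu>))"
  proof (intro sum.cong refl)
    fix \<nu>
    have "(\<Sum>\<omega>\<in>UNIV. complex_of_real (pi_vec D \<nu> * P_mat D \<nu> \<omega>)) = complex_of_real (pi_vec D \<nu>)"
      by (simp only: of_real_sum[symmetric] sum_distrib_left[symmetric] P_stochastic mult_1_right)
    thus "(\<Sum>\<omega>\<in>UNIV. complex_of_real (pi_vec D \<nu> * P_mat D \<nu> \<omega>) * mat_tr (heis_iter (\<lambda>\<omega>. 1 - \<alpha> \<omega>) N \<nu>)) =
        complex_of_real (pi_vec D \<nu>) * mat_tr (heis_iter (\<lambda>\<omega>. 1 - \<alpha> \<omega>) N \<nu>)"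
      by (metis sum_distrib_right)
  qed
  finally show ?thesis .
qed

end

section \<open>Existence of the growth rate\<close>

text \<open>The limit is the infimum of a k / k over k >= 1, finite by the linear lower bound.
  Dividing k with remainder by a nearly optimal p gives the upper estimate.\<close>

lemma fekete:
  fixes a :: "nat \<Rightarrow> real"
  assumes sub: "\<And>k l. a (k + l) \<le> a k + a l" and lb: "\<And>k. - c * real k \<le> a k"
  shows "convergent (\<lambda>k. a k / real k)"
proof -
  define L where "L = Inf ((\<lambda>k. a k / real k) ` {1..})"
  have lbd: "- c \<le> a k / real k" if "1 \<le> k" for k
    using lb[of k] that by (simp add: field_simps)
  have bdd: "bdd_below ((\<lambda>k. a k / real k) ` {1..})"
    using lbd by (intro bdd_belowI[of _ "- c"]) auto
  have L: "L \<le> a k / real k" if "1 \<le> k" for k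
    unfolding L_def using that bdd by (intro cInf_lower) auto
  have mult: "a (q * p + r) \<le> real q * a p + a r" for q p r
  proof (induction q)
    case (Suc q)
    have "a (Suc q * p + r) \<le> a p + a (q * p + r)" using sub[of p "q * p + r"] by (simp add: add.assoc)
    thus ?case using Suc by (simp add: algebra_simps)
  qed simp
  have "(\<lambda>k. a k / real k) \<longlonglongrightarrow> L"
  proof (rule LIMSEQ_I)
    fix e :: real assume e: "0 < e"
    obtain p where p: "1 \<le> p" "a p / real p < L + e / 2"
      using cInf_lessD[of "(\<lambda>k. a k / real k) ` {1..}" "L + e / 2"] e by (auto simp: L_def)
    \<comment> \<open>\<open>M\<close> absorbs two errors: the value of \<open>a\<close> at the
      remainder r = k mod p, and the difference between (k - r) a p / p and k a p / p.\<close>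
    define M where "M = (\<Sum>r<p. \<bar>a r\<bar>) + \<bar>a p\<bar>"
    have up: "a k \<le> real k * (a p / real p) + M" for k
    proof -
      let ?q = "k div p" and ?r = "k mod p"
      have r: "?r < p" using p by simp
      have k: "real k = real ?q * real p + real ?r"
        by (metis div_mult_mod_eq of_nat_add of_nat_mult)
      have "a k \<le> real ?q * a p + a ?r" using mult[of ?q p ?r] by simp
      also have "real ?q * a p = real k * (a p / real p) - real ?r * (a p / real p)"
        using p by (simp add: k field_simps)
      also have "- (real ?r * (a p / real p)) \<le> \<bar>a p\<bar>"
      proof -
        have "\<bar>real ?r * (a p / real p)\<bar> = (real ?r / real p) * \<bar>a p\<bar>" by (simp add: abs_mult)
        also have "\<dots> \<le> 1 * \<bar>a p\<bar>" using r p by (intro mult_right_mono) auto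
        finally show ?thesis by linarith
      qed
      moreover have "a ?r \<le> (\<Sum>r<p. \<bar>a r\<bar>)"
        by (rule order.trans[OF abs_ge_self], rule member_le_sum) (use r in auto)
      ultimately show ?thesis unfolding M_def by linarith
    qed
    obtain k0 :: nat where k0: "2 * M / e < real k0" using reals_Archimedean2 by blast
    show "\<exists>k1. \<forall>k\<ge>k1. norm (a k / real k - L) < e"
    proof (intro exI allI impI)
      fix k assume k: "Suc k0 \<le> k"
      have "e * real k0 \<le> e * real k" using k e by (intro mult_left_mono) auto
      moreover have "2 * M < e * real k0" using k0 e by (simp add: pos_divide_less_eq mult.commute)
      ultimately have "M < e / 2 * real k" by linarith
      hence "M / real k < e / 2" using k by (simp add: pos_divide_less_eq)
      moreover have "a k / real k \<le> a p / real p + M / real k"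
        using divide_right_mono[OF up[of k], of "real k"] k by (simp add: add_divide_distrib)
      ultimately have "a k / real k < L + e" using p(2) by linarith
      moreover have "L \<le> a k / real k" using L k by simp
      ultimately show "norm (a k / real k - L) < e" by simp
    qed
  qed
  thus ?thesis by (rule convergentI)
qed

text \<open>Multiplicative constants contribute ln C / k, which vanishes in the limit; positivity of
  \<open>b\<close> comes from the second bound.\<close>

lemma ln_rate_comparison:
  fixes b f :: "nat \<Rightarrow> real"
  assumes f: "\<And>k. 0 < f k" and c: "0 < C" "0 < C'"
    and le: "\<And>k. b k \<le> C * f k" "\<And>k. f k \<le> C' * b k"
    and lim: "(\<lambda>k. ln (f k) / real k) \<longlonglongrightarrow> L"
  shows "(\<lambda>k. ln (b k) / real k) \<longlonglongrightarrow> L"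
proof (rule tendsto_sandwich)
  have b: "0 < b k" for k
    using f[of k] le(2)[of k] c(2) by (metis less_le_trans zero_less_mult_pos)
  have "ln (b k) \<le> ln C + ln (f k)" for k
    using le(1)[of k] b[of k] f[of k] c by (simp flip: ln_mult_pos)
  thus "\<forall>\<^sub>F k in sequentially. ln (b k) / real k \<le> ln C / real k + ln (f k) / real k"
    by (intro always_eventually allI) (simp add: add_divide_distrib[symmetric] divide_right_mono)
  have "ln (f k) \<le> ln C' + ln (b k)" for k
    using le(2)[of k] b[of k] f[of k] c by (simp flip: ln_mult_pos)
  thus "\<forall>\<^sub>F k in sequentially. ln (f k) / real k - ln C' / real k \<le> ln (b k) / real k"
    by (intro always_eventually allI) (simp add: diff_divide_distrib[symmetric] divide_right_mono diff_le_eq add.commute)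
  have z: "(\<lambda>k. x / real k) \<longlonglongrightarrow> 0" for x :: real
    by (rule lim_const_over_n)
  show "(\<lambda>k. ln C / real k + ln (f k) / real k) \<longlonglongrightarrow> L"
    using tendsto_add[OF z lim] by simp
  show "(\<lambda>k. ln (f k) / real k - ln C' / real k) \<longlonglongrightarrow> L"
    using tendsto_diff[OF lim z] by simp
qed

lemma mat_tr_mult_le:
  assumes "A \<in> carrier_mat n n" "pos_semidef A" "B \<in> carrier_mat n n" "pos_semidef B"
  shows "Re (mat_tr (A * B)) \<le> Re (mat_tr A) * Re (mat_tr B)"
proof -
  let ?t = "complex_of_real (Re (mat_tr A))"
  have c: "?t \<cdot>\<^sub>m 1\<^sub>m n \<in> carrier_mat n n" by simp
  have "0 \<le> mat_tr ((?t \<cdot>\<^sub>m 1\<^sub>m n - A) * B)"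
    using assms by (intro mat_tr_mult_nonneg[of _ n] pos_semidef_le_trace) auto
  also have "(?t \<cdot>\<^sub>m 1\<^sub>m n - A) * B = ?t \<cdot>\<^sub>m B - A * B"
    using assms by (simp add: minus_mult_distrib_mat[OF c assms(1,3)] mult_smult_assoc_mat[of _ n n _ n] left_mult_one_mat[of _ n n])
  also have "mat_tr \<dots> = ?t * mat_tr B - mat_tr (A * B)"
    using assms by (subst mat_tr_minus[of _ n]) (auto intro!: mult_carrier_mat[of _ n n])
  finally show ?thesis by (simp add: less_eq_complex_def)
qed

context thermal_ris
begin

section \<open>Order estimates for the Heisenberg iterates\<close>

definition pcone :: "('w \<Rightarrow> complex mat) \<Rightarrow> bool" where
  "pcone R \<longleftrightarrow> (\<forall>\<omega>. R \<omega> \<in> carrier_mat m m \<and> pos_semidef (R \<omega>))"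

definition tr_pair :: "('w \<Rightarrow> complex mat) \<Rightarrow> ('w \<Rightarrow> complex mat) \<Rightarrow> real" where
  "tr_pair X R = (\<Sum>\<omega>\<in>UNIV. Re (mat_tr (X \<omega> * R \<omega>)))"

text \<open>The operator inequality X <= c Y at every probe, stated through test matrices so that
  duality carries it along \<open>heis\<close>.\<close>

definition dominated :: "real \<Rightarrow> ('w \<Rightarrow> complex mat) \<Rightarrow> ('w \<Rightarrow> complex mat) \<Rightarrow> bool" where
  "dominated c X Y \<longleftrightarrow> (\<forall>\<omega>. X \<omega> \<in> carrier_mat m m \<and> Y \<omega> \<in> carrier_mat m m \<and>
     (\<forall>B \<in> carrier_mat m m. pos_semidef B \<longrightarrow> Re (mat_tr (X \<omega> * B)) \<le> c * Re (mat_tr (Y \<omega> * B))))"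

abbreviation "one_S \<equiv> (\<lambda>_. 1\<^sub>m m)"

lemma pcone_one: "pcone one_S"
  by (simp add: pcone_def pos_semidef_one)

lemma tr_pair_nonneg: "pcone X \<Longrightarrow> pcone R \<Longrightarrow> 0 \<le> tr_pair X R"
  unfolding tr_pair_def pcone_def
  by (intro sum_nonneg) (metis mat_tr_mult_nonneg less_eq_complex_def zero_complex.simps(1))

lemma tr_pair_mono:
  assumes "dominated c X Y" "pcone R"
  shows "tr_pair X R \<le> c * tr_pair Y R"
  using assms unfolding tr_pair_def dominated_def pcone_def sum_distrib_left
  by (intro sum_mono) auto

lemma pcone_heis:
  assumes "pcone X"
  shows "pcone (heis \<alpha> X)"
  unfolding pcone_def
proof (intro allI conjI)
  fix \<omega>
  have X: "\<And>\<nu>. X \<nu> \<in> carrier_mat m m" "\<And>\<nu>. pos_semidef (X \<nu>)" using assms by (auto simp: pcone_def)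
  show "pos_semidef (heis \<alpha> X \<omega>)"
  proof (subst pos_semidef_trace_iff[of _ m], simp, intro ballI impI)
    fix B :: "complex mat" assume B: "B \<in> carrier_mat m m" "pos_semidef B"
    have "0 \<le> complex_of_real (P_mat D \<omega> \<nu>) * mat_tr (X \<nu> * tilted_L (\<alpha> \<omega>) \<omega> B)" for \<nu>
      using X B P_nonneg by (intro mult_nonneg_nonneg mat_tr_mult_nonneg[of _ m] tilted_L_pos_semidef)
        (auto simp: less_eq_complex_def)
    thus "0 \<le> mat_tr (heis \<alpha> X \<omega> * B)"
      unfolding mat_tr_heis_mult[OF X(1) B(1)] by (intro sum_nonneg) auto
  qed
qed simp

lemma Re_mat_tr_heis_mult:
  assumes "\<And>\<nu>. X \<nu> \<in> carrier_mat m m" "B \<in> carrier_mat m m"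
  shows "Re (mat_tr (heis \<alpha> X \<omega> * B)) =
    (\<Sum>\<nu>\<in>UNIV. P_mat D \<omega> \<nu> * Re (mat_tr (X \<nu> * tilted_L (\<alpha> \<omega>) \<omega> B)))"
  by (simp add: mat_tr_heis_mult[OF assms])

text \<open>By duality the test matrix \<open>B\<close> is replaced by its image under
  \<open>tilted_L\<close>, which is again positive, and the transition probabilities are
  nonnegative.\<close>

lemma dominated_heis:
  assumes "dominated c X Y"
  shows "dominated c (heis \<alpha> X) (heis \<alpha> Y)"
  unfolding dominated_def
proof (intro allI conjI ballI impI)
  fix \<omega> and B :: "complex mat" assume B: "B \<in> carrier_mat m m" "pos_semidef B"
  have c: "X \<nu> \<in> carrier_mat m m" "Y \<nu> \<in> carrier_mat m m" for \<nu> using assms by (auto simp: dominated_def)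
  have "P_mat D \<omega> \<nu> * Re (mat_tr (X \<nu> * tilted_L (\<alpha> \<omega>) \<omega> B)) \<le>
      P_mat D \<omega> \<nu> * (c * Re (mat_tr (Y \<nu> * tilted_L (\<alpha> \<omega>) \<omega> B)))" for \<nu>
    using assms B tilted_L_pos_semidef by (intro mult_left_mono P_nonneg) (auto simp: dominated_def)
  thus "Re (mat_tr (heis \<alpha> X \<omega> * B)) \<le> c * Re (mat_tr (heis \<alpha> Y \<omega> * B))"
    unfolding Re_mat_tr_heis_mult[OF c(1) B(1)] Re_mat_tr_heis_mult[OF c(2) B(1)] sum_distrib_left
    by (intro sum_mono) (simp add: mult.left_commute)
qed simp_all

lemma pcone_heis_iter: "pcone (heis_iter \<alpha> N)"
  by (induction N) (simp_all add: pcone_one pcone_heis)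

definition mass :: "('w \<Rightarrow> real) \<Rightarrow> nat \<Rightarrow> real" where
  "mass \<alpha> N = tr_pair (heis_iter \<alpha> N) one_S"

lemma mass_eq: "mass \<alpha> N = (\<Sum>\<omega>\<in>UNIV. Re (mat_tr (heis_iter \<alpha> N \<omega>)))"
  by (simp add: mass_def tr_pair_def right_mult_one_mat[of _ m m])

lemma mass_nonneg: "0 \<le> mass \<alpha> N"
  unfolding mass_def by (intro tr_pair_nonneg pcone_heis_iter pcone_one)

lemma heis_iter_dominated_one: "dominated (mass \<alpha> N) (heis_iter \<alpha> N) one_S"
  unfolding dominated_def
proof (intro allI conjI ballI impI)
  fix \<omega> and B :: "complex mat" assume B: "B \<in> carrier_mat m m" "pos_semidef B"
  have X: "heis_iter \<alpha> N \<nu> \<in> carrier_mat m m" "pos_semidef (heis_iter \<alpha> N \<nu>)" for \<nu>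
    using pcone_heis_iter by (auto simp: pcone_def)
  have nn: "0 \<le> Re (mat_tr (heis_iter \<alpha> N \<nu>))" for \<nu>
    using mat_tr_nonneg[OF X] by (simp add: less_eq_complex_def)
  have "Re (mat_tr (heis_iter \<alpha> N \<omega> * B)) \<le> Re (mat_tr (heis_iter \<alpha> N \<omega>)) * Re (mat_tr B)"
    by (rule mat_tr_mult_le[OF X B])
  also have "\<dots> \<le> mass \<alpha> N * Re (mat_tr B)"
    unfolding mass_eq using nn mat_tr_nonneg[OF B]
    by (intro mult_right_mono member_le_sum) (auto simp: less_eq_complex_def)
  finally show "Re (mat_tr (heis_iter \<alpha> N \<omega> * B)) \<le> mass \<alpha> N * Re (mat_tr (1\<^sub>m m * B))"
    using B by (simp add: left_mult_one_mat[of _ m m])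
qed simp_all

text \<open>Monotonicity of \<open>heis\<close>, applied \<open>M\<close> times to the bound of the
  \<open>N\<close>-th iterate by a multiple of the identity. Pairing with the identity then gives
  submultiplicativity of \<open>mass\<close>.\<close>

lemma heis_iter_dominated: "dominated (mass \<alpha> N) (heis_iter \<alpha> (M + N)) (heis_iter \<alpha> M)"
proof (induction M)
  case (Suc M)
  thus ?case using dominated_heis by simp
qed (simp add: heis_iter_dominated_one)

lemma mass_submult: "mass \<alpha> (M + N) \<le> mass \<alpha> M * mass \<alpha> N"
  using tr_pair_mono[OF heis_iter_dominated pcone_one, of \<alpha> M N] by (simp add: mass_def mult.commute add.commute)

lemma tr_pair_heis_iter_le: "pcone R \<Longrightarrow> tr_pair (heis_iter \<alpha> N) R \<le> mass \<alpha> N * tr_pair one_S R"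
  by (rule tr_pair_mono[OF heis_iter_dominated_one])

text \<open>The cost of an extra step does not depend on \<open>N\<close>. This uniform geometric
  growth lets the exponential series in \<open>mass_le_tr_pair\<close> sum to a constant.\<close>

lemma tr_pair_heis_iter_add_le: "pcone R \<Longrightarrow> tr_pair (heis_iter \<alpha> (N + k)) R \<le> mass \<alpha> 1 ^ k * tr_pair (heis_iter \<alpha> N) R"
proof (induction k)
  case (Suc k)
  have "tr_pair (heis_iter \<alpha> (N + k + 1)) R \<le> mass \<alpha> 1 * tr_pair (heis_iter \<alpha> (N + k)) R"
    by (rule tr_pair_mono[OF heis_iter_dominated Suc.prems])
  also have "\<dots> \<le> mass \<alpha> 1 * (mass \<alpha> 1 ^ k * tr_pair (heis_iter \<alpha> N) R)"
    using Suc by (intro mult_left_mono mass_nonneg)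
  finally show ?case by (simp add: mult.assoc)
qed simp

section \<open>Comparison of the untilted evolution of states with the tilted iterates\<close>

lemma L_map_pos_semidef:
  assumes "\<rho> \<in> carrier_mat m m" "pos_semidef \<rho>"
  shows "pos_semidef (L_map D \<omega> \<rho>)"
proof (subst pos_semidef_trace_iff[of _ m], simp, intro ballI impI)
  fix B :: "complex mat" assume B: "B \<in> carrier_mat m m" "pos_semidef B"
  have "mat_tr (L_map D \<omega> \<rho> * B) = mat_tr (B * L_map D \<omega> \<rho>)"
    using B by (intro mat_tr_mult_comm) auto
  also have "0 \<le> \<dots>"
    unfolding mat_tr_mult_L_map[OF B(1) assms(1)] using B assms
    by (intro sum_nonneg mat_tr_mult_nonneg[of _ m] L_xi_pos_semidef) auto
  finally show "0 \<le> mat_tr (L_map D \<omega> \<rho> * B)" .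
qed

lemma pcone_ext_L: "pcone R \<Longrightarrow> pcone (ext_L D R)"
  unfolding pcone_def ext_L_def
  by (auto intro!: pos_semidef_mat_sum pos_semidef_smult[of _ m] L_map_pos_semidef P_nonneg)

lemma tr_pair_ext_L:
  assumes X: "\<And>\<nu>. X \<nu> \<in> carrier_mat m m" and R: "\<And>\<nu>. R \<nu> \<in> carrier_mat m m"
  shows "tr_pair X (ext_L D R) = tr_pair (heis (\<lambda>_. 0) X) R"
proof -
  have "mat_tr (X \<omega> * ext_L D R \<omega>) = (\<Sum>\<nu>\<in>UNIV. complex_of_real (P_mat D \<nu> \<omega>) * mat_tr (X \<omega> * L_map D \<nu> (R \<nu>)))" for \<omega>
    unfolding ext_L_def using X R
    by (subst mat_tr_mult_mat_sum)
      (auto simp: mult_smult_distrib[of _ m m _ m] mat_tr_smult[OF mult_carrier_mat[of _ m m _ m]])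
  hence "tr_pair X (ext_L D R) = (\<Sum>\<omega>\<in>UNIV. \<Sum>\<nu>\<in>UNIV. P_mat D \<nu> \<omega> * Re (mat_tr (X \<omega> * L_map D \<nu> (R \<nu>))))"
    by (simp add: tr_pair_def)
  also have "\<dots> = (\<Sum>\<nu>\<in>UNIV. \<Sum>\<omega>\<in>UNIV. P_mat D \<nu> \<omega> * Re (mat_tr (X \<omega> * L_map D \<nu> (R \<nu>))))"
    by (rule sum.swap)
  also have "\<dots> = tr_pair (heis (\<lambda>_. 0) X) R"
    by (simp add: tr_pair_def Re_mat_tr_heis_mult[OF X R] mat_tr_mult_tilted_L_0[OF X R])
  finally show ?thesis .
qed

lemma weight_lower_bound:
  obtains C where "0 < C" "\<And>\<omega> \<xi>. \<xi> \<in> Xi D \<omega> \<Longrightarrow> 1 \<le> C * weight (\<alpha> \<omega>) \<xi>"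
proof
  \<comment> \<open>The sum of the reciprocals of the finitely many weights bounds each of them; the
    added 1 makes \<open>?C\<close> visibly positive.\<close>
  let ?C = "1 + (\<Sum>x\<in>outcomes D. 1 / weight (\<alpha> (fst x)) (snd x))"
  have fin: "finite (outcomes D)" by (simp add: outcomes_def)
  have nn: "0 \<le> 1 / weight (\<alpha> (fst x)) (snd x)" for x :: "'w outcome"
    by (simp add: less_imp_le[OF weight_pos])
  show "0 < ?C" using sum_nonneg[of "outcomes D", OF nn] by (simp add: add_pos_nonneg)
  fix \<omega> \<xi> assume "\<xi> \<in> Xi D \<omega>"
  hence "(\<omega>, \<xi>) \<in> outcomes D" by (simp add: outcomes_def)
  hence "1 / weight (\<alpha> \<omega>) \<xi> \<le> ?C"
    using member_le_sum[of "(\<omega>, \<xi>)" "outcomes D" "\<lambda>x. 1 / weight (\<alpha> (fst x)) (snd x)"] nn fin by simp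
  thus "1 \<le> ?C * weight (\<alpha> \<omega>) \<xi>" using weight_pos[of "\<alpha> \<omega>" \<xi>] by (simp add: pos_divide_le_eq)
qed

text \<open>Each outcome contributes a nonnegative term, so inserting the factors
  \<open>C * weight\<close>, all at least 1, can only increase the sum.\<close>

lemma tr_pair_heis_0_le:
  assumes C: "0 < C" "\<And>\<omega> \<xi>. \<xi> \<in> Xi D \<omega> \<Longrightarrow> 1 \<le> C * weight (\<alpha> \<omega>) \<xi>"
    and X: "pcone X" and R: "pcone R"
  shows "tr_pair (heis (\<lambda>_. 0) X) R \<le> C * tr_pair (heis \<alpha> X) R"
proof -
  have Xc: "X \<nu> \<in> carrier_mat m m" "pos_semidef (X \<nu>)" and Rc: "R \<nu> \<in> carrier_mat m m" "pos_semidef (R \<nu>)" for \<nu>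
    using X R by (auto simp: pcone_def)
  have le: "Re (mat_tr (X \<nu> * tilted_L 0 \<omega> (R \<omega>))) \<le> C * Re (mat_tr (X \<nu> * tilted_L (\<alpha> \<omega>) \<omega> (R \<omega>)))" for \<nu> \<omega>
  proof -
    have "Re (mat_tr (X \<nu> * tilted_L 0 \<omega> (R \<omega>))) = (\<Sum>\<xi>\<in>Xi D \<omega>. 1 * Re (mat_tr (X \<nu> * L_xi D \<omega> \<xi> (R \<omega>))))"
      by (simp add: mat_tr_mult_tilted_L[OF Xc(1)] weight_def)
    also have "\<dots> \<le> (\<Sum>\<xi>\<in>Xi D \<omega>. (C * weight (\<alpha> \<omega>) \<xi>) * Re (mat_tr (X \<nu> * L_xi D \<omega> \<xi> (R \<omega>))))"
    proof (intro sum_mono mult_right_mono C(2))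
      fix \<xi>
      have "0 \<le> mat_tr (X \<nu> * L_xi D \<omega> \<xi> (R \<omega>))"
        by (intro mat_tr_mult_nonneg[of _ m] Xc L_xi_carrier L_xi_pos_semidef Rc)
      thus "0 \<le> Re (mat_tr (X \<nu> * L_xi D \<omega> \<xi> (R \<omega>)))" by (simp add: less_eq_complex_def)
    qed
    also have "\<dots> = C * Re (mat_tr (X \<nu> * tilted_L (\<alpha> \<omega>) \<omega> (R \<omega>)))"
      by (simp add: mat_tr_mult_tilted_L[OF Xc(1)] sum_distrib_left mult.assoc)
    finally show ?thesis .
  qed
  have "P_mat D \<omega> \<nu> * Re (mat_tr (X \<nu> * tilted_L 0 \<omega> (R \<omega>))) \<le>
      C * (P_mat D \<omega> \<nu> * Re (mat_tr (X \<nu> * tilted_L (\<alpha> \<omega>) \<omega> (R \<omega>))))" for \<nu> \<omega>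
    using mult_left_mono[OF le P_nonneg] by (simp add: mult.left_commute)
  thus ?thesis
    unfolding tr_pair_def Re_mat_tr_heis_mult[OF Xc(1) Rc(1)] sum_distrib_left by (intro sum_mono)
qed

lemma pcone_ext_L_pow: "pcone R \<Longrightarrow> pcone ((ext_L D ^^ k) R)"
  by (induction k) (simp_all add: pcone_ext_L)

text \<open>The k untilted steps are moved one by one to the other side of the pairing and tilted
  there, at the cost of a factor \<open>C\<close> each. Every move raises the index of the iterate
  by one, hence the induction with \<open>N\<close> arbitrary.\<close>

lemma tr_pair_ext_L_pow_le:
  assumes C: "0 < C" "\<And>\<omega> \<xi>. \<xi> \<in> Xi D \<omega> \<Longrightarrow> 1 \<le> C * weight (\<alpha> \<omega>) \<xi>" and R: "pcone R"
  shows "tr_pair (heis_iter \<alpha> N) ((ext_L D ^^ k) R) \<le> C ^ k * tr_pair (heis_iter \<alpha> (N + k)) R"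
proof (induction k arbitrary: N)
  case (Suc k)
  let ?S = "(ext_L D ^^ k) R"
  have S: "pcone ?S" by (rule pcone_ext_L_pow[OF R])
  have "tr_pair (heis_iter \<alpha> N) ((ext_L D ^^ Suc k) R) = tr_pair (heis (\<lambda>_. 0) (heis_iter \<alpha> N)) ?S"
    using S by (simp add: tr_pair_ext_L pcone_def)
  also have "\<dots> \<le> C * tr_pair (heis_iter \<alpha> (Suc N)) ?S"
    using tr_pair_heis_0_le[OF C pcone_heis_iter[of \<alpha> N] S] by simp
  also have "\<dots> \<le> C * (C ^ k * tr_pair (heis_iter \<alpha> (Suc N + k)) R)"
    using C(1) Suc.IH[of "Suc N"] by (intro mult_left_mono) auto
  finally show ?case by (simp add: mult.assoc)
qed simp

lemma tr_pair_ext_L_pow: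
  assumes R: "pcone R"
  shows "tr_pair (heis_iter (\<lambda>_. 0) N) ((ext_L D ^^ k) R) = tr_pair (heis_iter (\<lambda>_. 0) (N + k)) R"
proof (induction k arbitrary: N)
  case (Suc k)
  have "pcone ((ext_L D ^^ k) R)" by (rule pcone_ext_L_pow[OF R])
  hence "tr_pair (heis_iter (\<lambda>_. 0) N) ((ext_L D ^^ Suc k) R) = tr_pair (heis_iter (\<lambda>_. 0) (Suc N)) ((ext_L D ^^ k) R)"
    by (simp add: tr_pair_ext_L pcone_def)
  thus ?case using Suc.IH[of "Suc N"] by simp
qed simp

text \<open>\<open>exp_map\<close> is an entrywise \<open>suminf\<close>, so summability has to be
  known before the pairing can be taken inside. Entries are bounded by the total trace, that is, by
  the pairing with the zeroth iterate, whose growth in k is at most geometric.\<close>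

lemma tr_pair_exp_map_sums:
  assumes t: "0 < t" and R: "pcone R" and X: "\<And>\<omega>. X \<omega> \<in> carrier_mat m m"
  shows "(\<lambda>k. t ^ k / fact k * tr_pair X ((ext_L D ^^ k) R)) sums tr_pair X (exp_map D t (ext_L D) R)"
proof -
  let ?R = "\<lambda>k. (ext_L D ^^ k) R"
  let ?b = "\<lambda>k. t ^ k / fact k * (mass (\<lambda>_. 0) 1 ^ k * tr_pair one_S R)"
  have Rk: "?R k \<omega> \<in> carrier_mat m m" "pos_semidef (?R k \<omega>)" for k \<omega>
    using pcone_ext_L_pow[OF R] by (auto simp: pcone_def)
  have bound: "cmod (?R k \<omega> $$ (i, j)) \<le> mass (\<lambda>_. 0) 1 ^ k * tr_pair one_S R" if "i < m" "j < m" for k \<omega> i j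
  proof -
    have "cmod (?R k \<omega> $$ (i, j)) \<le> Re (mat_tr (?R k \<omega>))"
      by (rule pos_semidef_entry_le_trace[OF Rk that])
    also have "\<dots> \<le> (\<Sum>\<omega>\<in>UNIV. Re (mat_tr (?R k \<omega>)))"
      using mat_tr_nonneg[OF Rk] by (intro member_le_sum) (auto simp: less_eq_complex_def)
    also have "\<dots> = tr_pair (heis_iter (\<lambda>_. 0) 0) (?R k)"
      using Rk by (simp add: tr_pair_def left_mult_one_mat[of _ m m])
    also have "\<dots> = tr_pair (heis_iter (\<lambda>_. 0) (0 + k)) R" by (rule tr_pair_ext_L_pow[OF R])
    also have "\<dots> \<le> mass (\<lambda>_. 0) 1 ^ k * tr_pair (heis_iter (\<lambda>_. 0) 0) R"
      by (rule tr_pair_heis_iter_add_le[OF R])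
    finally show ?thesis by simp
  qed
  have "summable ?b"
    using summable_mult2[OF summable_exp[of "t * mass (\<lambda>_. 0) 1"], of "tr_pair one_S R"]
    by (simp add: power_mult_distrib divide_inverse mult_ac)
  hence entry: "(\<lambda>k. complex_of_real (t ^ k / fact k) * ?R k \<omega> $$ (i, j)) sums (exp_map D t (ext_L D) R \<omega> $$ (i, j))"
    if ij: "i < m" "j < m" for \<omega> i j
  proof -
    have "summable (\<lambda>k. complex_of_real (t ^ k / fact k) * ?R k \<omega> $$ (i, j))"
    proof (rule summable_comparison_test'[OF \<open>summable ?b\<close>])
      fix k
      show "norm (complex_of_real (t ^ k / fact k) * ?R k \<omega> $$ (i, j)) \<le> ?b k"
        unfolding norm_mult using t bound[OF ij]
        by (intro mult_mono) (auto simp: norm_divide norm_power)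
    qed
    thus ?thesis using ij by (simp add: exp_map_def summable_sums)
  qed
  have "(\<lambda>k. \<Sum>\<omega>\<in>UNIV. Re (\<Sum>i<m. \<Sum>j<m. X \<omega> $$ (i, j) * (complex_of_real (t ^ k / fact k) * ?R k \<omega> $$ (j, i))))
     sums (\<Sum>\<omega>\<in>UNIV. Re (\<Sum>i<m. \<Sum>j<m. X \<omega> $$ (i, j) * exp_map D t (ext_L D) R \<omega> $$ (j, i)))"
    by (intro sums_sum sums_Re sums_mult entry) auto
  moreover have "(\<Sum>\<omega>\<in>UNIV. Re (\<Sum>i<m. \<Sum>j<m. X \<omega> $$ (i, j) * exp_map D t (ext_L D) R \<omega> $$ (j, i))) =
      tr_pair X (exp_map D t (ext_L D) R)"
    using X by (simp add: tr_pair_def mat_tr_mult[of _ m m] exp_map_def)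
  moreover have "(\<Sum>\<omega>\<in>UNIV. Re (\<Sum>i<m. \<Sum>j<m. X \<omega> $$ (i, j) * (complex_of_real (t ^ k / fact k) * ?R k \<omega> $$ (j, i)))) =
      t ^ k / fact k * tr_pair X (?R k)" for k
  proof -
    have "(\<Sum>i<m. \<Sum>j<m. X \<omega> $$ (i, j) * (complex_of_real (t ^ k / fact k) * ?R k \<omega> $$ (j, i))) =
       complex_of_real (t ^ k / fact k) * mat_tr (X \<omega> * ?R k \<omega>)" for \<omega>
      using X Rk(1) by (simp only: mat_tr_mult[of _ m m] sum_distrib_left mult.left_commute)
    thus ?thesis by (simp add: tr_pair_def sum_distrib_left del: of_real_divide of_real_power)
  qed
  ultimately show ?thesis by simp
qed

lemma mass_le_tr_pair:
  assumes irr: "irreducible_map D (ext_L D)" and R: "pcone R" and R0: "R \<omega>\<^sub>0 \<noteq> 0\<^sub>m m m"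
  obtains K where "0 < K" "\<And>N. mass \<alpha> N \<le> K * tr_pair (heis_iter \<alpha> N) R"
proof -
  obtain C where C: "0 < C" "\<And>\<omega> \<xi>. \<xi> \<in> Xi D \<omega> \<Longrightarrow> 1 \<le> C * weight (\<alpha> \<omega>) \<xi>"
    using weight_lower_bound[of \<alpha>] by blast
  obtain t where t: "0 < t" and pd: "\<And>\<omega>. pos_def (exp_map D t (ext_L D) R \<omega>)"
    using irr R R0 unfolding irreducible_map_def ext_obs_def pcone_def by blast
  let ?E = "exp_map D t (ext_L D) R"
  have E: "?E \<omega> \<in> carrier_mat m m" for \<omega> by (simp add: exp_map_def)
  have "\<exists>c>0. pos_semidef (?E \<omega> - complex_of_real c \<cdot>\<^sub>m 1\<^sub>m m)" for \<omega>
    using pos_def_bounded_below[OF E pd] by blast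
  then obtain c where c: "\<And>\<omega>. 0 < c \<omega>" "\<And>\<omega>. pos_semidef (?E \<omega> - complex_of_real (c \<omega>) \<cdot>\<^sub>m 1\<^sub>m m)"
    by metis
  define c0 where "c0 = Min (range c)"
  have c0: "0 < c0" "\<And>\<omega>. c0 \<le> c \<omega>" using c(1) by (auto simp: c0_def)
  \<comment> \<open>The time t, times the loss \<open>C\<close> per step for tilting, times the
    growth \<open>mass \<alpha> 1\<close> per step; nothing in it depends on
    \<open>N\<close>.\<close>
  let ?g = "t * C * mass \<alpha> 1"
  have "mass \<alpha> N \<le> exp ?g / c0 * tr_pair (heis_iter \<alpha> N) R" for N
  proof -
    let ?X = "heis_iter \<alpha> N"
    have X: "?X \<omega> \<in> carrier_mat m m" "pos_semidef (?X \<omega>)" for \<omega>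
      using pcone_heis_iter by (auto simp: pcone_def)
    have low: "c0 * Re (mat_tr (?X \<omega>)) \<le> Re (mat_tr (?X \<omega> * ?E \<omega>))" for \<omega>
    proof -
      let ?I = "complex_of_real (c \<omega>) \<cdot>\<^sub>m 1\<^sub>m m"
      have "0 \<le> mat_tr (?X \<omega> * (?E \<omega> - ?I))"
        using E by (intro mat_tr_mult_nonneg[of _ m] X c) auto
      also have "?X \<omega> * (?E \<omega> - ?I) = ?X \<omega> * ?E \<omega> - complex_of_real (c \<omega>) \<cdot>\<^sub>m ?X \<omega>"
        using X(1) E by (subst mult_minus_distrib_mat[of _ m m])
          (auto simp: mult_smult_distrib[of _ m m _ m] right_mult_one_mat[of _ m m])
      also have "mat_tr \<dots> = mat_tr (?X \<omega> * ?E \<omega>) - complex_of_real (c \<omega>) * mat_tr (?X \<omega>)"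
        using X(1)[of \<omega>] E[of \<omega>]
        by (subst mat_tr_minus[of _ m]) (auto simp: mat_tr_smult[OF X(1)] intro!: mult_carrier_mat[of _ m m])
      finally have "c \<omega> * Re (mat_tr (?X \<omega>)) \<le> Re (mat_tr (?X \<omega> * ?E \<omega>))"
        by (simp add: less_eq_complex_def)
      moreover have "c0 * Re (mat_tr (?X \<omega>)) \<le> c \<omega> * Re (mat_tr (?X \<omega>))"
        using mat_tr_nonneg[OF X] c0 by (intro mult_right_mono) (auto simp: less_eq_complex_def)
      ultimately show ?thesis by simp
    qed
    have s: "(\<lambda>k. t ^ k / fact k * tr_pair ?X ((ext_L D ^^ k) R)) sums tr_pair ?X ?E"
      by (rule tr_pair_exp_map_sums[OF t R X(1)])
    have "(\<lambda>k. ?g ^ k / fact k) sums exp ?g"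
      using exp_converges[of ?g] by (simp add: divide_inverse mult.commute)
    hence s': "(\<lambda>k. ?g ^ k / fact k * tr_pair ?X R) sums (exp ?g * tr_pair ?X R)"
      by (rule sums_mult2)
    have "t ^ k / fact k * tr_pair ?X ((ext_L D ^^ k) R) \<le> ?g ^ k / fact k * tr_pair ?X R" for k
    proof -
      have "tr_pair ?X ((ext_L D ^^ k) R) \<le> C ^ k * tr_pair (heis_iter \<alpha> (N + k)) R"
        by (rule tr_pair_ext_L_pow_le[OF C R])
      also have "\<dots> \<le> C ^ k * (mass \<alpha> 1 ^ k * tr_pair ?X R)"
        using C(1) tr_pair_heis_iter_add_le[OF R] by (intro mult_left_mono) auto
      finally have "t ^ k / fact k * tr_pair ?X ((ext_L D ^^ k) R) \<le>
          t ^ k / fact k * (C ^ k * (mass \<alpha> 1 ^ k * tr_pair ?X R))"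
        using t by (intro mult_left_mono) auto
      thus ?thesis by (simp add: power_mult_distrib)
    qed
    hence "tr_pair ?X ?E \<le> exp ?g * tr_pair ?X R" by (rule sums_le[OF _ s s'])
    moreover have "c0 * mass \<alpha> N \<le> tr_pair ?X ?E"
      unfolding mass_eq tr_pair_def sum_distrib_left by (rule sum_mono) (rule low)
    ultimately show ?thesis using c0(1) by (simp add: field_simps)
  qed
  moreover have "0 < exp ?g / c0" using c0 by simp
  ultimately show thesis by (rule that[rotated])
qed

lemma pi_state_pcone: "pcone (\<lambda>\<omega>. complex_of_real (pi_vec D \<omega>) \<cdot>\<^sub>m 1\<^sub>m m)"
  by (auto simp: pcone_def intro!: pos_semidef_smult[of _ m] pos_semidef_one pi_nonneg)

lemma tr_pair_pi_state:
  assumes "\<And>\<omega>. X \<omega> \<in> carrier_mat m m"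
  shows "tr_pair X (\<lambda>\<omega>. complex_of_real (pi_vec D \<omega>) \<cdot>\<^sub>m 1\<^sub>m m) =
    Re (\<Sum>\<omega>\<in>UNIV. complex_of_real (pi_vec D \<omega>) * mat_tr (X \<omega>))"
  using assms by (simp add: tr_pair_def mult_smult_distrib[of _ m m _ m] right_mult_one_mat[of _ m m] mat_tr_smult[OF assms])

text \<open>The hypothesis \<open>norm\<close>, conservation of the total trace at zero tilt, keeps
  \<open>mass\<close> above C^{-N}. This makes the logarithms meaningful and supplies the linear
  lower bound for \<open>fekete\<close>.\<close>

theorem growth_rate_symmetry:
  assumes irr: "irreducible_map D (ext_L D)" and TRI: "time_reversal_invariant D" and DB: "detailed_balance D"
    and R: "pcone R" and norm: "\<And>N. tr_pair (heis_iter (\<lambda>_. 0) N) R = 1"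
  obtains L where "(\<lambda>N. ln (tr_pair (heis_iter \<alpha> N) R) / real N) \<longlonglongrightarrow> L"
    "(\<lambda>N. ln (tr_pair (heis_iter (\<lambda>\<omega>. 1 - \<alpha> \<omega>) N) R) / real N) \<longlonglongrightarrow> L"
proof -
  define S where "S = (\<lambda>\<omega>. complex_of_real (pi_vec D \<omega>) \<cdot>\<^sub>m (1\<^sub>m m :: complex mat))"
  have S: "pcone S" unfolding S_def by (rule pi_state_pcone)
  obtain \<omega>\<^sub>1 where "pi_vec D \<omega>\<^sub>1 \<noteq> 0" using pi_sum by (metis sum.neutral zero_neq_one)
  hence "S \<omega>\<^sub>1 $$ (0, 0) \<noteq> 0\<^sub>m m m $$ (0, 0)" using dim_S_pos by (simp add: S_def)
  hence S1: "S \<omega>\<^sub>1 \<noteq> 0\<^sub>m m m" by metis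
  have one_R: "tr_pair one_S R = 1" using norm[of 0] by simp
  have "\<exists>\<omega>. R \<omega> \<noteq> 0\<^sub>m m m"
  proof (rule ccontr)
    assume "\<not> ?thesis"
    hence "tr_pair one_S R = 0" by (simp add: tr_pair_def mat_tr_def)
    thus False using one_R by simp
  qed
  then obtain \<omega>\<^sub>0 where R0: "R \<omega>\<^sub>0 \<noteq> 0\<^sub>m m m" ..
  have rates: "\<exists>L. (\<lambda>N. ln (tr_pair (heis_iter \<beta> N) R) / real N) \<longlonglongrightarrow> L \<and>
      (\<lambda>N. ln (tr_pair (heis_iter \<beta> N) S) / real N) \<longlonglongrightarrow> L" for \<beta>
  proof -
    obtain C where C: "0 < C" "\<And>\<omega> \<xi>. \<xi> \<in> Xi D \<omega> \<Longrightarrow> 1 \<le> C * weight (\<beta> \<omega>) \<xi>"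
      using weight_lower_bound[of \<beta>] by blast
    have low: "1 \<le> C ^ N * mass \<beta> N" for N
    proof -
      have "1 = tr_pair (heis_iter (\<lambda>_. 0) 0) ((ext_L D ^^ N) R)"
        unfolding tr_pair_ext_L_pow[OF R] norm ..
      also have "\<dots> = tr_pair (heis_iter \<beta> 0) ((ext_L D ^^ N) R)" by simp
      also have "\<dots> \<le> C ^ N * tr_pair (heis_iter \<beta> (0 + N)) R" by (rule tr_pair_ext_L_pow_le[OF C R])
      also have "\<dots> \<le> C ^ N * mass \<beta> N"
        using tr_pair_heis_iter_le[OF R, of \<beta> N] C(1) one_R by (intro mult_left_mono) auto
      finally show ?thesis .
    qed
    have mp: "0 < mass \<beta> N" for N
    proof -
      have "0 < C ^ N * mass \<beta> N" using low[of N] by linarith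
      thus ?thesis using C(1) by (simp add: zero_less_mult_iff)
    qed
    have "convergent (\<lambda>N. ln (mass \<beta> N) / real N)"
    proof (rule fekete[where c = "ln C"])
      fix M N
      have "ln (mass \<beta> (M + N)) \<le> ln (mass \<beta> M * mass \<beta> N)"
        using mp mass_submult by (simp add: mult_pos_pos)
      thus "ln (mass \<beta> (M + N)) \<le> ln (mass \<beta> M) + ln (mass \<beta> N)"
        using mp by (simp add: ln_mult_pos)
    next
      fix N
      have "0 \<le> ln (C ^ N * mass \<beta> N)" using low[of N] by simp
      also have "\<dots> = real N * ln C + ln (mass \<beta> N)"
        using mp[of N] C(1) by (simp add: ln_mult_pos ln_realpow)
      finally show "- ln C * real N \<le> ln (mass \<beta> N)" by (simp add: mult.commute)
    qed
    then obtain L where L: "(\<lambda>N. ln (mass \<beta> N) / real N) \<longlonglongrightarrow> L"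
      by (auto simp: convergent_def)
    have "(\<lambda>N. ln (tr_pair (heis_iter \<beta> N) T) / real N) \<longlonglongrightarrow> L"
      if T: "pcone T" "T \<omega> \<noteq> 0\<^sub>m m m" for T \<omega>
    proof -
      obtain K where K: "0 < K" "\<And>N. mass \<beta> N \<le> K * tr_pair (heis_iter \<beta> N) T"
        using mass_le_tr_pair[OF irr T] by blast
      have "0 \<le> tr_pair one_S T" by (intro tr_pair_nonneg pcone_one T)
      \<comment> \<open>The added 1 makes the constant strictly positive, as
        \<open>ln_rate_comparison\<close> requires.\<close>
      hence "tr_pair (heis_iter \<beta> N) T \<le> (tr_pair one_S T + 1) * mass \<beta> N" for N
        using tr_pair_heis_iter_le[OF T(1), of \<beta> N] mp[of N] by (simp add: algebra_simps)
      thus ?thesis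
        using \<open>0 \<le> tr_pair one_S T\<close> by (intro ln_rate_comparison[OF mp _ K(1) _ K(2) L]) auto
    qed
    thus ?thesis using R R0 S S1 by blast
  qed
  have "tr_pair (heis_iter \<alpha> N) S = tr_pair (heis_iter (\<lambda>\<omega>. 1 - \<alpha> \<omega>) N) S" for N
    unfolding S_def tr_pair_pi_state[OF heis_iter_carrier] heis_iter_reversal[OF TRI DB, of \<alpha> N] ..
  hence eq: "(\<lambda>N. ln (tr_pair (heis_iter \<alpha> N) S) / real N) = (\<lambda>N. ln (tr_pair (heis_iter (\<lambda>\<omega>. 1 - \<alpha> \<omega>) N) S) / real N)"
    by simp
  obtain L where L: "(\<lambda>N. ln (tr_pair (heis_iter \<alpha> N) R) / real N) \<longlonglongrightarrow> L"
      "(\<lambda>N. ln (tr_pair (heis_iter \<alpha> N) S) / real N) \<longlonglongrightarrow> L"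
    using rates[of \<alpha>] by blast
  obtain L' where L': "(\<lambda>N. ln (tr_pair (heis_iter (\<lambda>\<omega>. 1 - \<alpha> \<omega>) N) R) / real N) \<longlonglongrightarrow> L'"
      "(\<lambda>N. ln (tr_pair (heis_iter (\<lambda>\<omega>. 1 - \<alpha> \<omega>) N) S) / real N) \<longlonglongrightarrow> L'"
    using rates[of "\<lambda>\<omega>. 1 - \<alpha> \<omega>"] by blast
  have "L = L'" by (rule LIMSEQ_unique[OF L(2)[unfolded eq] L'(2)])
  thus thesis using that L(1) L'(1) by simp
qed

end

section \<open>Moment generating function of the entropy fluxes\<close>

lemma shd_stl_pow: "shd ((stl ^^ k) x) = x !! k"
  by (induction k arbitrary: x) (simp_all add: funpow_swap1)

text \<open>At each time exactly one probe interacts, so the sum over \<omega> keeps a single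
  term.\<close>

lemma birkhoff_sum_entropy_flux:
  fixes \<alpha> :: "'w::finite \<Rightarrow> real"
  assumes "length xs = N" "stake N x = xs"
  shows "(\<Sum>\<omega>\<in>UNIV. \<alpha> \<omega> * birkhoff_sum N (entropy_flux \<omega>) x) =
    (\<Sum>k<N. \<alpha> (fst (xs ! k)) * (snd (snd (xs ! k)) - fst (snd (xs ! k))))"
proof -
  have "(\<Sum>\<omega>\<in>UNIV. \<alpha> \<omega> * birkhoff_sum N (entropy_flux \<omega>) x) =
     (\<Sum>k<N. \<Sum>\<omega>\<in>UNIV. \<alpha> \<omega> * entropy_flux \<omega> ((stl ^^ k) x))"
    unfolding birkhoff_sum_def sum_distrib_left by (rule sum.swap)
  also have "\<dots> = (\<Sum>k<N. \<alpha> (fst (xs ! k)) * (snd (snd (xs ! k)) - fst (snd (xs ! k))))"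
  proof (rule sum.cong)
    fix k assume "k \<in> {..<N}"
    hence k: "x !! k = xs ! k" using assms by (metis lessThan_iff stake_nth)
    obtain \<omega>\<^sub>1 s s' where e: "xs ! k = (\<omega>\<^sub>1, s, s')" by (cases "xs ! k") auto
    have "(\<Sum>\<omega>\<in>UNIV. \<alpha> \<omega> * entropy_flux \<omega> ((stl ^^ k) x)) = (\<Sum>\<omega>\<in>UNIV. if \<omega> = \<omega>\<^sub>1 then \<alpha> \<omega> * (s' - s) else 0)"
      by (intro sum.cong) (auto simp: entropy_flux_def shd_stl_pow k e)
    thus "(\<Sum>\<omega>\<in>UNIV. \<alpha> \<omega> * entropy_flux \<omega> ((stl ^^ k) x)) = \<alpha> (fst (xs ! k)) * (snd (snd (xs ! k)) - fst (snd (xs ! k)))"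
      by (simp add: e)
  qed simp
  finally show ?thesis .
qed

context thermal_ris
begin

definition path_weight :: "('w \<Rightarrow> real) \<Rightarrow> 'w outcome list \<Rightarrow> real" where
  "path_weight \<alpha> xs = (\<Prod>k<length xs. weight (\<alpha> (fst (xs ! k))) (snd (xs ! k)))"

lemma path_weight_Nil [simp]: "path_weight \<alpha> [] = 1"
  and path_weight_Cons [simp]: "path_weight \<alpha> (x # xs) = weight (\<alpha> (fst x)) (snd x) * path_weight \<alpha> xs"
  by (simp_all add: path_weight_def prod.lessThan_Suc_shift del: prod.lessThan_Suc)

definition paths :: "nat \<Rightarrow> 'w outcome list set" where
  "paths N = {xs. set xs \<subseteq> outcomes D \<and> length xs = N}"

lemma finite_outcomes: "finite (outcomes D)"
  by (simp add: outcomes_def)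

lemma finite_paths: "finite (paths N)"
  unfolding paths_def by (rule finite_lists_length_eq[OF finite_outcomes])

lemma sum_paths_Suc: "(\<Sum>xs\<in>paths (Suc N). f xs) = (\<Sum>x\<in>outcomes D. \<Sum>ys\<in>paths N. f (x # ys))"
proof -
  have "paths (Suc N) = (\<lambda>(x, ys). x # ys) ` (outcomes D \<times> paths N)"
    by (auto simp: paths_def length_Suc_conv image_iff)
  moreover have "inj_on (\<lambda>(x, ys). x # ys) (outcomes D \<times> paths N)"
    by (auto simp: inj_on_def)
  ultimately have "(\<Sum>xs\<in>paths (Suc N). f xs) = (\<Sum>(x, ys)\<in>outcomes D \<times> paths N. f (x # ys))"
    by (simp add: sum.reindex case_prod_unfold)
  thus ?thesis by (simp add: sum.cartesian_product)
qed

lemma sum_outcomes: "(\<Sum>x\<in>outcomes D. f x) = (\<Sum>\<omega>\<in>UNIV. \<Sum>\<xi>\<in>Xi D \<omega>. f (\<omega>, \<xi>))"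
  unfolding outcomes_def by (subst sum.Sigma) (simp_all add: case_prod_unfold)

lemma exp_birkhoff_sum:
  assumes "length xs = N" "stake N x = xs"
  shows "exp (- (\<Sum>\<omega>\<in>UNIV. \<alpha> \<omega> * birkhoff_sum N (entropy_flux \<omega>) x)) = path_weight \<alpha> xs"
  unfolding birkhoff_sum_entropy_flux[OF assms] using assms(1)
  by (simp add: path_weight_def exp_sum weight_def flip: sum_negf)

text \<open>The cylinder formula before taking real parts, with a free initial operator: the first
  outcome can then be absorbed into \<rho>, which permits recursion on the path.\<close>

definition path_trace :: "'w outcome list \<Rightarrow> complex mat \<Rightarrow> complex" where
  "path_trace xs \<rho> = complex_of_real (\<Prod>i<length xs - 1. P_mat D (fst (xs ! i)) (fst (xs ! Suc i))) *
     mat_tr (fold (\<lambda>(\<omega>, \<xi>) \<rho>. L_xi D \<omega> \<xi> \<rho>) xs \<rho>)"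

lemma cylinder_prob_path_trace: "cylinder_prob D R\<^sub>0 xs = Re (path_trace xs (R\<^sub>0 (fst (hd xs))))"
  by (simp add: cylinder_prob_def path_trace_def del: of_real_prod)

text \<open>Two outcomes have to be exposed, because a transition probability stands between
  consecutive outcomes and a path of length one carries none.\<close>

lemma path_trace_Cons:
  "path_trace ((\<omega>, \<xi>) # y # ys) \<rho> = complex_of_real (P_mat D \<omega> (fst y)) * path_trace (y # ys) (L_xi D \<omega> \<xi> \<rho>)"
  by (simp add: path_trace_def prod.lessThan_Suc_shift del: prod.lessThan_Suc)

text \<open>
  The sum runs over the outcomes of \<open>Suc N\<close> interactions, the first one with probe \<open>\<omega>\<close>; performing it from
  the last interaction backwards produces the Heisenberg iterates.
\<close>

lemma sum_path_trace:
  assumes "\<rho> \<in> carrier_mat m m"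
  shows "(\<Sum>\<xi>\<in>Xi D \<omega>. \<Sum>ys\<in>paths N. complex_of_real (path_weight \<alpha> ((\<omega>, \<xi>) # ys)) * path_trace ((\<omega>, \<xi>) # ys) \<rho>) =
    mat_tr (heis_iter \<alpha> (Suc N) \<omega> * \<rho>)"
  using assms
proof (induction N arbitrary: \<omega> \<rho>)
  case 0
  have "(\<Sum>\<xi>\<in>Xi D \<omega>. \<Sum>ys\<in>paths 0. complex_of_real (path_weight \<alpha> ((\<omega>, \<xi>) # ys)) * path_trace ((\<omega>, \<xi>) # ys) \<rho>) =
     (\<Sum>\<xi>\<in>Xi D \<omega>. complex_of_real (weight (\<alpha> \<omega>) \<xi>) * mat_tr (L_xi D \<omega> \<xi> \<rho>))"
    by (simp add: paths_def path_trace_def cong: conj_cong)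
  also have "\<dots> = mat_tr (1\<^sub>m m * tilted_L (\<alpha> \<omega>) \<omega> \<rho>)"
    by (subst mat_tr_mult_tilted_L) (simp_all add: left_mult_one_mat[of _ m m])
  \<comment> \<open>A single outcome comes without transition probability; this agrees with
    \<open>heis\<close> because its \<open>mean_P\<close> acts here on the identity and fixes
    it.\<close>
  also have "\<dots> = mat_tr (heis_iter \<alpha> (Suc 0) \<omega> * \<rho>)"
    using 0 by (simp add: heis_def mean_P_one tilted_L_duality)
  finally show ?case .
next
  case (Suc N)
  have L: "L_xi D \<omega> \<xi> \<rho> \<in> carrier_mat m m" for \<xi> by simp
  have "(\<Sum>\<xi>\<in>Xi D \<omega>. \<Sum>ys\<in>paths (Suc N). complex_of_real (path_weight \<alpha> ((\<omega>, \<xi>) # ys)) * path_trace ((\<omega>, \<xi>) # ys) \<rho>) =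
    (\<Sum>\<xi>\<in>Xi D \<omega>. complex_of_real (weight (\<alpha> \<omega>) \<xi>) * (\<Sum>\<nu>\<in>UNIV. complex_of_real (P_mat D \<omega> \<nu>) *
       (\<Sum>\<xi>'\<in>Xi D \<nu>. \<Sum>ys\<in>paths N. complex_of_real (path_weight \<alpha> ((\<nu>, \<xi>') # ys)) * path_trace ((\<nu>, \<xi>') # ys) (L_xi D \<omega> \<xi> \<rho>))))"
    by (simp add: sum_paths_Suc sum_outcomes path_trace_Cons sum_distrib_left mult_ac)
  also have "\<dots> = (\<Sum>\<xi>\<in>Xi D \<omega>. complex_of_real (weight (\<alpha> \<omega>) \<xi>) * (\<Sum>\<nu>\<in>UNIV. complex_of_real (P_mat D \<omega> \<nu>) *
       mat_tr (heis_iter \<alpha> (Suc N) \<nu> * L_xi D \<omega> \<xi> \<rho>)))"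
    by (simp only: Suc.IH[OF L])
  also have "\<dots> = (\<Sum>\<xi>\<in>Xi D \<omega>. complex_of_real (weight (\<alpha> \<omega>) \<xi>) * mat_tr (mean_P (heis_iter \<alpha> (Suc N)) \<omega> * L_xi D \<omega> \<xi> \<rho>))"
    by (subst mat_tr_mean_P_mult) simp_all
  also have "\<dots> = mat_tr (heis_iter \<alpha> (Suc (Suc N)) \<omega> * \<rho>)"
    using Suc.prems by (simp add: heis_def[of \<alpha> "heis \<alpha> (heis_iter \<alpha> N)"] tilted_L_duality mat_tr_mult_tilted_L)
  finally show ?case .
qed

text \<open>The integrand depends only on the first N + 1 outcomes, which take finitely many values,
  so it is a finite combination of cylinder indicators. The index is \<open>Suc N\<close> because
  cylinder probabilities are prescribed for nonempty words.\<close>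

lemma integral_full_statistics:
  assumes R: "pcone R\<^sub>0" and Q: "full_statistics D R\<^sub>0 Q"
  shows "(\<integral>x. exp (- (\<Sum>\<omega>\<in>UNIV. \<alpha> \<omega> * birkhoff_sum (Suc N) (entropy_flux \<omega>) x)) \<partial>Q) = tr_pair (heis_iter \<alpha> (Suc N)) R\<^sub>0"
proof -
  have prob: "prob_space Q" and sets: "sets Q = sets (stream_space (count_space (outcomes D)))"
    and cyl: "\<And>xs. xs \<noteq> [] \<Longrightarrow> set xs \<subseteq> outcomes D \<Longrightarrow>
        measure Q {x \<in> space Q. stake (length xs) x = xs} = cylinder_prob D R\<^sub>0 xs"
    using Q by (auto simp: full_statistics_def)
  interpret prob_space Q by (rule prob)
  have space: "space Q = streams (outcomes D)"
    using sets_eq_imp_space_eq[OF sets] by (simp add: space_stream_space)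
  have Rc: "R\<^sub>0 \<omega> \<in> carrier_mat m m" for \<omega> using R by (simp add: pcone_def)
  let ?cyl = "\<lambda>xs. {x \<in> space Q. stake (length xs) x = xs}"
  have meas: "?cyl xs \<in> sets Q" for xs
  proof -
    have snth: "(\<lambda>x. x !! i) \<in> measurable Q (count_space (outcomes D))" for i
      unfolding measurable_cong_sets[OF sets refl] by measurable
    have "?cyl xs = space Q \<inter> (\<Inter>i\<in>{..<length xs}. {x \<in> space Q. x !! i \<in> {xs ! i}})"
      by (auto simp: list_eq_iff_nth_eq)
    also have "\<dots> = space Q \<inter> (\<Inter>i\<in>{..<length xs}. (\<lambda>x. x !! i) -` ({xs ! i} \<inter> outcomes D) \<inter> space Q)"
      by (auto simp: space dest: snth_in)
    also have "\<dots> \<in> sets Q"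
    \<comment> \<open>For the empty word the intersection over no indices is the whole type; the
      factor \<open>space Q\<close> in front takes care of this case.\<close>
    proof (cases "length xs = 0")
      case False
      have "(\<Inter>i\<in>{..<length xs}. (\<lambda>x. x !! i) -` ({xs ! i} \<inter> outcomes D) \<inter> space Q) \<in> sets Q"
      proof (rule sets.finite_INT)
        show "(\<lambda>x. x !! i) -` ({xs ! i} \<inter> outcomes D) \<inter> space Q \<in> sets Q" for i
          by (rule measurable_sets[OF snth]) simp
      qed (use False in auto)
      thus ?thesis by (rule sets.Int[OF sets.top])
    qed simp
    finally show ?thesis .
  qed
  have "(\<integral>x. exp (- (\<Sum>\<omega>\<in>UNIV. \<alpha> \<omega> * birkhoff_sum (Suc N) (entropy_flux \<omega>) x)) \<partial>Q) =
      (\<integral>x. (\<Sum>xs\<in>paths (Suc N). path_weight \<alpha> xs * indicator (?cyl xs) x) \<partial>Q)"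
  proof (rule Bochner_Integration.integral_cong)
    fix x assume x: "x \<in> space Q"
    let ?xs = "stake (Suc N) x"
    have mem: "?xs \<in> paths (Suc N)"
      using snth_in[OF x[unfolded space]] by (auto simp: paths_def in_set_conv_nth simp del: stake.simps) metis
    have "(\<Sum>xs\<in>paths (Suc N). path_weight \<alpha> xs * indicator (?cyl xs) x) =
       (\<Sum>xs\<in>paths (Suc N). if xs = ?xs then path_weight \<alpha> xs else 0)"
      using x by (intro sum.cong) (auto simp: paths_def indicator_def)
    also have "\<dots> = path_weight \<alpha> ?xs" using mem finite_paths by simp
    finally show "exp (- (\<Sum>\<omega>\<in>UNIV. \<alpha> \<omega> * birkhoff_sum (Suc N) (entropy_flux \<omega>) x)) =
        (\<Sum>xs\<in>paths (Suc N). path_weight \<alpha> xs * indicator (?cyl xs) x)"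
      using exp_birkhoff_sum[of ?xs "Suc N" x \<alpha>] by simp
  qed simp
  also have "\<dots> = (\<Sum>xs\<in>paths (Suc N). path_weight \<alpha> xs * measure Q (?cyl xs))"
    using meas by (subst Bochner_Integration.integral_sum) (auto simp: emeasure_eq_measure)
  also have "\<dots> = (\<Sum>xs\<in>paths (Suc N). path_weight \<alpha> xs * cylinder_prob D R\<^sub>0 xs)"
  proof (intro sum.cong refl)
    fix xs assume "xs \<in> paths (Suc N)"
    hence xs: "xs \<noteq> []" "set xs \<subseteq> outcomes D" by (auto simp: paths_def)
    show "path_weight \<alpha> xs * measure Q (?cyl xs) = path_weight \<alpha> xs * cylinder_prob D R\<^sub>0 xs"
      using cyl[OF xs] by (rule arg_cong)
  qed
  also have "\<dots> = Re (\<Sum>xs\<in>paths (Suc N). complex_of_real (path_weight \<alpha> xs) * path_trace xs (R\<^sub>0 (fst (hd xs))))"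
    by (simp add: cylinder_prob_path_trace)
  also have "(\<Sum>xs\<in>paths (Suc N). complex_of_real (path_weight \<alpha> xs) * path_trace xs (R\<^sub>0 (fst (hd xs)))) =
      (\<Sum>\<omega>\<in>UNIV. mat_tr (heis_iter \<alpha> (Suc N) \<omega> * R\<^sub>0 \<omega>))"
    by (simp only: sum_paths_Suc sum_outcomes list.sel fst_conv sum_path_trace[OF Rc])
  finally show ?thesis by (simp add: tr_pair_def)
qed

end

text \<open>\<open>e_fun\<close> is a \<open>lim\<close>, which is informative only for convergent
  sequences; the third conjunct provides the convergence, so that the first two speak of genuine
  limits.\<close>

theorem theorem4p4:
  fixes D :: "'w::finite ris"
    and R\<^sub>0 :: "'w \<Rightarrow> complex mat"
    and Q :: "'w outcome stream measure"
  assumes "is_ris D"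
    and "irreducible_map D (ext_L D)"
    and "time_reversal_invariant D"
    and "detailed_balance D"
    and "R\<^sub>0 \<in> ext_states D"
    and "full_statistics D R\<^sub>0 Q"
  shows "(\<forall>s. rate_fun Q (\<lambda>\<omega>. - s \<omega>) = rate_fun Q s + ereal (\<Sum>\<omega>\<in>UNIV. s \<omega>))
    \<and> (\<forall>\<alpha>. e_fun Q (\<lambda>\<omega>. 1 - \<alpha> \<omega>) = e_fun Q \<alpha>)
    \<and> (\<forall>\<alpha>. (\<lambda>N. scaled_cumulant Q N \<alpha>) \<longlonglongrightarrow> e_fun Q \<alpha>)"
proof -
  interpret thermal_ris D by standard (rule assms(1))
  have R: "pcone R\<^sub>0"
    using assms(5) by (auto simp: ext_states_def ext_obs_def pcone_def)
  have R1: "(\<Sum>\<omega>\<in>UNIV. mat_tr (R\<^sub>0 \<omega>)) = 1"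
    using assms(5) by (auto simp: ext_states_def)
  interpret prob_space Q using assms(6) by (simp add: full_statistics_def)
  note int = integral_full_statistics[OF R assms(6)]
  \<comment> \<open>Conservation of the total trace is read off from the total mass of
    \<open>Q\<close>, since at zero tilt the integrand is 1. At time 0 it is the normalisation of
    \<open>R\<^sub>0\<close>.\<close>
  have norm: "tr_pair (heis_iter (\<lambda>_. 0) N) R\<^sub>0 = 1" for N
  proof (cases N)
    case 0
    have "tr_pair (\<lambda>_. 1\<^sub>m (dim_S D)) R\<^sub>0 = Re (\<Sum>\<omega>\<in>UNIV. mat_tr (R\<^sub>0 \<omega>))"
      using R by (simp add: tr_pair_def pcone_def left_mult_one_mat[of _ "dim_S D" "dim_S D"])
    thus ?thesis using R1 0 by simp
  next
    case (Suc M)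
    show ?thesis using int[of "\<lambda>_. 0" M] by (simp add: Suc prob_space del: heis_iter_Suc)
  qed
  \<comment> \<open>For \<open>N = 0\<close> both sides vanish, as division by zero yields
    0.\<close>
  have cumulant: "scaled_cumulant Q N \<alpha> = ln (tr_pair (heis_iter \<alpha> N) R\<^sub>0) / real N" for N \<alpha>
    by (cases N) (simp_all add: scaled_cumulant_def int del: heis_iter_Suc)
  have lim: "(\<lambda>N. scaled_cumulant Q N \<alpha>) \<longlonglongrightarrow> e_fun Q \<alpha> \<and> e_fun Q (\<lambda>\<omega>. 1 - \<alpha> \<omega>) = e_fun Q \<alpha>" for \<alpha>
  proof -
    obtain L where L: "(\<lambda>N. ln (tr_pair (heis_iter \<alpha> N) R\<^sub>0) / real N) \<longlonglongrightarrow> L"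
        "(\<lambda>N. ln (tr_pair (heis_iter (\<lambda>\<omega>. 1 - \<alpha> \<omega>) N) R\<^sub>0) / real N) \<longlonglongrightarrow> L"
      by (rule growth_rate_symmetry[OF assms(2,3,4) R norm])
    have "e_fun Q \<alpha> = L" "e_fun Q (\<lambda>\<omega>. 1 - \<alpha> \<omega>) = L"
      unfolding e_fun_def cumulant by (rule limI, rule L)+
    thus ?thesis unfolding cumulant using L(1) by simp
  qed
  have "rate_fun Q (\<lambda>\<omega>. - s \<omega>) = rate_fun Q s + ereal (\<Sum>\<omega>\<in>UNIV. s \<omega>)" for s :: "'w \<Rightarrow> real"
  proof -
    let ?F = "\<lambda>s \<alpha>. ereal ((\<Sum>\<omega>\<in>UNIV. \<alpha> \<omega> * s \<omega>) - e_fun Q (\<lambda>\<omega>. - \<alpha> \<omega>))"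
    \<comment> \<open>The reflection of the tilt, written in the sign convention of
      \<open>rate_fun\<close>, is the involution \<alpha> to -1 - \<alpha>: it leaves the
      \<open>e_fun\<close> term unchanged, and (-1 - \<alpha>) paired with -s exceeds \<alpha>
      paired with s by the sum of s.\<close>
    have shift: "?F (\<lambda>\<omega>. - s \<omega>) (\<lambda>\<omega>. - 1 - \<alpha> \<omega>) = ?F s \<alpha> + ereal (\<Sum>\<omega>\<in>UNIV. s \<omega>)" for \<alpha> :: "'w \<Rightarrow> real"
    proof -
      have "e_fun Q (\<lambda>\<omega>. 1 - - \<alpha> \<omega>) = e_fun Q (\<lambda>\<omega>. - \<alpha> \<omega>)"
        using lim[of "\<lambda>\<omega>. - \<alpha> \<omega>"] by (rule conjunct2)
      thus ?thesis by (simp add: algebra_simps sum.distrib sum_subtractf sum_negf)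
    qed
    have surj: "range (\<lambda>\<alpha> \<omega>. - 1 - \<alpha> \<omega>) = (UNIV :: ('w \<Rightarrow> real) set)"
    proof (rule surjI)
      fix \<alpha> :: "'w \<Rightarrow> real"
      show "(\<lambda>\<omega>. - 1 - (- 1 - \<alpha> \<omega>)) = \<alpha>" by simp
    qed
    have "rate_fun Q (\<lambda>\<omega>. - s \<omega>) = (SUP \<alpha>\<in>range (\<lambda>\<alpha> \<omega>. - 1 - \<alpha> \<omega>). ?F (\<lambda>\<omega>. - s \<omega>) \<alpha>)"
      unfolding rate_fun_def surj ..
    also have "\<dots> = (SUP \<alpha>. ?F s \<alpha> + ereal (\<Sum>\<omega>\<in>UNIV. s \<omega>))"
      by (simp only: image_image shift)
    also have "\<dots> = rate_fun Q s + ereal (\<Sum>\<omega>\<in>UNIV. s \<omega>)"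
      unfolding rate_fun_def by (rule SUP_ereal_add_left) simp_all
    finally show ?thesis .
  qed
  thus ?thesis using lim by blast
qed

end
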